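(* Let $k,l,m,n,\rho$ be positive integers with $k<m$, $l<n$ and $\min\{k,l\}\ge\rho+2\ge4$. Let $H_1\in\mathbb R^{m\times\rho}$ and $H_2\in\mathbb R^{\rho\times n}$ be independent Gaussian matrices, let $\Sigma$ be a constant $\rho\times\rho$ matrix of full rank $\rho$, and let $M':=H_1\Sigma H_2$. Fix index sets $\mathcal I\subseteq\{1,\dots,m\}$ and $\mathcal J\subseteq\{1,\dots,n\}$ of cardinality $k$ and $l$, respectively. Let $$\alpha:=\frac{e^2\sqrt{kl}}{(k-\rho)(l-\rho)},\qquad \beta:=\max\big\{(\sqrt m+\sqrt\rho)(\sqrt\rho+\sqrt l),\ (\sqrt n+\sqrt\rho)(\sqrt\rho+\sqrt k)\big\},$$ let $0<\epsilon\le\frac{\sigma_\rho(\Sigma)}{30\alpha}$, and let $E\in\mathbb R^{m\times n}$ satisfy $\|E\|\le\epsilon$. Put $M:=M'+E$, $C:=M_{:,\mathcal J}$, $R:=M_{\mathcal I,:}$, $U:=\big((M_{\mathcal I,\mathcal J})_\rho\big)^+$, and $\zeta:=(1+\sqrt5)/2$. Then, with a probability no less than $0.6$, $$\|M-CUR\|\le\big(4\zeta(v+1)+2\big)(v+1)\,\epsilon\qquad\text{for } v=150\,\alpha\beta\,\sigma_1(\Sigma)/\sigma_\rho(\Sigma)+1/2,$$ where $4\zeta\le2+2\sqrt5$.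
   Context: All matrices are real. A Gaussian matrix is one filled with independent identically distributed standard normal random variables. $e=2.71828\dots$; $\|\cdot\|$ is the spectral norm; $\sigma_j(A)$ is the $j$-th largest singular value. $M_{\mathcal I,:}$, $M_{:,\mathcal J}$, $M_{\mathcal I,\mathcal J}$ are the submatrices of $M$ formed by the rows in $\mathcal I$, the columns in $\mathcal J$, and both. $A_\rho$ is obtained from an SVD of $A$ by setting to $0$ all singular values except the $\rho$ largest. $A^+$ is the Moore–Penrose pseudo inverse. *)

theory Defs
  imports "HOL-Probability.Probability"
begin

text \<open>An \<open>m \<times> n\<close> real matrix is an element of \<^typ>\<open>real ^ 'n ^ 'm\<close>.\<close>

definition spectral_norm :: "real ^ 'n ^ 'm \<Rightarrow> real" where
  "spectral_norm A = onorm ((*v) A)"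

text \<open>
  Singular value decomposition \<open>A = \<Sum>i. s\<^sub>i u\<^sub>i v\<^sub>i\<^sup>T\<close>, summed over \<open>1 \<le> i \<le> min m n\<close>:
  the index types carry no order, so singular values and singular vectors are indexed by
  \<open>1, \<dots>, min m n\<close>. Values outside this range are irrelevant.
\<close>

definition svd_dim :: "real ^ 'n ^ 'm \<Rightarrow> nat" where
  "svd_dim A = min CARD('m) CARD('n)"

definition svd_sum ::
    "nat \<Rightarrow> (nat \<Rightarrow> real ^ 'm) \<Rightarrow> (nat \<Rightarrow> real) \<Rightarrow> (nat \<Rightarrow> real ^ 'n) \<Rightarrow> real ^ 'n ^ 'm" where
  "svd_sum d u s v = (\<Sum>i=1..d. s i *\<^sub>R (\<chi> a b. u i $ a * v i $ b))"

definition is_svd ::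
    "real ^ 'n ^ 'm \<Rightarrow> (nat \<Rightarrow> real ^ 'm) \<Rightarrow> (nat \<Rightarrow> real) \<Rightarrow> (nat \<Rightarrow> real ^ 'n) \<Rightarrow> bool" where
  "is_svd A u s v \<longleftrightarrow>
     (\<forall>i\<in>{1..svd_dim A}. \<forall>j\<in>{1..svd_dim A}. u i \<bullet> u j = (if i = j then 1 else 0)) \<and>
     (\<forall>i\<in>{1..svd_dim A}. \<forall>j\<in>{1..svd_dim A}. v i \<bullet> v j = (if i = j then 1 else 0)) \<and>
     (\<forall>i\<in>{1..svd_dim A}. 0 \<le> s i) \<and>
     (\<forall>i\<in>{1..svd_dim A}. \<forall>j\<in>{1..svd_dim A}. i \<le> j \<longrightarrow> s j \<le> s i) \<and>
     A = svd_sum (svd_dim A) u s v"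

text \<open>The \<open>j\<close>-th largest singular value, for \<open>1 \<le> j \<le> min m n\<close>; all SVDs of \<open>A\<close> share the
  same \<open>s\<^sub>j\<close>.\<close>

definition singular_value :: "nat \<Rightarrow> real ^ 'n ^ 'm \<Rightarrow> real" where
  "singular_value j A = (THE t. \<exists>u s v. is_svd A u s v \<and> t = s j)"

text \<open>
  \<open>B\<close> is a truncation \<open>A\<^sub>r\<close> of \<open>A\<close>. This is a relation because different SVDs of \<open>A\<close> may give
  different truncations when the \<open>r\<close>-th and \<open>(r + 1)\<close>-st singular values coincide.
\<close>

definition is_truncation :: "nat \<Rightarrow> real ^ 'n ^ 'm \<Rightarrow> real ^ 'n ^ 'm \<Rightarrow> bool" where
  "is_truncation r A B \<longleftrightarrow>
     (\<exists>u s v. is_svd A u s v \<and> B = svd_sum (min r (svd_dim A)) u s v)"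

text \<open>Moore--Penrose pseudo inverse: the unique solution of the four Penrose equations.\<close>

definition pinv :: "real ^ 'n ^ 'm \<Rightarrow> real ^ 'm ^ 'n" where
  "pinv A = (THE X. A ** X ** A = A \<and> X ** A ** X = X \<and>
     transpose (A ** X) = A ** X \<and> transpose (X ** A) = X ** A)"

text \<open>
  Submatrices with rows \<open>range p\<close> and columns \<open>range q\<close>. The injections \<open>p\<close>, \<open>q\<close> list the selected
  indices, since the type of the submatrix has to provide its own row and column index types.
\<close>

definition row_submatrix :: "('k \<Rightarrow> 'm) \<Rightarrow> real ^ 'n ^ 'm \<Rightarrow> real ^ 'n ^ 'k" where
  "row_submatrix p A = (\<chi> i j. A $ p i $ j)"

definition col_submatrix :: "('l \<Rightarrow> 'n) \<Rightarrow> real ^ 'n ^ 'm \<Rightarrow> real ^ 'l ^ 'm" where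
  "col_submatrix q A = (\<chi> i j. A $ i $ q j)"

definition submatrix :: "('k \<Rightarrow> 'm) \<Rightarrow> ('l \<Rightarrow> 'n) \<Rightarrow> real ^ 'n ^ 'm \<Rightarrow> real ^ 'l ^ 'k" where
  "submatrix p q A = (\<chi> i j. A $ p i $ q j)"

definition gaussian_matrix :: "'w measure \<Rightarrow> ('w \<Rightarrow> real ^ 'n ^ 'm) \<Rightarrow> bool" where
  "gaussian_matrix P H \<longleftrightarrow>
     prob_space.indep_vars P (\<lambda>_. borel) (\<lambda>(i, j) \<omega>. H \<omega> $ i $ j) UNIV \<and>
     (\<forall>i j. distributed P lborel (\<lambda>\<omega>. H \<omega> $ i $ j) std_normal_density)"

text \<open>
  The library's \<open>indep_var\<close> needs both random variables to have the same value type. This is its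
  characterisation \<open>indep_var_eq\<close> for two different value types.
\<close>

definition indep_rvs ::
    "'w measure \<Rightarrow> 'a measure \<Rightarrow> ('w \<Rightarrow> 'a) \<Rightarrow> 'b measure \<Rightarrow> ('w \<Rightarrow> 'b) \<Rightarrow> bool" where
  "indep_rvs P S X T Y \<longleftrightarrow>
     X \<in> measurable P S \<and> Y \<in> measurable P T \<and>
     prob_space.indep_set P
       (sigma_sets (space P) {X -` A \<inter> space P | A. A \<in> sets S})
       (sigma_sets (space P) {Y -` A \<inter> space P | A. A \<in> sets T})"

end

theory Submission imports Defs begin

text \<open>
Let \<open>A\<close> and \<open>W = A + F\<close> be the sampled blocks of \<open>M' = H\<^sub>1 \<Sigma> H\<^sub>2\<close> and of \<open>M\<close>, let \<open>G\<^sub>1\<close> be the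
selected rows of \<open>H\<^sub>1\<close> and \<open>G\<^sub>2\<close> the selected columns of \<open>H\<^sub>2\<close>, so that \<open>A = G\<^sub>1 \<Sigma> G\<^sub>2\<close>. The proof has a
deterministic half and a probabilistic half.

Deterministic half. If \<open>G\<^sub>1\<close> and the transpose of \<open>G\<^sub>2\<close> stretch every vector by at least \<open>s\<^sub>1\<close> and
\<open>s\<^sub>2\<close>, then the \<open>\<rho>\<close>-th singular value of \<open>A\<close> is at least \<open>\<tau> = s\<^sub>1 s\<^sub>2 \<sigma>\<^sub>\<rho>(\<Sigma>)\<close>. As \<open>A\<close> has rank
\<open>\<rho>\<close>, a perturbation by \<open>\<epsilon> \<le> \<tau> / 3\<close> leaves a gap: the \<open>\<rho>\<close>-th singular value of \<open>W\<close> is at least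
\<open>\<tau> - \<epsilon>\<close>, the next one at most \<open>\<epsilon>\<close>. Hence \<open>U\<close> has norm at most \<open>1 / (\<tau> - \<epsilon>)\<close>, the products
\<open>W U\<close> and \<open>U W\<close> are orthogonal projections, and \<open>W\<close> differs from \<open>W U W\<close> by at most \<open>\<epsilon>\<close>
(lemma \<open>truncation_pinv_properties\<close>). A generalised inverse \<open>Z\<close> of \<open>A\<close> with norm at most \<open>1 / \<tau>\<close>
yields \<open>M' = L A K\<close>, where \<open>L A\<close> and \<open>A K\<close> are the selected columns and rows of \<open>M'\<close>. Substituting
these into \<open>M - C U R\<close> leaves only terms that contain a factor of size \<open>\<epsilon>\<close>, with total at most
\<open>(9/2 v\<^sup>2 + 3 v + 3/2) \<epsilon>\<close> for any bound \<open>v\<close> on the norms of \<open>L\<close> and \<open>K\<close> (lemmas \<open>cur_error_bound\<close>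
and \<open>cur_error_bound_of_factorization\<close>).
With \<open>v = 100 \<alpha> \<beta> \<sigma>\<^sub>1(\<Sigma>) / \<sigma>\<^sub>\<rho>(\<Sigma>)\<close>, that is \<open>\<nu> = 3/2 v + 1/2\<close>, this is below the
claimed bound.

Probabilistic half. It remains to bound above the norms of four Gaussian matrices and to bound
below the least singular values of two. Both rest on the following averaging argument. Let \<open>x\<close> be
an additional Gaussian vector. A matrix \<open>G\<close> with norm above \<open>T\<close> has \<open>|G x| \<ge> |\<langle>x, w\<rangle>|\<close> for some
\<open>w\<close> longer than \<open>T\<close>, so that averaging \<open>|G x|\<close> to the power \<open>2 j\<close> over \<open>x\<close> gives at least
\<open>T\<^bsup>2j\<^esup>\<close> times a moment of the normal distribution. Averaging over \<open>G\<close> first gives a product of two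
chi-square moments instead, and comparing the two averages bounds the probability of such \<open>G\<close>
(lemma \<open>gauss_norm_tail\<close>). For the least singular value the quadratic form
\<open>x\<^sup>T (G\<^sup>T G)\<^bsup>-1\<^esup> x\<close> takes the place of \<open>|G x|\<^sup>2\<close>. For fixed \<open>x\<close> it is \<open>|x|\<^sup>2\<close> divided by a squared
distance of a Gaussian vector from a subspace, so that inverse chi-square moments enter (lemma
\<open>gauss_small_tail\<close>). The four norm bounds fail with probability at most 0.03 each, the other two
with probability at most 0.1 each, and 0.12 + 0.2 is less than 0.4.
\<close>

section \<open>Gaussian measure on Euclidean spaces\<close>

text \<open>
The standard Gaussian measure. A matrix type \<open>real ^ 'r ^ 'k\<close> is itself a Euclidean space, whose
coordinates are the matrix entries, so the same constant describes Gaussian vectors, Gaussian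
matrices and pairs of them.
\<close>

definition gauss :: "'a::euclidean_space measure" where
  "gauss = density lborel (\<lambda>x. ennreal (\<Prod>b\<in>Basis. std_normal_density (x \<bullet> b)))"

text \<open>
Rotation invariance of \<open>gauss\<close> comes from this form of the density.
\<close>

lemma gauss_density_eq_norm:
  fixes x :: "'a::euclidean_space"
  shows "(\<Prod>b\<in>Basis. std_normal_density (x \<bullet> b)) = (1 / sqrt (2 * pi)) ^ DIM('a) * exp (- (norm x)\<^sup>2 / 2)"
proof -
  have "(\<Prod>b\<in>Basis. std_normal_density (x \<bullet> b)) = (1 / sqrt (2 * pi)) ^ DIM('a) * exp (\<Sum>b\<in>Basis. - (x \<bullet> b)\<^sup>2 / 2)"
    by (simp add: std_normal_density_def prod.distrib exp_sum prod_dividef power_divide)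
  also have "(\<Sum>b\<in>Basis. - (x \<bullet> b)\<^sup>2 / 2) = - (norm x)\<^sup>2 / 2"
    by (simp add: euclidean_inner[of x x] power2_norm_eq_inner sum_negf flip: sum_divide_distrib power2_eq_square)
  finally show ?thesis .
qed

lemma sets_gauss [measurable_cong, simp]: "sets gauss = sets borel"
  by (simp add: gauss_def)

lemma space_gauss [simp]: "space gauss = UNIV"
  by (simp add: gauss_def)

lemma nn_integral_gauss:
  assumes [measurable]: "h \<in> borel_measurable borel"
  shows "(\<integral>\<^sup>+x. h x \<partial>gauss) = (\<integral>\<^sup>+x. ennreal (\<Prod>b\<in>Basis. std_normal_density (x \<bullet> b)) * h x \<partial>lborel)"
  unfolding gauss_def by (rule nn_integral_density) simp_all

lemma nn_integral_std_normal: "(\<integral>\<^sup>+x. ennreal (std_normal_density x) \<partial>lborel) = 1"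
  using prob_space.emeasure_space_1[OF prob_space_normal_density[of 1 0]]
  by (simp add: emeasure_density)

lemma nn_integral_gauss_prod:
  fixes f :: "'a::euclidean_space \<Rightarrow> real \<Rightarrow> real"
  assumes [measurable]: "\<And>b. b \<in> Basis \<Longrightarrow> f b \<in> borel_measurable borel"
    and nn: "\<And>b x. b \<in> Basis \<Longrightarrow> 0 \<le> f b x"
  shows "(\<integral>\<^sup>+x. ennreal (\<Prod>b\<in>Basis. f b (x \<bullet> b)) \<partial>gauss) =
    (\<Prod>b\<in>Basis. \<integral>\<^sup>+x. ennreal (std_normal_density x * f b x) \<partial>lborel)"
proof -
  have "(\<integral>\<^sup>+x. ennreal (\<Prod>b\<in>Basis. f b (x \<bullet> b)) \<partial>gauss)
    = (\<integral>\<^sup>+x. (\<Prod>b\<in>Basis. ennreal (std_normal_density (x \<bullet> b) * f b (x \<bullet> b))) \<partial>lborel)"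
    by (subst nn_integral_gauss)
       (auto simp: ennreal_mult[symmetric] prod_nonneg nn prod.distrib[symmetric] prod_ennreal intro!: nn_integral_cong)
  also have "\<dots> = (\<Prod>b\<in>Basis. \<integral>\<^sup>+x. ennreal (std_normal_density x * f b x) \<partial>lborel)"
    by (rule nn_integral_lborel_prod[where f="\<lambda>b x. ennreal (std_normal_density x * f b x)"]) auto
  finally show ?thesis .
qed

lemma prob_space_gauss: "prob_space (gauss :: 'a::euclidean_space measure)"
proof
  have "(\<integral>\<^sup>+x. ennreal (\<Prod>b\<in>(Basis::'a set). (\<lambda>_ _. 1) b (x \<bullet> b)) \<partial>gauss) = 1"
    by (subst nn_integral_gauss_prod) (auto simp: nn_integral_std_normal)
  then show "emeasure gauss (space (gauss :: 'a measure)) = 1"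
    by (simp del: space_gauss)
qed

text \<open>
The uniqueness argument for Haar measure, with the unit ball \<open>B\<close> as reference set. By translation
invariance, the integral of \<open>1\<^sub>B(y) 1\<^sub>A(f x + y)\<close> over \<open>x\<close> and \<open>y\<close> is the measure of \<open>B\<close> times the
measure of the preimage of \<open>A\<close>. Substituting \<open>y - f x\<close> for \<open>y\<close> and integrating over \<open>x\<close> first turns it
into the measure of \<open>B\<close> times that of \<open>A\<close>, because \<open>f\<close> preserves the ball.
\<close>

lemma distr_lborel_orthogonal:
  fixes f :: "'a::euclidean_space \<Rightarrow> 'a"
  assumes f: "orthogonal_transformation f"
  shows "distr lborel borel f = lborel"
proof -
  have lin: "linear f" using f by (rule orthogonal_transformation_linear)
  have [measurable]: "f \<in> borel_measurable borel"
    by (intro borel_measurable_continuous_onI linear_continuous_on linear_conv_bounded_linear[THEN iffD1] lin)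
  define B :: "'a set" where "B = ball 0 1"
  have [measurable]: "B \<in> sets borel" by (simp add: B_def)
  have trans: "(\<integral>\<^sup>+x. h (x + a) \<partial>lborel) = (\<integral>\<^sup>+x. h x \<partial>lborel)"
    if [measurable]: "h \<in> borel_measurable borel" for h :: "'a \<Rightarrow> ennreal" and a
  proof -
    have "(\<integral>\<^sup>+x. h x \<partial>lborel) = (\<integral>\<^sup>+x. h x \<partial>(distr lborel borel ((+) a)))"
      by (simp add: lborel_distr_plus)
    also have "\<dots> = (\<integral>\<^sup>+x. h (a + x) \<partial>lborel)" by (subst nn_integral_distr) auto
    finally show ?thesis by (simp add: add.commute)
  qed
  have surj: "\<exists>z. f z = y" for y
    using orthogonal_transformation_surj[OF f] by (metis surj_def)
  have "emeasure (distr lborel borel f) A = emeasure lborel A" if [measurable]: "A \<in> sets borel" for A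
  proof -
    have "emeasure lborel B * emeasure (distr lborel borel f) A
       = (\<integral>\<^sup>+y. (indicator B y) * (\<integral>\<^sup>+x. indicator A (f x) \<partial>lborel) \<partial>lborel)"
      by (subst nn_integral_multc) (auto simp: mult.commute nn_integral_distr simp flip: nn_integral_indicator)
    also have "\<dots> = (\<integral>\<^sup>+y. (indicator B y) * (\<integral>\<^sup>+x. indicator A (f x + y) \<partial>lborel) \<partial>lborel)"
    proof (rule nn_integral_cong, rule arg_cong2[of _ _ _ _ "(*)", OF refl])
      fix y
      obtain z where z: "f z = y" using surj by blast
      have "(\<integral>\<^sup>+x. (indicator A (f x + y) :: ennreal) \<partial>lborel) = (\<integral>\<^sup>+x. indicator A (f (x + z)) \<partial>lborel)"
        by (simp add: linear_add[OF lin] z)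
      also have "\<dots> = (\<integral>\<^sup>+x. indicator A (f x) \<partial>lborel)"
        by (rule trans[where h="\<lambda>x. indicator A (f x)"]) simp
      finally show "(\<integral>\<^sup>+x. (indicator A (f x) :: ennreal) \<partial>lborel) = (\<integral>\<^sup>+x. indicator A (f x + y) \<partial>lborel)"
        by (rule sym)
    qed
    also have "\<dots> = (\<integral>\<^sup>+y. (\<integral>\<^sup>+x. indicator B y * indicator A (f x + y) \<partial>lborel) \<partial>lborel)"
      by (intro nn_integral_cong) (simp add: nn_integral_cmult)
    also have "\<dots> = (\<integral>\<^sup>+x. (\<integral>\<^sup>+y. indicator B y * indicator A (f x + y) \<partial>lborel) \<partial>lborel)"
      by (rule lborel_pair.Fubini') simp
    also have "\<dots> = (\<integral>\<^sup>+x. (\<integral>\<^sup>+y. indicator B (y - f x) * indicator A y \<partial>lborel) \<partial>lborel)"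
    proof (rule nn_integral_cong)
      fix x
      show "(\<integral>\<^sup>+y. indicator B y * indicator A (f x + y) \<partial>lborel)
          = (\<integral>\<^sup>+y. indicator B (y - f x) * indicator A y \<partial>lborel)"
        using trans[of "\<lambda>y. indicator B (y - f x) * indicator A y" "f x"] by (simp add: add.commute)
    qed
    also have "\<dots> = (\<integral>\<^sup>+y. (\<integral>\<^sup>+x. indicator B (y - f x) * indicator A y \<partial>lborel) \<partial>lborel)"
      by (rule lborel_pair.Fubini') simp
    also have "\<dots> = (\<integral>\<^sup>+y. emeasure lborel B * indicator A y \<partial>lborel)"
    proof (rule nn_integral_cong)
      fix y
      obtain z where z: "f z = y" using surj by blast
      have *: "indicator B (y - f x) = (indicator B (x + - z) :: ennreal)" for x
        using orthogonal_transformation_norm[OF f, of "z - x"]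
        by (simp add: B_def indicator_def dist_norm z[symmetric] linear_diff[OF lin] norm_minus_commute)
      have "(\<integral>\<^sup>+x. indicator B (y - f x) * indicator A y \<partial>lborel)
          = (\<integral>\<^sup>+x. indicator B (x + - z) \<partial>lborel) * indicator A y"
        unfolding * by (rule nn_integral_multc) simp
      also have "(\<integral>\<^sup>+x. indicator B (x + - z) \<partial>lborel) = emeasure lborel B"
        by (subst trans) auto
      finally show "(\<integral>\<^sup>+x. indicator B (y - f x) * indicator A y \<partial>lborel) = emeasure lborel B * indicator A y" .
    qed
    also have "\<dots> = emeasure lborel B * emeasure lborel A"
      by (simp add: nn_integral_cmult)
    finally have eq: "emeasure lborel B * emeasure (distr lborel borel f) A = emeasure lborel B * emeasure lborel A" .
    have "emeasure lborel B < \<infinity>" unfolding B_def by (intro emeasure_lborel_ball_finite)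
    moreover have "emeasure lborel B \<noteq> 0"
      unfolding B_def by (simp add: emeasure_ball less_imp_neq[OF unit_ball_vol_pos, symmetric])
    ultimately show ?thesis using eq ennreal_mult_left_cong
      by (metis ennreal_mult_cancel_left infinity_ennreal_def less_irrefl)
  qed
  then show ?thesis by (intro measure_eqI) auto
qed

lemma nn_integral_gauss_orthogonal:
  fixes f :: "'a::euclidean_space \<Rightarrow> 'a"
  assumes f: "orthogonal_transformation f" and [measurable]: "h \<in> borel_measurable borel"
  shows "(\<integral>\<^sup>+x. h (f x) \<partial>gauss) = (\<integral>\<^sup>+x. h x \<partial>gauss)"
proof -
  have [measurable]: "f \<in> borel_measurable borel"
    using orthogonal_transformation_linear[OF f]
    by (intro borel_measurable_continuous_onI linear_continuous_on) (simp add: linear_conv_bounded_linear)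
  have "(\<integral>\<^sup>+x. h x \<partial>gauss) = (\<integral>\<^sup>+x. ennreal (\<Prod>b\<in>Basis. std_normal_density (x \<bullet> b)) * h x \<partial>distr lborel borel f)"
    by (subst nn_integral_gauss) (simp_all add: distr_lborel_orthogonal[OF f])
  also have "\<dots> = (\<integral>\<^sup>+x. ennreal (\<Prod>b\<in>Basis. std_normal_density (f x \<bullet> b)) * h (f x) \<partial>lborel)"
    by (subst nn_integral_distr) simp_all
  also have "\<dots> = (\<integral>\<^sup>+x. h (f x) \<partial>gauss)"
    by (subst nn_integral_gauss) (simp_all add: gauss_density_eq_norm orthogonal_transformation_norm[OF f])
  finally show ?thesis ..
qed

lemma nn_integral_gauss_pair:
  fixes h :: "'a::euclidean_space \<times> 'b::euclidean_space \<Rightarrow> ennreal"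
  assumes [measurable]: "h \<in> borel_measurable borel"
  shows "(\<integral>\<^sup>+z. h z \<partial>gauss) = (\<integral>\<^sup>+x. (\<integral>\<^sup>+y. h (x, y) \<partial>gauss) \<partial>gauss)"
proof -
  have [measurable]: "h \<in> borel_measurable (borel \<Otimes>\<^sub>M borel)"
    by (simp add: borel_prod)
  have d: "(\<Prod>b\<in>Basis. std_normal_density ((x, y) \<bullet> b))
     = (\<Prod>b\<in>Basis. std_normal_density (x \<bullet> b)) * (\<Prod>b\<in>Basis. std_normal_density (y \<bullet> b))"
    for x :: 'a and y :: 'b
    unfolding gauss_density_eq_norm
    by (simp add: norm_Pair power_add exp_add[symmetric] add_divide_distrib ac_simps)
  have "(\<integral>\<^sup>+z. h z \<partial>gauss) = (\<integral>\<^sup>+z. ennreal (\<Prod>b\<in>Basis. std_normal_density (z \<bullet> b)) * h z \<partial>(lborel \<Otimes>\<^sub>M lborel))"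
    by (subst nn_integral_gauss) (simp_all add: lborel_prod)
  also have "\<dots> = (\<integral>\<^sup>+x. (\<integral>\<^sup>+y. ennreal (\<Prod>b\<in>Basis. std_normal_density ((x, y) \<bullet> b)) * h (x, y) \<partial>lborel) \<partial>lborel)"
    by (subst lborel.nn_integral_fst[symmetric]) (simp_all add: lborel_prod)
  also have "\<dots> = (\<integral>\<^sup>+x. ennreal (\<Prod>b\<in>Basis. std_normal_density (x \<bullet> b)) * (\<integral>\<^sup>+y. h (x, y) \<partial>gauss) \<partial>lborel)"
    by (intro nn_integral_cong)
       (simp add: d nn_integral_gauss ennreal_mult prod_nonneg mult.assoc nn_integral_cmult)
  also have "\<dots> = (\<integral>\<^sup>+x. (\<integral>\<^sup>+y. h (x, y) \<partial>gauss) \<partial>gauss)"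
  proof (rule nn_integral_gauss[symmetric])
    interpret prob_space "gauss :: 'b measure" by (rule prob_space_gauss)
    show "(\<lambda>x. \<integral>\<^sup>+y. h (x, y) \<partial>gauss) \<in> borel_measurable borel" by measurable
  qed
  finally show ?thesis .
qed

text \<open>
For a unit vector \<open>x\<close>, this is the matrix that maps \<open>x\<close> to \<open>g\<close> and agrees with \<open>G\<close> on the orthogonal
complement of \<open>x\<close>.
\<close>

definition replace_image :: "real ^ 'r \<Rightarrow> real ^ 'k \<Rightarrow> real ^ 'r ^ 'k \<Rightarrow> real ^ 'r ^ 'k" where
  "replace_image x g G = (\<chi> i. G $ i + (g $ i - G $ i \<bullet> x) *\<^sub>R x)"

lemma replace_image_mult_vec:
  "replace_image x g G *v y = (x \<bullet> y) *\<^sub>R g + G *v (y - (x \<bullet> y) *\<^sub>R x)"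
  by (simp add: vec_eq_iff matrix_vector_mul_component replace_image_def inner_add_left inner_diff_right algebra_simps)

text \<open>
Exchanging \<open>g\<close> with the image \<open>G x\<close> is an isometry of the space of pairs \<open>(g, G)\<close>, hence preserves
the Gaussian measure on it. The two components of this map give the two facts below: \<open>G x\<close> is a
Gaussian vector, and it can be resampled independently of the action of \<open>G\<close> on the orthogonal
complement of \<open>x\<close>.
\<close>

lemma orthogonal_transformation_replace_image:
  fixes x :: "real ^ 'r"
  assumes x: "norm x = 1"
  shows "orthogonal_transformation (\<lambda>(g :: real ^ 'k, G :: real ^ 'r ^ 'k). (G *v x, replace_image x g G))"
proof -
  have xx: "x \<bullet> x = 1" using x by (simp add: norm_eq_1)
  have "linear (\<lambda>(g :: real ^ 'k, G :: real ^ 'r ^ 'k). (G *v x, replace_image x g G))"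
    by (rule linearI)
       (auto simp: replace_image_def vec_eq_iff matrix_vector_mul_component inner_add_left algebra_simps)
  moreover have "norm (G *v x, replace_image x g G) = norm (g, G)" for g :: "real ^ 'k" and G :: "real ^ 'r ^ 'k"
  proof -
    have row: "(G $ i + (g $ i - G $ i \<bullet> x) *\<^sub>R x) \<bullet> (G $ i + (g $ i - G $ i \<bullet> x) *\<^sub>R x)
      = G $ i \<bullet> G $ i + g $ i * g $ i - (G $ i \<bullet> x) * (G $ i \<bullet> x)" for i
      by (simp add: inner_add_left inner_add_right xx inner_commute[of x "G $ i"] algebra_simps)
    have "replace_image x g G \<bullet> replace_image x g G = (\<Sum>i\<in>UNIV. G $ i \<bullet> G $ i + g $ i * g $ i - (G $ i \<bullet> x) * (G $ i \<bullet> x))"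
      by (subst inner_vec_def) (simp add: replace_image_def row)
    moreover have "(G *v x) \<bullet> (G *v x) = (\<Sum>i\<in>UNIV. (G $ i \<bullet> x) * (G $ i \<bullet> x))"
      by (subst inner_vec_def) (simp add: matrix_vector_mul_component)
    moreover have "G \<bullet> G = (\<Sum>i\<in>UNIV. G $ i \<bullet> G $ i)" "g \<bullet> g = (\<Sum>i\<in>UNIV. g $ i * g $ i)"
      by (subst inner_vec_def, simp)+
    ultimately have "(G *v x, replace_image x g G) \<bullet> (G *v x, replace_image x g G) = (g, G) \<bullet> (g, G)"
      by (simp add: inner_Pair sum.distrib sum_subtractf)
    then show ?thesis by (simp add: norm_eq_sqrt_inner)
  qed
  ultimately show ?thesis by (auto simp: orthogonal_transformation)
qed

lemma borel_measurable_linear: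
  "linear f \<Longrightarrow> f \<in> borel_measurable borel" for f :: "'a::euclidean_space \<Rightarrow> 'b::euclidean_space"
  by (intro borel_measurable_continuous_onI linear_continuous_on) (simp add: linear_conv_bounded_linear)

lemma borel_measurable_orthogonal:
  "orthogonal_transformation f \<Longrightarrow> f \<in> borel_measurable borel" for f :: "'a::euclidean_space \<Rightarrow> 'a"
  by (rule borel_measurable_linear) (rule orthogonal_transformation_linear)

lemma emeasure_gauss_UNIV [simp]: "emeasure gauss UNIV = 1"
  using prob_space.emeasure_space_1[OF prob_space_gauss] by simp

lemma nn_integral_gauss_mult_unit:
  fixes x :: "real ^ 'r" and h :: "real ^ 'k \<Rightarrow> ennreal"
  assumes x: "norm x = 1" and [measurable]: "h \<in> borel_measurable borel"
  shows "(\<integral>\<^sup>+G. h (G *v x) \<partial>(gauss :: (real ^ 'r ^ 'k) measure)) = (\<integral>\<^sup>+g. h g \<partial>gauss)"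
proof -
  let ?T = "\<lambda>(g :: real ^ 'k, G :: real ^ 'r ^ 'k). (G *v x, replace_image x g G)"
  have [measurable]: "fst \<in> borel_measurable (borel :: ((real ^ 'k) \<times> (real ^ 'r ^ 'k)) measure)"
    by (rule borel_measurable_linear) (rule linear_fst)
  have T [measurable]: "?T \<in> borel_measurable borel"
    by (rule borel_measurable_orthogonal[OF orthogonal_transformation_replace_image[OF x]])
  have "(\<integral>\<^sup>+z. h (fst (?T z)) \<partial>gauss) = (\<integral>\<^sup>+z. h (fst z) \<partial>(gauss :: ((real ^ 'k) \<times> (real ^ 'r ^ 'k)) measure))"
    by (rule nn_integral_gauss_orthogonal[OF orthogonal_transformation_replace_image[OF x]]) simp
  then show ?thesis
    by (subst (asm) (1 2) nn_integral_gauss_pair) simp_all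
qed

lemma nn_integral_gauss_replace_image:
  fixes x :: "real ^ 'r" and h :: "real ^ 'r ^ 'k \<Rightarrow> ennreal"
  assumes x: "norm x = 1" and [measurable]: "h \<in> borel_measurable borel"
  shows "(\<integral>\<^sup>+G. h G \<partial>gauss) = (\<integral>\<^sup>+G. (\<integral>\<^sup>+g. h (replace_image x g G) \<partial>gauss) \<partial>gauss)"
proof -
  let ?T = "\<lambda>(g :: real ^ 'k, G :: real ^ 'r ^ 'k). (G *v x, replace_image x g G)"
  have [measurable]: "snd \<in> borel_measurable (borel :: ((real ^ 'k) \<times> (real ^ 'r ^ 'k)) measure)"
    by (rule borel_measurable_linear) (rule linear_snd)
  have [measurable]: "?T \<in> borel_measurable borel"
    by (rule borel_measurable_orthogonal[OF orthogonal_transformation_replace_image[OF x]])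
  have m: "(\<lambda>z. h (snd (?T z))) \<in> borel_measurable borel"
    by measurable
  have m2: "(\<lambda>(g, G). h (replace_image x g G)) \<in> borel_measurable (gauss \<Otimes>\<^sub>M gauss)"
  proof -
    have "sets (gauss \<Otimes>\<^sub>M gauss :: ((real ^ 'k) \<times> (real ^ 'r ^ 'k)) measure) = sets borel"
      by (simp add: borel_prod[symmetric] cong: sets_pair_measure_cong)
    then have "borel_measurable (gauss \<Otimes>\<^sub>M gauss :: ((real ^ 'k) \<times> (real ^ 'r ^ 'k)) measure) = (borel_measurable borel :: (_ \<Rightarrow> ennreal) set)"
      by (rule measurable_cong_sets) simp
    then show ?thesis using m by (simp add: case_prod_beta')
  qed
  have "(\<integral>\<^sup>+G. h G \<partial>gauss) = (\<integral>\<^sup>+z. h (snd z) \<partial>(gauss :: ((real ^ 'k) \<times> (real ^ 'r ^ 'k)) measure))"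
    by (subst nn_integral_gauss_pair) simp_all
  also have "\<dots> = (\<integral>\<^sup>+z. h (snd (?T z)) \<partial>gauss)"
    by (rule nn_integral_gauss_orthogonal[OF orthogonal_transformation_replace_image[OF x], symmetric]) simp
  also have "\<dots> = (\<integral>\<^sup>+g. (\<integral>\<^sup>+G. h (replace_image x g G) \<partial>gauss) \<partial>gauss)"
    by (subst nn_integral_gauss_pair[OF m]) simp
  also have "\<dots> = (\<integral>\<^sup>+G. (\<integral>\<^sup>+g. h (replace_image x g G) \<partial>gauss) \<partial>gauss)"
  proof -
    interpret a: prob_space "gauss :: (real ^ 'k) measure" by (rule prob_space_gauss)
    interpret b: prob_space "gauss :: (real ^ 'r ^ 'k) measure" by (rule prob_space_gauss)
    interpret pair_sigma_finite "gauss :: (real ^ 'k) measure" "gauss :: (real ^ 'r ^ 'k) measure" ..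
    show ?thesis by (rule Fubini'[OF m2, symmetric])
  qed
  finally show ?thesis .
qed

section \<open>Moments of Gaussian vectors\<close>

text \<open>
Substitution of \<open>c x\<close> for \<open>x\<close>: the exponential factor turns the density \<open>exp (- |x|\<^sup>2 / 2)\<close> into
\<open>exp (- |x / c|\<^sup>2 / 2)\<close>.
\<close>

lemma gauss_norm_moment_scaled:
  assumes c: "c > 1"
  shows "(\<integral>\<^sup>+x. ennreal (norm x ^ (2 * j) * exp ((1 - 1 / c\<^sup>2) * (norm x)\<^sup>2 / 2)) \<partial>(gauss :: ('a::euclidean_space) measure))
    = ennreal (c ^ (DIM('a) + 2 * j)) * (\<integral>\<^sup>+x. ennreal (norm x ^ (2 * j)) \<partial>(gauss :: 'a measure))"
proof -
  define K where "K = (1 / sqrt (2 * pi)) ^ DIM('a)"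
  have K: "K \<ge> 0" by (simp add: K_def)
  have dens: "(\<Prod>b\<in>Basis. std_normal_density (x \<bullet> b)) = K * exp (- (norm x)\<^sup>2 / 2)" for x :: 'a
    unfolding K_def by (rule gauss_density_eq_norm)
  have "(\<integral>\<^sup>+x. ennreal (norm x ^ (2 * j) * exp ((1 - 1 / c\<^sup>2) * (norm x)\<^sup>2 / 2)) \<partial>(gauss :: 'a measure))
    = (\<integral>\<^sup>+x. ennreal (K * exp (- (norm x)\<^sup>2 / 2 / c\<^sup>2) * norm x ^ (2 * j)) \<partial>(lborel :: 'a measure))"
    by (subst nn_integral_gauss)
       (auto simp: dens K ennreal_mult[symmetric] exp_add[symmetric] field_simps
             intro!: nn_integral_cong arg_cong[of _ _ ennreal])
  also have "\<dots> = (\<integral>\<^sup>+x. ennreal (c ^ DIM('a)) * ennreal (K * exp (- (norm x)\<^sup>2 / 2) * (c ^ (2 * j) * norm x ^ (2 * j))) \<partial>(lborel :: 'a measure))"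
    using c
    by (subst lborel_affine[of c 0])
       (auto simp: nn_integral_density nn_integral_distr power_mult_distrib field_simps abs_of_pos
             intro!: nn_integral_cong)
  also have "\<dots> = (\<integral>\<^sup>+x. ennreal (c ^ (DIM('a) + 2 * j)) * ennreal (K * exp (- (norm x)\<^sup>2 / 2) * norm x ^ (2 * j)) \<partial>(lborel :: 'a measure))"
    using c K by (intro nn_integral_cong) (simp add: ennreal_mult[symmetric] power_add mult_ac)
  also have "\<dots> = ennreal (c ^ (DIM('a) + 2 * j)) * (\<integral>\<^sup>+x. ennreal (K * exp (- (norm x)\<^sup>2 / 2) * norm x ^ (2 * j)) \<partial>(lborel :: 'a measure))"
    by (rule nn_integral_cmult) simp
  also have "(\<integral>\<^sup>+x. ennreal (K * exp (- (norm x)\<^sup>2 / 2) * norm x ^ (2 * j)) \<partial>(lborel :: 'a measure))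
     = (\<integral>\<^sup>+x. ennreal (norm x ^ (2 * j)) \<partial>(gauss :: 'a measure))"
    using K by (subst nn_integral_gauss) (simp_all add: dens ennreal_mult)
  finally show ?thesis .
qed

text \<open>
The moments of the chi-square distribution, by induction on \<open>j\<close>. In the preceding lemma, bound the
exponential below by its first-order expansion. The moment of order \<open>2 j + 2\<close> then is at most the
moment of order \<open>2 j\<close> times twice the quotient of \<open>c\<^sup>N - 1\<close> by \<open>1 - 1 / c\<^sup>2\<close>, where \<open>N = n + 2 j\<close> in
dimension \<open>n\<close>. This factor tends to \<open>N\<close> as \<open>c\<close> decreases to 1.
\<close>

lemma gauss_norm_moment_le:
  "(\<integral>\<^sup>+x. ennreal (norm x ^ (2 * j)) \<partial>(gauss :: ('a::euclidean_space) measure)) \<le> ennreal (\<Prod>i<j. real (DIM('a) + 2 * i))"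
proof (induction j)
  case 0
  then show ?case by simp
next
  case (Suc j)
  define I where "I j = (\<integral>\<^sup>+x. ennreal (norm x ^ (2 * j)) \<partial>(gauss :: 'a measure))" for j
  define N where "N = DIM('a) + 2 * j"
  obtain r where r: "I j = ennreal r" "0 \<le> r" "r \<le> (\<Prod>i<j. real (DIM('a) + 2 * i))"
    using Suc unfolding I_def[symmetric] 
    by (cases "I j") (auto simp: top_unique prod_nonneg)
  have ineq: "I j + ennreal ((1 - 1 / c\<^sup>2) / 2) * I (Suc j) \<le> ennreal (c ^ N) * I j" if c: "c > 1" for c :: real
  proof -
    have d: "1 - 1 / c\<^sup>2 \<ge> 0" using c by (simp add: field_simps)
    have "I j + ennreal ((1 - 1 / c\<^sup>2) / 2) * I (Suc j)
       = (\<integral>\<^sup>+x. ennreal (norm x ^ (2 * j)) + ennreal ((1 - 1 / c\<^sup>2) / 2) * ennreal (norm x ^ (2 * Suc j)) \<partial>(gauss :: 'a measure))"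
      unfolding I_def by (subst nn_integral_add) (simp_all add: nn_integral_cmult)
    also have "\<dots> \<le> (\<integral>\<^sup>+x. ennreal (norm x ^ (2 * j) * exp ((1 - 1 / c\<^sup>2) * (norm x)\<^sup>2 / 2)) \<partial>(gauss :: 'a measure))"
    proof (intro nn_integral_mono)
      fix x :: 'a
      have "norm x ^ (2 * j) * (1 + (1 - 1 / c\<^sup>2) * (norm x)\<^sup>2 / 2) \<le> norm x ^ (2 * j) * exp ((1 - 1 / c\<^sup>2) * (norm x)\<^sup>2 / 2)"
        by (intro mult_left_mono exp_ge_add_one_self) auto
      then show "ennreal (norm x ^ (2 * j)) + ennreal ((1 - 1 / c\<^sup>2) / 2) * ennreal (norm x ^ (2 * Suc j))
         \<le> ennreal (norm x ^ (2 * j) * exp ((1 - 1 / c\<^sup>2) * (norm x)\<^sup>2 / 2))"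
        using d by (subst ennreal_mult[symmetric], simp, simp, subst ennreal_plus[symmetric], simp, simp)
          (rule ennreal_leI, simp add: power2_eq_square algebra_simps)
    qed
    also have "\<dots> = ennreal (c ^ N) * I j"
      unfolding N_def I_def by (rule gauss_norm_moment_scaled[OF c])
    finally show ?thesis .
  qed
  obtain q where q: "I (Suc j) = ennreal q" "0 \<le> q"
  proof (cases "I (Suc j)")
    case top
    \<comment> \<open>\<open>c = 2\<close> suffices for finiteness; then \<open>(1 - 1 / c\<^sup>2) / 2 = 3 / 8\<close>\<close>
    have "ennreal (3 / 8) * I (Suc j) \<le> I j + ennreal ((1 - 1 / 2\<^sup>2) / 2) * I (Suc j)" by simp
    also have "\<dots> \<le> ennreal (2 ^ N) * ennreal r" using ineq[of 2] r by simp
    finally show ?thesis using top by (simp add: ennreal_mult_top ennreal_mult[symmetric] r top_unique del: ennreal_power)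
  qed auto
  have "q \<le> r * (2 * c\<^sup>2 / (c + 1) * (\<Sum>i<N. c ^ i))" if c: "c > 1" for c :: real
  proof -
    have d: "1 - 1 / c\<^sup>2 > 0" using c by (simp add: field_simps)
    have "r + (1 - 1 / c\<^sup>2) / 2 * q \<le> c ^ N * r"
      using ineq[OF c] q r d c
      by (simp add: ennreal_mult[symmetric] ennreal_plus[symmetric] del: ennreal_plus ennreal_power)
    then have "(1 - 1 / c\<^sup>2) / 2 * q \<le> (c ^ N - 1) * r" by (simp add: algebra_simps)
    also have "c ^ N - 1 = (c - 1) * (\<Sum>i<N. c ^ i)" by (rule power_diff_1_eq)
    finally have "q \<le> ((c - 1) * (\<Sum>i<N. c ^ i)) * r / ((1 - 1 / c\<^sup>2) / 2)"
      using d by (simp add: field_simps)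
    also have "\<dots> = r * (2 * c\<^sup>2 / (c + 1) * (\<Sum>i<N. c ^ i))"
    proof -
      have "(1 - 1 / c\<^sup>2) / 2 = (c - 1) * ((c + 1) / (2 * c\<^sup>2))" using c by (simp add: field_simps power2_eq_square)
      then show ?thesis using c by simp
    qed
    finally show ?thesis .
  qed
  then have ev: "\<forall>\<^sub>F c in at_right (1::real). q \<le> r * (2 * c\<^sup>2 / (c + 1) * (\<Sum>i<N. c ^ i))"
    by (auto simp: eventually_at_right_field intro: exI[of _ 2])
  have lim: "((\<lambda>c. r * (2 * c\<^sup>2 / (c + 1) * (\<Sum>i<N. c ^ i))) \<longlongrightarrow> r * (2 * 1\<^sup>2 / (1 + 1) * (\<Sum>i<N. 1 ^ i))) (at_right (1::real))"
    by (intro tendsto_intros) auto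
  have "q \<le> r * real N"
    using tendsto_lowerbound[OF lim ev] by simp
  also have "\<dots> \<le> (\<Prod>i<Suc j. real (DIM('a) + 2 * i))"
    unfolding N_def prod.lessThan_Suc by (intro mult_right_mono r) auto
  finally show ?case
    unfolding I_def[symmetric] q(1) by (rule ennreal_leI)
qed

text \<open>
By rotation invariance \<open>v\<close> may be taken along a coordinate axis, which leaves an even moment of the
one-dimensional normal distribution.
\<close>

lemma gauss_inner_moment:
  fixes v :: "real ^ 'r"
  shows "(\<integral>\<^sup>+x. ennreal ((x \<bullet> v) ^ (2 * j)) \<partial>gauss) = ennreal (norm v ^ (2 * j) * (fact (2 * j) / (2 ^ j * fact j)))"
proof -
  fix i :: 'r
  define a :: "real ^ 'r" where "a = axis i 1"
  have a: "a \<in> Basis" by (simp add: a_def axis_in_Basis_iff)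
  obtain f where f: "orthogonal_transformation f" "f v = norm v *\<^sub>R a"
    using orthogonal_transformation_exists[of v "norm v *\<^sub>R a"] by (auto simp: a_def norm_axis_1)
  have "(\<integral>\<^sup>+x. ennreal ((x \<bullet> v) ^ (2 * j)) \<partial>gauss) = (\<integral>\<^sup>+x. ennreal ((f x \<bullet> f v) ^ (2 * j)) \<partial>gauss)"
    using f(1) by (simp add: orthogonal_transformation_def)
  also have "\<dots> = (\<integral>\<^sup>+x. ennreal ((x \<bullet> f v) ^ (2 * j)) \<partial>gauss)"
    by (rule nn_integral_gauss_orthogonal[OF f(1), where h="\<lambda>x. ennreal ((x \<bullet> f v) ^ (2 * j))"]) simp
  also have "\<dots> = (\<integral>\<^sup>+x. ennreal (norm v ^ (2 * j)) * ennreal (\<Prod>b\<in>Basis. (\<lambda>b t. if b = a then t ^ (2 * j) else 1) b (x \<bullet> b)) \<partial>gauss)"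
    using a by (simp add: f(2) power_mult_distrib ennreal_mult)
  also have "\<dots> = ennreal (norm v ^ (2 * j)) * (\<Prod>b\<in>Basis. \<integral>\<^sup>+t. ennreal (std_normal_density t * (if b = a then t ^ (2 * j) else 1)) \<partial>lborel)"
    by (subst nn_integral_cmult, simp) (subst nn_integral_gauss_prod, auto)
  also have "(\<lambda>b. \<integral>\<^sup>+t. ennreal (std_normal_density t * (if b = a then t ^ (2 * j) else 1)) \<partial>lborel)
      = (\<lambda>b. if b = a then ennreal (fact (2 * j) / (2 ^ j * fact j)) else 1)"
  proof
    fix b
    have "(\<integral>\<^sup>+t. ennreal (std_normal_density t * t ^ (2 * j)) \<partial>lborel) = ennreal (fact (2 * j) / (2 ^ j * fact j))"
      using std_normal_moment_even[of j]
      by (subst nn_integral_eq_integral) (auto simp: has_bochner_integral_iff)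
    then show "(\<integral>\<^sup>+t. ennreal (std_normal_density t * (if b = a then t ^ (2 * j) else 1)) \<partial>lborel) =
         (if b = a then ennreal (fact (2 * j) / (2 ^ j * fact j)) else 1)"
      by (simp add: nn_integral_std_normal)
  qed
  finally show ?thesis using a by (simp add: ennreal_mult'[symmetric])
qed

lemma nn_integral_std_normal_exp_square:
  assumes "t \<ge> 0"
  shows "(\<integral>\<^sup>+y. ennreal (std_normal_density y * exp (- t * y\<^sup>2 / 2)) \<partial>lborel) = ennreal ((1 + t) powr (- 1 / 2))"
proof -
  define s where "s = 1 / sqrt (1 + t)"
  have s: "s > 0" "s\<^sup>2 = 1 / (1 + t)" using assms by (auto simp: s_def power_divide)
  have eq: "std_normal_density y * exp (- t * y\<^sup>2 / 2) = s * normal_density 0 s y" for y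
  proof -
    have "- y\<^sup>2 / 2 + - t * y\<^sup>2 / 2 = - y\<^sup>2 / (2 * s\<^sup>2)"
      unfolding s(2) using assms by (simp add: field_simps)
    then have "exp (- y\<^sup>2 / 2) * exp (- t * y\<^sup>2 / 2) = exp (- y\<^sup>2 / (2 * s\<^sup>2))"
      by (simp add: exp_add[symmetric])
    then show ?thesis
      using s(1) by (simp add: std_normal_density_def normal_density_def real_sqrt_mult field_simps)
  qed
  have "(\<integral>\<^sup>+y. ennreal (normal_density 0 s y) \<partial>lborel) = 1"
    using prob_space.emeasure_space_1[OF prob_space_normal_density[of s 0]] s(1)
    by (simp add: emeasure_density)
  then have "(\<integral>\<^sup>+y. ennreal (std_normal_density y * exp (- t * y\<^sup>2 / 2)) \<partial>lborel) = ennreal s"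
    unfolding eq using s(1) by (simp add: ennreal_mult nn_integral_cmult)
  also have "s = (1 + t) powr (- 1 / 2)"
    using assms by (simp add: s_def powr_minus powr_half_sqrt field_simps)
  finally show ?thesis .
qed

lemma gauss_laplace_partial_norm:
  fixes D :: "'k::finite set"
  assumes t: "t \<ge> 0"
  shows "(\<integral>\<^sup>+x. ennreal (exp (- t * (\<Sum>i\<in>D. (x $ i)\<^sup>2) / 2)) \<partial>(gauss :: (real ^ 'k) measure))
     = ennreal ((1 + t) powr (- real (card D) / 2))"
proof -
  define A :: "(real ^ 'k) set" where "A = (\<lambda>i. axis i 1) ` D"
  have A: "A \<subseteq> Basis" by (auto simp: A_def axis_in_Basis_iff)
  have inj: "inj_on (\<lambda>i. axis i (1::real)) D" by (auto simp: inj_on_def axis_eq_axis)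
  have card: "card A = card D" unfolding A_def by (rule card_image[OF inj])
  have eq: "exp (- t * (\<Sum>i\<in>D. (x $ i)\<^sup>2) / 2) = (\<Prod>b\<in>Basis. (\<lambda>b y. if b \<in> A then exp (- t * y\<^sup>2 / 2) else 1) b (x \<bullet> b))"
    for x :: "real ^ 'k"
  proof -
    have "(\<Prod>b\<in>Basis. (\<lambda>b y. if b \<in> A then exp (- t * y\<^sup>2 / 2) else 1) b (x \<bullet> b)) = (\<Prod>b\<in>A. exp (- t * (x \<bullet> b)\<^sup>2 / 2))"
      using A by (simp add: prod.If_cases Int_absorb1)
    also have "\<dots> = (\<Prod>i\<in>D. exp (- t * (x $ i)\<^sup>2 / 2))"
      unfolding A_def by (subst prod.reindex[OF inj]) (simp add: inner_axis)
    also have "\<dots> = exp (- t * (\<Sum>i\<in>D. (x $ i)\<^sup>2) / 2)"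
      by (simp add: exp_sum[symmetric] sum_distrib_left sum_divide_distrib sum_negf)
    finally show ?thesis ..
  qed
  have "(\<integral>\<^sup>+x. ennreal (exp (- t * (\<Sum>i\<in>D. (x $ i)\<^sup>2) / 2)) \<partial>(gauss :: (real ^ 'k) measure))
    = (\<Prod>b\<in>(Basis :: (real ^ 'k) set). \<integral>\<^sup>+y. ennreal (std_normal_density y * (if b \<in> A then exp (- t * y\<^sup>2 / 2) else 1)) \<partial>lborel)"
    unfolding eq by (subst nn_integral_gauss_prod) auto
  also have "\<dots> = (\<Prod>b\<in>(Basis :: (real ^ 'k) set). if b \<in> A then ennreal ((1 + t) powr (- 1 / 2)) else 1)"
    using nn_integral_std_normal_exp_square[OF t] by (intro prod.cong refl) (simp add: nn_integral_std_normal)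
  also have "\<dots> = ennreal ((1 + t) powr (- 1 / 2)) ^ card D"
    using A by (simp add: prod.If_cases Int_absorb1 card)
  also have "\<dots> = ennreal ((1 + t) powr (- real (card D) / 2))"
    using t by (simp add: ennreal_power powr_power)
  finally show ?thesis .
qed

lemma emeasure_lborel_Ici: "emeasure lborel {a :: real ..} = \<infinity>"
proof -
  have "of_nat n \<le> emeasure lborel {a ..}" for n
  proof -
    have "of_nat n = emeasure lborel {a .. a + real n}"
      by (simp add: ennreal_of_nat_eq_real_of_nat)
    also have "\<dots> \<le> emeasure lborel {a ..}" by (rule emeasure_mono) auto
    finally show ?thesis .
  qed
  then have "(SUP n. of_nat n :: ennreal) \<le> emeasure lborel {a ..}" by (rule SUP_least)
  then show ?thesis by (simp add: ennreal_SUP_of_nat_eq_top top_unique)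
qed

text \<open>
For positive \<open>S\<close> this is an equality, the normalisation of the Erlang density. For \<open>S = 0\<close> both sides
are infinite.
\<close>

lemma inverse_power_le_laplace:
  assumes "S \<ge> 0" "j \<ge> 1"
  shows "inverse (ennreal S) ^ j \<le> (\<integral>\<^sup>+t. ennreal (t ^ (j - 1) * exp (- t * S / 2) / (2 ^ j * fact (j - 1))) * indicator {0..} t \<partial>lborel)"
proof (cases "S = 0")
  case True
  have "\<infinity> = ennreal (1 / (2 ^ j * fact (j - 1))) * (\<integral>\<^sup>+t. indicator {1..} t \<partial>(lborel :: real measure))"
    by (simp add: emeasure_lborel_Ici ennreal_mult_top)
  also have "\<dots> = (\<integral>\<^sup>+t. ennreal (1 / (2 ^ j * fact (j - 1))) * indicator {1..} t \<partial>(lborel :: real measure))"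
    by (subst nn_integral_cmult) auto
  also have "\<dots> \<le> (\<integral>\<^sup>+t. ennreal (t ^ (j - 1) * exp (- t * S / 2) / (2 ^ j * fact (j - 1))) * indicator {0..} t \<partial>lborel)"
    using True by (intro nn_integral_mono) (auto simp: indicator_def intro!: ennreal_leI divide_right_mono)
  finally show ?thesis by (simp only: infinity_ennreal_def top_unique top_greatest)
next
  case False
  then have S: "S / 2 > 0" using assms by simp
  have "inverse (ennreal S) ^ j = ennreal (1 / S ^ j) * 1"
    using False assms(1) by (simp add: inverse_ennreal ennreal_power inverse_eq_divide power_one_over)
  also have "1 = (\<integral>\<^sup>+t. ennreal (erlang_density (j - 1) (S / 2) t) \<partial>lborel)"
    using nn_integral_erlang_ith_moment[OF S, of "j - 1" 0] by simp
  also have "ennreal (1 / S ^ j) * \<dots> = (\<integral>\<^sup>+t. ennreal (1 / S ^ j) * ennreal (erlang_density (j - 1) (S / 2) t) \<partial>lborel)"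
    by (rule nn_integral_cmult[symmetric]) simp
  also have "\<dots> = (\<integral>\<^sup>+t. ennreal (t ^ (j - 1) * exp (- t * S / 2) / (2 ^ j * fact (j - 1))) * indicator {0..} t \<partial>lborel)"
  proof (rule nn_integral_cong)
    fix t :: real
    have "(1 / S ^ j) * erlang_density (j - 1) (S / 2) t = (t ^ (j - 1) * exp (- t * S / 2) / (2 ^ j * fact (j - 1))) * indicator {0..} t"
    proof (cases "t \<ge> 0")
      case True
      obtain i where i: "j = Suc i" using assms(2) by (cases j) auto
      have "- (S / 2) * t = - t * S / 2" by simp
      moreover have "(1 / S ^ j) * (S / 2) ^ j = 1 / 2 ^ j" using False by (simp add: power_divide)
      moreover have "(1 / S ^ j) * erlang_density (j - 1) (S / 2) t
          = ((1 / S ^ j) * (S / 2) ^ j) * (t ^ i * exp (- (S / 2) * t) / fact i)"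
        using True by (simp add: erlang_density_def i)
      ultimately have "(1 / S ^ j) * erlang_density (j - 1) (S / 2) t = (1 / 2 ^ j) * (t ^ i * exp (- t * S / 2) / fact i)"
        by (simp only:)
      then show ?thesis using True by (simp add: i)
    qed (simp add: erlang_density_def)
    then show "ennreal (1 / S ^ j) * ennreal (erlang_density (j - 1) (S / 2) t) = ennreal (t ^ (j - 1) * exp (- t * S / 2) / (2 ^ j * fact (j - 1))) * indicator {0..} t"
      using S assms by (subst ennreal_mult[symmetric]) (auto simp: indicator_def)
  qed
  finally show ?thesis by simp
qed

lemma borel_measurable_vec_nth [measurable (raw)]:
  fixes f :: "'w \<Rightarrow> 'a::euclidean_space ^ 'k"
  assumes "f \<in> borel_measurable M"
  shows "(\<lambda>w. f w $ i) \<in> borel_measurable M"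
  using measurable_compose[OF assms borel_measurable_linear[of "\<lambda>x. x $ i"]]
  by (simp add: linear_iff)

text \<open>
Negative moments of the chi-square distribution with \<open>card D\<close> degrees of freedom. The Laplace
integral reduces them to the integral of \<open>t\<^bsup>j-1\<^esup> (1 + t)\<^bsup>-d/2\<^esup>\<close>, a Beta function. Replacing \<open>t\<^bsup>j-1\<^esup>\<close> by
\<open>(1 + t)\<^bsup>j-1\<^esup>\<close> makes it elementary and costs little when \<open>2 j\<close> is close to \<open>d\<close>, which is the case in
\<open>gauss_small_tail\<close>.
\<close>

lemma gauss_inverse_partial_norm_moment_le:
  fixes D :: "'k::finite set"
  assumes j: "j \<ge> 1" and D: "2 * j < card D"
  shows "(\<integral>\<^sup>+x. inverse (ennreal (\<Sum>i\<in>D. (x $ i)\<^sup>2)) ^ j \<partial>(gauss :: (real ^ 'k) measure))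
     \<le> ennreal (1 / (2 ^ (j - 1) * fact (j - 1) * real (card D - 2 * j)))"
proof -
  define d where "d = card D"
  define c :: real where "c = 1 / (2 ^ j * fact (j - 1))"
  define e where "e = real d / 2 - real j"
  have e: "e > 0" using D by (simp add: e_def d_def)
  have c: "c > 0" by (simp add: c_def)
  interpret prob_space "gauss :: (real ^ 'k) measure" by (rule prob_space_gauss)
  interpret pair_sigma_finite "gauss :: (real ^ 'k) measure" "lborel :: real measure" ..
  have "(\<integral>\<^sup>+x. inverse (ennreal (\<Sum>i\<in>D. (x $ i)\<^sup>2)) ^ j \<partial>(gauss :: (real ^ 'k) measure))
    \<le> (\<integral>\<^sup>+x. (\<integral>\<^sup>+t. ennreal (t ^ (j - 1) * exp (- t * (\<Sum>i\<in>D. (x $ i)\<^sup>2) / 2) / (2 ^ j * fact (j - 1))) * indicator {0..} t \<partial>lborel) \<partial>(gauss :: (real ^ 'k) measure))"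
    by (intro nn_integral_mono inverse_power_le_laplace j sum_nonneg) auto
  also have "\<dots> = (\<integral>\<^sup>+t. (\<integral>\<^sup>+x. ennreal (t ^ (j - 1) * exp (- t * (\<Sum>i\<in>D. (x $ i)\<^sup>2) / 2) / (2 ^ j * fact (j - 1))) * indicator {0..} t \<partial>(gauss :: (real ^ 'k) measure)) \<partial>lborel)"
    by (rule Fubini'[symmetric]) measurable
  also have "\<dots> \<le> (\<integral>\<^sup>+t. ennreal c * (ennreal ((1 + t) powr (- e - 1)) * indicator {0..} t) \<partial>lborel)"
  proof (intro nn_integral_mono)
    fix t :: real
    show "(\<integral>\<^sup>+x. ennreal (t ^ (j - 1) * exp (- t * (\<Sum>i\<in>D. (x $ i)\<^sup>2) / 2) / (2 ^ j * fact (j - 1))) * indicator {0..} t \<partial>(gauss :: (real ^ 'k) measure))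
      \<le> ennreal c * (ennreal ((1 + t) powr (- e - 1)) * indicator {0..} t)"
    proof (cases "t \<ge> 0")
      case True
      have "(\<integral>\<^sup>+x. ennreal (t ^ (j - 1) * exp (- t * (\<Sum>i\<in>D. (x $ i)\<^sup>2) / 2) / (2 ^ j * fact (j - 1))) * indicator {0..} t \<partial>(gauss :: (real ^ 'k) measure))
        = (\<integral>\<^sup>+x. ennreal (c * t ^ (j - 1)) * ennreal (exp (- t * (\<Sum>i\<in>D. (x $ i)\<^sup>2) / 2)) \<partial>(gauss :: (real ^ 'k) measure))"
        using True c by (intro nn_integral_cong) (simp add: c_def ennreal_mult[symmetric])
      also have "\<dots> = ennreal (c * t ^ (j - 1)) * ennreal ((1 + t) powr (- real d / 2))"
        unfolding d_def by (subst nn_integral_cmult) (simp_all only: gauss_laplace_partial_norm[OF True], measurable)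
      also have "\<dots> = ennreal (c * (t ^ (j - 1) * (1 + t) powr (- real d / 2)))"
        using True c by (simp add: ennreal_mult[symmetric] mult.assoc)
      also have "\<dots> \<le> ennreal (c * ((1 + t) ^ (j - 1) * (1 + t) powr (- real d / 2)))"
        using True c by (intro ennreal_leI mult_left_mono mult_right_mono power_mono) auto
      also have "(1 + t) ^ (j - 1) * (1 + t) powr (- real d / 2) = (1 + t) powr (- e - 1)"
        using True j by (simp add: powr_realpow[symmetric] powr_add[symmetric] e_def of_nat_diff diff_diff_eq add.commute diff_right_commute)
      finally show ?thesis using True c by (simp add: ennreal_mult)
    qed simp
  qed
  also have "\<dots> = ennreal c * (\<integral>\<^sup>+t. ennreal ((1 + t) powr (- e - 1)) * indicator {0..} t \<partial>lborel)"
    by (rule nn_integral_cmult) measurable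
  also have "(\<integral>\<^sup>+t. ennreal ((1 + t) powr (- e - 1)) * indicator {0..} t \<partial>lborel) = ennreal (0 - (- ((1 + 0) powr (- e)) / e))"
  proof (rule nn_integral_FTC_atLeast)
    fix x :: real assume "0 \<le> x"
    then show "((\<lambda>x. - ((1 + x) powr (- e)) / e) has_real_derivative (1 + x) powr (- e - 1)) (at x)"
      using e by (auto intro!: derivative_eq_intros simp: powr_diff)
  next
    have "((\<lambda>x::real. (1 + x) powr (- e)) \<longlongrightarrow> 0) at_top"
      using e by (intro tendsto_neg_powr filterlim_tendsto_add_at_top tendsto_const filterlim_ident) auto
    then have "((\<lambda>x. - ((1 + x) powr (- e)) / e) \<longlongrightarrow> - 0 / e) at_top"
      by (intro tendsto_intros) (use e in auto)
    then show "((\<lambda>x. - ((1 + x) powr (- e)) / e) \<longlongrightarrow> 0) at_top" by simp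
  qed auto
  also have "ennreal c * \<dots> = ennreal (1 / (2 ^ (j - 1) * fact (j - 1) * real (card D - 2 * j)))"
  proof -
    have "c / e = 1 / (2 ^ (j - 1) * fact (j - 1) * real (card D - 2 * j))"
      using D j unfolding c_def e_def d_def
      by (cases j) (simp_all add: of_nat_diff field_simps)
    then show ?thesis using c e by (simp add: ennreal_mult[symmetric])
  qed
  finally show ?thesis .
qed

section \<open>The law of a Gaussian matrix\<close>

text \<open>
The two measures agree on boxes, which are stable under intersection and generate the Borel sets.
\<close>

lemma (in prob_space) distr_eq_gauss:
  fixes H :: "'a \<Rightarrow> 'b::euclidean_space"
  assumes ind: "indep_vars (\<lambda>_. borel) (\<lambda>b \<omega>. H \<omega> \<bullet> b) Basis"
    and std: "\<And>b. b \<in> Basis \<Longrightarrow> distributed M lborel (\<lambda>\<omega>. H \<omega> \<bullet> b) std_normal_density"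
  shows "H \<in> borel_measurable M" "distr M borel H = gauss"
proof -
  have meas: "(\<lambda>\<omega>. H \<omega> \<bullet> b) \<in> borel_measurable M" if "b \<in> Basis" for b
    using distributed_measurable[OF std[OF that]] by simp
  show [measurable]: "H \<in> borel_measurable M"
    by (subst borel_measurable_euclidean_space) (use meas in auto)
  show "distr M borel H = gauss"
  proof (rule measure_eqI_generator_eq)
    let ?E = "range (\<lambda>(a, b). box a b::'b set)"
    show "Int_stable ?E"
      by (auto simp: Int_stable_def box_Int_box)
    show "?E \<subseteq> Pow UNIV" "sets (distr M borel H) = sigma_sets UNIV ?E" "sets (gauss :: 'b measure) = sigma_sets UNIV ?E"
      by (simp_all add: borel_eq_box)
    let ?A = "\<lambda>n::nat. box (- (real n *\<^sub>R One)) (real n *\<^sub>R One) :: 'b set"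
    show "range ?A \<subseteq> ?E" "(\<Union>i. ?A i) = UNIV"
      unfolding UN_box_eq_UNIV by auto
    show "emeasure (distr M borel H) (?A i) \<noteq> \<infinity>" for i
      by (simp add: emeasure_distr emeasure_eq_measure)
    show "emeasure (distr M borel H) X = emeasure gauss X" if "X \<in> ?E" for X
    proof -
      from that obtain l u where X: "X = box l u" by auto
      have "emeasure (distr M borel H) X = emeasure M (H -` box l u \<inter> space M)"
        unfolding X by (rule emeasure_distr) auto
      also have "H -` box l u \<inter> space M = (\<Inter>b\<in>Basis. (\<lambda>\<omega>. H \<omega> \<bullet> b) -` {l \<bullet> b <..< u \<bullet> b} \<inter> space M)"
        by (auto simp: mem_box)
      also have "emeasure M \<dots> = ennreal (\<Prod>b\<in>Basis. prob ((\<lambda>\<omega>. H \<omega> \<bullet> b) -` {l \<bullet> b <..< u \<bullet> b} \<inter> space M))"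
        unfolding emeasure_eq_measure by (subst indep_varsD[OF ind]) auto
      also have "\<dots> = (\<Prod>b\<in>Basis. emeasure M ((\<lambda>\<omega>. H \<omega> \<bullet> b) -` {l \<bullet> b <..< u \<bullet> b} \<inter> space M))"
        by (simp add: emeasure_eq_measure prod_ennreal)
      also have "\<dots> = (\<Prod>b\<in>Basis. \<integral>\<^sup>+y. ennreal (std_normal_density y * indicator {l \<bullet> b <..< u \<bullet> b} y) \<partial>lborel)"
      proof (rule prod.cong[OF refl])
        fix b :: 'b assume b: "b \<in> Basis"
        have "emeasure M ((\<lambda>\<omega>. H \<omega> \<bullet> b) -` {l \<bullet> b <..< u \<bullet> b} \<inter> space M)
          = (\<integral>\<^sup>+y. ennreal (std_normal_density y) * indicator {l \<bullet> b <..< u \<bullet> b} y \<partial>lborel)"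
          by (rule distributed_emeasure[OF std[OF b]]) simp
        then show "emeasure M ((\<lambda>\<omega>. H \<omega> \<bullet> b) -` {l \<bullet> b <..< u \<bullet> b} \<inter> space M)
          = (\<integral>\<^sup>+y. ennreal (std_normal_density y * indicator {l \<bullet> b <..< u \<bullet> b} y) \<partial>lborel)"
          by (simp add: ennreal_mult ennreal_indicator)
      qed
      also have "\<dots> = (\<integral>\<^sup>+x. ennreal (\<Prod>b\<in>Basis. (\<lambda>b y. indicator {l \<bullet> b <..< u \<bullet> b} y) b (x \<bullet> b)) \<partial>gauss)"
        by (rule nn_integral_gauss_prod[symmetric]) auto
      also have "\<dots> = (\<integral>\<^sup>+x. indicator X x \<partial>gauss)"
      proof (rule nn_integral_cong)
        fix x :: 'b
        have "(\<Prod>b\<in>Basis. (indicator {l \<bullet> b <..< u \<bullet> b} (x \<bullet> b) :: real)) = indicator X x"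
          by (cases "x \<in> X") (auto simp: X mem_box indicator_eq_0_iff intro!: prod.neutral prod_zero)
        then show "ennreal (\<Prod>b\<in>Basis. (\<lambda>b y. indicator {l \<bullet> b <..< u \<bullet> b} y) b (x \<bullet> b)) = indicator X x"
          by (simp add: ennreal_indicator)
      qed
      finally show ?thesis by (simp add: X)
    qed
  qed
qed

lemma (in prob_space) indep_vars_reindex_inj:
  assumes g: "inj_on g I" and ind: "indep_vars M' X (g ` I)"
  shows "indep_vars (\<lambda>i. M' (g i)) (\<lambda>i. X (g i)) I"
proof -
  have ind': "indep_sets (\<lambda>i. {X i -` A \<inter> space M |A. A \<in> sets (M' i)}) (g ` I)"
    and rv: "\<And>i. i \<in> I \<Longrightarrow> random_variable (M' (g i)) (X (g i))"
    using ind by (auto simp: indep_vars_def2)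
  have "indep_sets (\<lambda>i. {X (g i) -` A \<inter> space M |A. A \<in> sets (M' (g i))}) I"
  proof (rule indep_setsI)
    fix i assume "i \<in> I"
    then show "{X (g i) -` A \<inter> space M |A. A \<in> sets (M' (g i))} \<subseteq> events"
      using rv by (auto intro: measurable_sets)
  next
    fix A J
    assume J: "J \<noteq> {}" "J \<subseteq> I" "finite J"
      and A: "\<forall>j\<in>J. A j \<in> {X (g j) -` A \<inter> space M |A. A \<in> sets (M' (g j))}"
    have inv: "the_inv_into I g (g j) = j" if "j \<in> J" for j
      using the_inv_into_f_f[OF g] that J by auto
    have "prob (\<Inter>i\<in>g ` J. A (the_inv_into I g i)) = (\<Prod>i\<in>g ` J. prob (A (the_inv_into I g i)))"
      by (rule indep_setsD[OF ind']) (use J A inv in auto)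
    then show "prob (\<Inter>j\<in>J. A j) = (\<Prod>j\<in>J. prob (A j))"
      using inj_on_subset[OF g J(2)] inv by (simp add: prod.reindex)
  qed
  then show ?thesis using rv by (auto simp: indep_vars_def2)
qed

text \<open>
The map \<open>f\<close> tells which entry of \<open>H\<close> goes to which place. This covers \<open>H\<close> itself, its transpose, and
submatrices of both.
\<close>

lemma gaussian_matrix_distr:
  fixes H :: "'w \<Rightarrow> real ^ 'n ^ 'm" and f :: "'a::finite \<times> 'b::finite \<Rightarrow> 'm \<times> 'n"
  assumes P: "prob_space P" and H: "gaussian_matrix P H" and f: "inj f"
  defines "X \<equiv> (\<lambda>\<omega>. \<chi> i j. H \<omega> $ fst (f (i, j)) $ snd (f (i, j)))"
  shows "X \<in> borel_measurable P" "distr P borel X = gauss"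
proof -
  interpret prob_space P by fact
  define \<phi> :: "(real ^ 'b ^ 'a) \<Rightarrow> 'a \<times> 'b" where "\<phi> = inv_into UNIV (\<lambda>(i, j). axis i (axis j 1))"
  have "inj (\<lambda>(i, j). axis i (axis j (1 :: real)) :: real ^ 'b ^ 'a)"
    by (auto simp: inj_def axis_eq_axis)
  then have \<phi>: "\<phi> (axis i (axis j 1)) = (i, j)" for i j
    unfolding \<phi>_def using inv_into_f_f[of "\<lambda>(i, j). axis i (axis j (1 :: real)) :: real ^ 'b ^ 'a" UNIV "(i, j)"] by simp
  have basis: "\<exists>i j. b = axis i (axis j 1)" if "b \<in> Basis" for b :: "real ^ 'b ^ 'a"
    using that by (auto simp: Basis_vec_def)
  have comp: "X \<omega> \<bullet> b = (case f (\<phi> b) of (i, j) \<Rightarrow> H \<omega> $ i $ j)" if "b \<in> Basis" for b \<omega>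
    using basis[OF that] by (auto simp: \<phi> X_def inner_axis case_prod_beta')
  have inj: "inj_on (\<lambda>b. f (\<phi> b)) Basis"
  proof (rule inj_onI)
    fix b c :: "real ^ 'b ^ 'a" assume bc: "b \<in> Basis" "c \<in> Basis" "f (\<phi> b) = f (\<phi> c)"
    then have "\<phi> b = \<phi> c" using f by (simp add: inj_eq)
    then show "b = c" using basis[OF bc(1)] basis[OF bc(2)] by (auto simp: \<phi>)
  qed
  have "indep_vars (\<lambda>_. borel) (\<lambda>(i, j) \<omega>. H \<omega> $ i $ j) ((\<lambda>b. f (\<phi> b)) ` Basis)"
    using H unfolding gaussian_matrix_def by (blast intro: indep_vars_subset)
  then have "indep_vars (\<lambda>_. borel) (\<lambda>b \<omega>. (case f (\<phi> b) of (i, j) \<Rightarrow> H \<omega> $ i $ j)) Basis"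
    using indep_vars_reindex_inj[OF inj] by (simp add: case_prod_beta')
  then have ind: "indep_vars (\<lambda>_. borel) (\<lambda>b \<omega>. X \<omega> \<bullet> b) Basis"
    by (subst indep_vars_cong[OF refl]) (use comp in auto)
  have std: "distributed P lborel (\<lambda>\<omega>. X \<omega> \<bullet> b) std_normal_density" if "b \<in> Basis" for b
    using H unfolding gaussian_matrix_def comp[OF that] by (cases "f (\<phi> b)") simp
  show "X \<in> borel_measurable P" "distr P borel X = gauss"
    using distr_eq_gauss[OF ind std] by auto
qed

section \<open>Upper tail of the norm of a Gaussian matrix\<close>

lemma borel_measurable_matrix_vector_mult [measurable (raw)]:
  fixes f :: "'w \<Rightarrow> real ^ 'n ^ 'm"
  assumes "f \<in> borel_measurable M" "g \<in> borel_measurable M"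
  shows "(\<lambda>w. f w *v g w) \<in> borel_measurable M"
  by (rule borel_measurable_continuous_Pair[OF assms])
     (auto simp: matrix_vector_mult_def intro!: continuous_intros)

lemma fact_double_eq_prod: "fact (2 * j) / (2 ^ j * fact j) = (\<Prod>i<j. real (1 + 2 * i))"
proof (induction j)
  case (Suc j)
  have "fact (2 * Suc j) / (2 ^ Suc j * fact (Suc j)) = (fact (2 * j) / (2 ^ j * fact j)) * (real (2 * j + 1) * real (2 * j + 2) / (2 * real (j + 1)))"
    by (simp add: field_simps)
  also have "real (2 * j + 1) * real (2 * j + 2) / (2 * real (j + 1)) = real (1 + 2 * j)"
    by (simp add: field_simps)
  finally show ?case using Suc by simp
qed simp

lemma continuous_on_matrix_vector_mult_left:
  "continuous_on UNIV (\<lambda>G :: real ^ 'n ^ 'm. G *v y)"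
  by (auto simp: matrix_vector_mult_def intro!: continuous_intros)

lemma open_matrices_exceeding: "open {G :: real ^ 'r ^ 'k. \<exists>y. T * norm y < norm (G *v y)}"
  by (simp add: Collect_ex_eq)
     (intro open_UN ballI open_Collect_less continuous_intros continuous_on_matrix_vector_mult_left)

lemma open_matrices_below: "open {G :: real ^ 'r ^ 'k. \<exists>y. norm (G *v y) < s * norm y}"
  by (simp add: Collect_ex_eq)
     (intro open_UN ballI open_Collect_less continuous_intros continuous_on_matrix_vector_mult_left)

lemma nn_integral_gauss_swap:
  fixes h :: "'a::euclidean_space \<Rightarrow> 'b::euclidean_space \<Rightarrow> ennreal"
  assumes "(\<lambda>(x, y). h x y) \<in> borel_measurable (borel \<Otimes>\<^sub>M borel)"
  shows "(\<integral>\<^sup>+x. (\<integral>\<^sup>+y. h x y \<partial>gauss) \<partial>gauss) = (\<integral>\<^sup>+y. (\<integral>\<^sup>+x. h x y \<partial>gauss) \<partial>gauss)"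
proof -
  interpret a: prob_space "gauss :: 'a measure" by (rule prob_space_gauss)
  interpret b: prob_space "gauss :: 'b measure" by (rule prob_space_gauss)
  interpret pair_sigma_finite "gauss :: 'a measure" "gauss :: 'b measure" ..
  have "(\<lambda>(x, y). h x y) \<in> borel_measurable (gauss \<Otimes>\<^sub>M gauss)"
    using assms by (simp cong: measurable_cong_sets sets_pair_measure_cong)
  then show ?thesis by (rule Fubini'[symmetric])
qed

lemma gauss_norm_image_moment_le:
  fixes x :: "real ^ 'r"
  assumes "j \<ge> 1"
  shows "(\<integral>\<^sup>+G. ennreal (norm (G *v x) ^ (2 * j)) \<partial>(gauss :: (real ^ 'r ^ 'k) measure))
    \<le> ennreal (norm x ^ (2 * j)) * ennreal (\<Prod>i<j. real (CARD('k) + 2 * i))"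
proof (cases "x = 0")
  case True
  then show ?thesis using assms by (cases j) auto
next
  case False
  define z where "z = x /\<^sub>R norm x"
  have z: "norm z = 1" "x = norm x *\<^sub>R z" using False by (auto simp: z_def)
  have "(\<integral>\<^sup>+G. ennreal (norm (G *v x) ^ (2 * j)) \<partial>(gauss :: (real ^ 'r ^ 'k) measure))
     = (\<integral>\<^sup>+G. ennreal (norm x ^ (2 * j)) * ennreal (norm (G *v z) ^ (2 * j)) \<partial>(gauss :: (real ^ 'r ^ 'k) measure))"
    by (subst z(2)) (simp add: matrix_vector_mult_scaleR power_mult_distrib ennreal_mult)
  also have "\<dots> = ennreal (norm x ^ (2 * j)) * (\<integral>\<^sup>+G. ennreal (norm (G *v z) ^ (2 * j)) \<partial>(gauss :: (real ^ 'r ^ 'k) measure))"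
    by (rule nn_integral_cmult) measurable
  also have "(\<integral>\<^sup>+G. ennreal (norm (G *v z) ^ (2 * j)) \<partial>(gauss :: (real ^ 'r ^ 'k) measure)) = (\<integral>\<^sup>+g. ennreal (norm g ^ (2 * j)) \<partial>(gauss :: (real ^ 'k) measure))"
    by (rule nn_integral_gauss_mult_unit[OF z(1)]) measurable
  also have "ennreal (norm x ^ (2 * j)) * \<dots> \<le> ennreal (norm x ^ (2 * j)) * ennreal (\<Prod>i<j. real (CARD('k) + 2 * i))"
    using gauss_norm_moment_le[where 'a="real ^ 'k", of j] by (intro mult_left_mono) auto
  finally show ?thesis .
qed

text \<open>
If \<open>|G y| > T |y|\<close> and \<open>u\<close> is the unit vector along \<open>G y\<close>, then \<open>w = G\<^sup>T u\<close> is longer than \<open>T\<close>, since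
its inner product with \<open>y\<close> is \<open>|G y|\<close>. Moreover \<open>|G x| \<ge> |\<langle>G x, u\<rangle>| = |\<langle>x, w\<rangle>|\<close> for all \<open>x\<close>. So on
this event the average of \<open>|G x|\<close> to the power \<open>2 j\<close> over Gaussian \<open>x\<close> is at least the second factor
on the left. The right-hand side is the average of the same quantity over both \<open>G\<close> and \<open>x\<close>.
\<close>

lemma gauss_norm_tail_moment:
  assumes T: "T \<ge> 0" and j: "j \<ge> 1"
  shows "emeasure gauss {G :: real ^ 'r ^ 'k. \<exists>y. T * norm y < norm (G *v y)}
      * ennreal (T ^ (2 * j) * (\<Prod>i<j. real (1 + 2 * i)))
    \<le> ennreal ((\<Prod>i<j. real (CARD('k) + 2 * i)) * (\<Prod>i<j. real (CARD('r) + 2 * i)))"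
proof -
  define A where "A = {G :: real ^ 'r ^ 'k. \<exists>y. T * norm y < norm (G *v y)}"
  have [measurable]: "A \<in> sets borel" unfolding A_def by (intro borel_open open_matrices_exceeding)
  have lower: "ennreal (T ^ (2 * j) * (\<Prod>i<j. real (1 + 2 * i))) \<le> (\<integral>\<^sup>+x. ennreal (norm (G *v x) ^ (2 * j)) \<partial>gauss)"
    if "G \<in> A" for G
  proof -
    from that obtain y where y: "T * norm y < norm (G *v y)" unfolding A_def by auto
    then have pos: "norm (G *v y) > 0" "norm y > 0" using T
      by (smt (verit) mult_nonneg_nonneg norm_ge_zero, auto)
    define u where "u = (G *v y) /\<^sub>R norm (G *v y)"
    define w where "w = transpose G *v u"
    have u: "norm u = 1" using pos by (simp add: u_def)
    have adj: "x \<bullet> w = (G *v x) \<bullet> u" for x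
      by (simp add: w_def dot_lmul_matrix[symmetric] vector_transpose_matrix inner_commute)
    have "(G *v y) \<bullet> u = norm (G *v y)"
      using pos by (simp add: u_def dot_square_norm power2_eq_square inverse_eq_divide)
    then have "T * norm y < (G *v y) \<bullet> u" using y by simp
    also have "\<dots> \<le> norm y * norm w"
      by (simp add: adj[symmetric] norm_cauchy_schwarz)
    finally have w: "T < norm w" using pos(2) by (simp add: mult.commute)
    have "T ^ (2 * j) * (\<Prod>i<j. real (1 + 2 * i)) \<le> norm w ^ (2 * j) * (fact (2 * j) / (2 ^ j * fact j))"
      unfolding fact_double_eq_prod using w T by (intro mult_right_mono power_mono prod_nonneg) auto
    then have "ennreal (T ^ (2 * j) * (\<Prod>i<j. real (1 + 2 * i))) \<le> (\<integral>\<^sup>+x. ennreal ((x \<bullet> w) ^ (2 * j)) \<partial>gauss)"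
      unfolding gauss_inner_moment by (rule ennreal_leI)
    also have "\<dots> \<le> (\<integral>\<^sup>+x. ennreal (norm (G *v x) ^ (2 * j)) \<partial>gauss)"
    proof (intro nn_integral_mono ennreal_leI)
      fix x
      have "\<bar>x \<bullet> w\<bar> \<le> norm (G *v x)"
        using Cauchy_Schwarz_ineq2[of "G *v x" u] by (simp add: adj u)
      then have "\<bar>x \<bullet> w\<bar> ^ (2 * j) \<le> norm (G *v x) ^ (2 * j)" by (intro power_mono) auto
      then show "(x \<bullet> w) ^ (2 * j) \<le> norm (G *v x) ^ (2 * j)" by (simp add: power_even_abs)
    qed
    finally show ?thesis .
  qed
  have "emeasure gauss A * ennreal (T ^ (2 * j) * (\<Prod>i<j. real (1 + 2 * i)))
      = (\<integral>\<^sup>+G. ennreal (T ^ (2 * j) * (\<Prod>i<j. real (1 + 2 * i))) * indicator A G \<partial>gauss)"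
    by (subst nn_integral_cmult_indicator) (simp_all add: mult.commute)
  also have "\<dots> \<le> (\<integral>\<^sup>+G. (\<integral>\<^sup>+x. ennreal (norm (G *v x) ^ (2 * j)) \<partial>gauss) \<partial>(gauss :: (real ^ 'r ^ 'k) measure))"
    by (intro nn_integral_mono) (auto simp: indicator_def dest: lower)
  also have "\<dots> = (\<integral>\<^sup>+x. (\<integral>\<^sup>+G. ennreal (norm (G *v x) ^ (2 * j)) \<partial>(gauss :: (real ^ 'r ^ 'k) measure)) \<partial>gauss)"
    by (rule nn_integral_gauss_swap) measurable
  also have "\<dots> \<le> (\<integral>\<^sup>+x. ennreal (norm x ^ (2 * j)) * ennreal (\<Prod>i<j. real (CARD('k) + 2 * i)) \<partial>(gauss :: (real ^ 'r) measure))"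
    by (intro nn_integral_mono gauss_norm_image_moment_le j)
  also have "\<dots> = (\<integral>\<^sup>+x. ennreal (norm x ^ (2 * j)) \<partial>(gauss :: (real ^ 'r) measure)) * ennreal (\<Prod>i<j. real (CARD('k) + 2 * i))"
    by (rule nn_integral_multc) measurable
  also have "\<dots> \<le> ennreal (\<Prod>i<j. real (CARD('r) + 2 * i)) * ennreal (\<Prod>i<j. real (CARD('k) + 2 * i))"
    using gauss_norm_moment_le[where 'a="real ^ 'r", of j] by (intro mult_right_mono) auto
  also have "\<dots> = ennreal ((\<Prod>i<j. real (CARD('k) + 2 * i)) * (\<Prod>i<j. real (CARD('r) + 2 * i)))"
    by (subst ennreal_mult[symmetric]) (auto simp: mult.commute intro!: prod_nonneg)
  finally show ?thesis unfolding A_def .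
qed

text \<open>
Pair the factor with index \<open>i\<close> with the one with index \<open>n - 1 - i\<close>. The two have mean
\<open>a + (n - 1)\<close>, which bounds their geometric mean.
\<close>

lemma prod_arith_progression_le:
  fixes a :: real assumes "a \<ge> 0"
  shows "(\<Prod>i<n. a + 2 * real i) \<le> (a + real (n - 1)) ^ n"
proof -
  let ?p = "\<Prod>i<n. a + 2 * real i"
  have "?p = (\<Prod>i<n. a + 2 * real (n - Suc i))"
    by (rule prod.nat_diff_reindex[symmetric])
  then have "?p\<^sup>2 = (\<Prod>i<n. (a + 2 * real i) * (a + 2 * real (n - Suc i)))"
    by (simp add: power2_eq_square prod.distrib)
  also have "\<dots> \<le> (\<Prod>i<n. (a + real (n - 1))\<^sup>2)"
  proof (intro prod_mono conjI)
    fix i assume "i \<in> {..<n}"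
    then have "real (n - Suc i) = real (n - 1) - real i" by auto
    moreover have "(a + 2 * x) * (a + 2 * (m - x)) \<le> (a + m)\<^sup>2" for x m :: real
      using zero_le_power2[of "2 * x - m"] by (simp add: power2_eq_square algebra_simps)
    ultimately show "(a + 2 * real i) * (a + 2 * real (n - Suc i)) \<le> (a + real (n - 1))\<^sup>2" by simp
  qed (use assms in auto)
  also have "\<dots> = ((a + real (n - 1)) ^ n)\<^sup>2"
    by (simp only: prod_constant card_lessThan power_mult[symmetric] mult.commute)
  finally show ?thesis by (rule power2_le_imp_le) (use assms in auto)
qed

text \<open>
Passing from \<open>r\<close> to \<open>r + 2\<close> multiplies the quotient of the two products by
\<open>3 (3 r + 2) (3 r + 4) / ((2 r + 1) (2 r + 3))\<close>, which is at most 9.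
\<close>

lemma prod_ratio_le:
  assumes "r \<ge> 1"
  shows "(\<Prod>i<r. real (r + 2 * i)) \<le> 3 ^ (r - 1) * (\<Prod>i<r. real (1 + 2 * i))"
  using assms
proof (induction r rule: nat_induct2)
  case 0 then show ?case by simp
next
  case 1 then show ?case by simp
next
  case (step r)
  show ?case
  proof (cases "r = 0")
    case True then show ?thesis by (simp add: numeral_2_eq_2)
  next
    case False
    then have r: "real r > 0" by simp
    define Q where "Q = (\<Prod>i<r+2. real (r + 2 + 2 * i))"
    define A where "A = (\<Prod>i<r. real (r + 2 * i))"
    let ?B = "\<Prod>i<r. real (1 + 2 * i)"
    have "real r * Q = (\<Prod>i<Suc (r+2). real (r + 2 * i))"
      unfolding Q_def by (subst prod.lessThan_Suc_shift) simp
    also have "\<dots> = A * real (r + 2 * r) * real (r + 2 * (r + 1)) * real (r + 2 * (r + 2))"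
      by (simp add: A_def) (simp add: algebra_simps)
    also have "\<dots> = real r * (A * (3 * real (3 * r + 2) * real (3 * r + 4)))"
    proof -
      have "real (r + 2 * r) = 3 * real r" "real (r + 2 * (r + 1)) = real (3 * r + 2)"
        "real (r + 2 * (r + 2)) = real (3 * r + 4)" by simp_all
      then show ?thesis by (simp only: mult_ac)
    qed
    finally have "Q = A * (3 * real (3 * r + 2) * real (3 * r + 4))"
      using mult_left_cancel[of "real r", THEN iffD1, OF less_imp_neq[OF r, symmetric]] by blast
    also have "\<dots> \<le> (3 ^ (r - 1) * ?B) * (9 * (real (2 * r + 1) * real (2 * r + 3)))"
    proof (rule mult_mono)
      show "A \<le> 3 ^ (r - 1) * ?B" using step False by (auto simp: A_def)
      have "9 * (real (2 * r + 1) * real (2 * r + 3)) - 3 * real (3 * r + 2) * real (3 * r + 4)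
          = 9 * (real r * real r) + 18 * real r + 3"
        by (simp add: algebra_simps)
      moreover have "0 \<le> 9 * (real r * real r) + 18 * real r + 3" by simp
      ultimately show "3 * real (3 * r + 2) * real (3 * r + 4) \<le> 9 * (real (2 * r + 1) * real (2 * r + 3))"
        by linarith
    qed (auto intro!: mult_nonneg_nonneg prod_nonneg)
    also have "\<dots> = 3 ^ (r + 2 - 1) * (\<Prod>i<r+2. real (1 + 2 * i))"
    proof -
      have "(\<Prod>i<r+2. real (1 + 2 * i)) = ?B * real (2 * r + 1) * real (2 * r + 3)" by simp
      moreover have "3 ^ (r + 2 - 1) = 3 ^ (r - 1) * (9 :: real)" using False by (cases r) auto
      ultimately show ?thesis by (simp only: mult.assoc mult.left_commute)
    qed
    finally show ?thesis unfolding Q_def .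
  qed
qed

text \<open>
The moment bound with exponent \<open>j = r\<close>. There the product over \<open>k + 2 i\<close> is at most \<open>(k + r)\<^sup>r\<close>, so it
is absorbed by the power of \<open>\<surd>k + \<surd>r\<close> on the other side, and the product over \<open>r + 2 i\<close> divided by
\<open>1 \<cdot> 3 \<cdots> (2 r - 1)\<close> is at most \<open>3\<^bsup>r-1\<^esup>\<close>, which the factor \<open>10\<^sup>r\<close> outweighs.
\<close>

lemma gauss_norm_tail:
  assumes r: "CARD('r) \<ge> 2"
  shows "measure gauss {G :: real ^ 'r ^ 'k. \<exists>y. sqrt 10 * (sqrt (real CARD('k)) + sqrt (real CARD('r))) * norm y < norm (G *v y)} \<le> 3 / 100"
proof -
  define k r where "k = CARD('k)" and "r = CARD('r)"
  define T where "T = sqrt 10 * (sqrt (real k) + sqrt (real r))"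
  define \<mu> where "\<mu> = measure gauss {G :: real ^ 'r ^ 'k. \<exists>y. T * norm y < norm (G *v y)}"
  interpret prob_space "gauss :: (real ^ 'r ^ 'k) measure" by (rule prob_space_gauss)
  let ?B = "\<Prod>i<r. real (1 + 2 * i)"
  have r2: "r \<ge> 2" using assms by (simp add: r_def)
  have T: "T > 0" using r2 by (auto simp: T_def intro!: mult_pos_pos add_nonneg_pos)
  have B: "?B > 0" by (intro prod_pos) auto
  have pos: "T ^ (2 * r) * ?B > 0" using T B by simp
  have "\<mu> * (T ^ (2 * r) * ?B) \<le> (\<Prod>i<r. real (k + 2 * i)) * (\<Prod>i<r. real (r + 2 * i))"
  proof -
    have "ennreal \<mu> * ennreal (T ^ (2 * r) * ?B) \<le> ennreal ((\<Prod>i<r. real (k + 2 * i)) * (\<Prod>i<r. real (r + 2 * i)))"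
      using gauss_norm_tail_moment[where 'r='r and 'k='k, of T r] T r2
      unfolding \<mu>_def k_def r_def emeasure_eq_measure by simp
    moreover have "(\<Prod>i<r. real (k + 2 * i)) * (\<Prod>i<r. real (r + 2 * i)) \<ge> 0"
      by (intro mult_nonneg_nonneg prod_nonneg) auto
    moreover have "\<mu> \<ge> 0" by (simp add: \<mu>_def)
    ultimately show ?thesis using pos
      by (subst (asm) ennreal_mult[symmetric]) (auto simp del: of_nat_add of_nat_mult)
  qed
  also have "\<dots> \<le> ((sqrt (real k) + sqrt (real r))\<^sup>2) ^ r * (3 ^ (r - 1) * ?B)"
  proof (intro mult_mono)
    have "(\<Prod>i<r. real (k + 2 * i)) \<le> (real k + real (r - 1)) ^ r"
      using prod_arith_progression_le[of "real k" r] by simp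
    also have "\<dots> \<le> ((sqrt (real k) + sqrt (real r))\<^sup>2) ^ r"
    proof (intro power_mono)
      have "real (r - 1) \<le> real r" "0 \<le> sqrt (real k) * sqrt (real r)" by auto
      then show "real k + real (r - 1) \<le> (sqrt (real k) + sqrt (real r))\<^sup>2"
        unfolding power2_sum by (simp only: real_sqrt_pow2 of_nat_0_le_iff mult.assoc)
    qed simp
    finally show "(\<Prod>i<r. real (k + 2 * i)) \<le> ((sqrt (real k) + sqrt (real r))\<^sup>2) ^ r" .
    show "(\<Prod>i<r. real (r + 2 * i)) \<le> 3 ^ (r - 1) * ?B" using r2 by (intro prod_ratio_le) auto
  qed (auto intro!: prod_nonneg)
  also have "\<dots> = (3 ^ (r - 1) / 10 ^ r) * (T ^ (2 * r) * ?B)"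
    by (simp add: T_def power_mult power_mult_distrib)
  finally have "\<mu> \<le> 3 ^ (r - 1) / 10 ^ r"
    by (rule mult_right_le_imp_le[OF _ pos])
  also have "\<dots> = (3 / 10) ^ (r - 1) / 10"
    using r2 by (cases r) (simp_all add: power_divide)
  also have "\<dots> \<le> (3 / 10) ^ 1 / 10"
    using r2 by (intro divide_right_mono power_decreasing) auto
  finally show ?thesis by (simp add: \<mu>_def T_def k_def r_def)
qed

section \<open>Lower tail of the least singular value of a Gaussian matrix\<close>

lemma power2_norm_vec: "(norm (v :: real ^ 'k))\<^sup>2 = (\<Sum>i\<in>UNIV. (v $ i)\<^sup>2)"
  unfolding power2_norm_eq_inner by (simp add: inner_vec_def power2_eq_square)

text \<open>
Orthonormal bases of \<open>W\<close> and of its orthogonal complement together form an orthogonal matrix, whose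
rows from the second basis are orthogonal to \<open>W\<close>. The coordinates in \<open>D\<close> are chosen among these.
\<close>

lemma orthogonal_transformation_kill_subspace:
  fixes W :: "(real ^ 'k) set"
  assumes W: "subspace W" and n: "n + dim W \<le> CARD('k)"
  obtains f :: "real ^ 'k \<Rightarrow> real ^ 'k" and D where "orthogonal_transformation f" "card D = n"
    "\<And>w i. w \<in> W \<Longrightarrow> i \<in> D \<Longrightarrow> f w $ i = 0"
proof -
  define V where "V = {y. \<forall>x\<in>W. orthogonal x y}"
  have V: "subspace V" unfolding V_def by (rule subspace_orthogonal_to_vectors)
  have dims: "dim V + dim W = CARD('k)"
    using dim_subspace_orthogonal_to_vectors[OF W subspace_UNIV] by (simp add: V_def)
  obtain B1 where B1: "B1 \<subseteq> W" "pairwise orthogonal B1" "\<And>x. x \<in> B1 \<Longrightarrow> norm x = 1" "independent B1" "card B1 = dim W"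
    using orthonormal_basis_subspace[OF W] by metis
  obtain B2 where B2: "B2 \<subseteq> V" "pairwise orthogonal B2" "\<And>x. x \<in> B2 \<Longrightarrow> norm x = 1" "independent B2" "card B2 = dim V"
    using orthonormal_basis_subspace[OF V] by metis
  have perp: "orthogonal x y" if "x \<in> W" "y \<in> B2" for x y
    using that B2(1) by (auto simp: V_def)
  have fin: "finite B1" "finite B2" using B1(4) B2(4) by (auto simp: independent_imp_finite)
  have disj: "B1 \<inter> B2 = {}"
  proof (rule ccontr)
    assume "B1 \<inter> B2 \<noteq> {}"
    then obtain x where x: "x \<in> B1" "x \<in> B2" by auto
    then have "x = 0" using perp[of x x] B1(1) by (auto simp: orthogonal_self)
    with B1(3)[OF x(1)] show False by simp
  qed
  have card: "card (B1 \<union> B2) = CARD('k)"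
    using fin disj by (simp add: card_Un_disjoint B1(5) B2(5) dims add.commute)
  then obtain e where e: "bij_betw e (UNIV :: 'k set) (B1 \<union> B2)"
    using finite_same_card_bij[of "UNIV :: 'k set" "B1 \<union> B2"] fin by auto
  have eB: "e i \<in> B1 \<union> B2" for i using bij_betwE[OF e] by auto
  have norm: "norm (e i) = 1" for i using eB[of i] B1(3) B2(3) by auto
  have orth: "orthogonal (e i) (e j)" if "i \<noteq> j" for i j
  proof -
    have "e i \<noteq> e j" using that bij_betw_imp_inj_on[OF e] by (auto dest: inj_onD)
    then show ?thesis
      using eB[of i] eB[of j] B1(1) perp[of "e i" "e j"] perp[of "e j" "e i"] B1(2) B2(2)
      by (auto simp: pairwise_def orthogonal_commute)
  qed
  define Q where "Q = (\<chi> i. e i)"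
  have Q: "orthogonal_transformation ((*v) Q)"
    unfolding orthogonal_transformation_matrix orthogonal_matrix_orthonormal_rows
    using norm orth by (auto simp: Q_def row_def vec_lambda_eta)
  have Qi: "(Q *v w) $ i = e i \<bullet> w" for w i
    by (simp add: Q_def matrix_vector_mul_component)
  have "bij_betw e (e -` B2) B2"
    using e by (auto simp: bij_betw_def image_vimage_eq intro: inj_on_subset)
  then have "card (e -` B2) = dim V" using B2(5) bij_betw_same_card by metis
  then have "n \<le> card (e -` B2)" using n dims by simp
  then obtain D where D: "D \<subseteq> e -` B2" "card D = n" by (metis obtain_subset_with_card_n)
  have "(Q *v w) $ i = 0" if "w \<in> W" "i \<in> D" for w i
    using perp[OF that(1), of "e i"] D(1) that(2) by (auto simp: Qi orthogonal_def inner_commute)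
  then show ?thesis using that[OF Q D(2)] by blast
qed

lemma inverse_ennreal_antimono:
  assumes "0 \<le> a" "a \<le> b"
  shows "inverse (ennreal b) \<le> inverse (ennreal a)"
  using assms by (cases "a = 0") (auto simp: inverse_ennreal le_imp_inverse_le)

text \<open>
For injective \<open>G\<close> and dense \<open>Y\<close> this is the quadratic form \<open>x\<^sup>T (G\<^sup>T G)\<^bsup>-1\<^esup> x\<close>. Written as a supremum
over a countable set it is visibly measurable, and with values in the extended nonnegative reals
singular \<open>G\<close> need no separate treatment.
\<close>

definition inv_gram_form :: "(real ^ 'r) set \<Rightarrow> real ^ 'r \<Rightarrow> real ^ 'r ^ 'k \<Rightarrow> ennreal" where
  "inv_gram_form Y x G = (SUP y\<in>Y. ennreal ((x \<bullet> y)\<^sup>2) * inverse (ennreal ((norm (G *v y))\<^sup>2)))"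

lemma borel_measurable_inv_gram_form:
  fixes g :: "'w \<Rightarrow> real ^ 'r ^ 'k"
  assumes Y: "countable Y" and [measurable]: "f \<in> borel_measurable M" "g \<in> borel_measurable M"
  shows "(\<lambda>w. inv_gram_form Y (f w) (g w)) \<in> borel_measurable M"
  unfolding inv_gram_form_def using Y by measurable

lemma inv_gram_form_scaleR:
  assumes "Y \<noteq> {}"
  shows "inv_gram_form Y (c *\<^sub>R z) G = ennreal (c\<^sup>2) * inv_gram_form Y z G"
  using assms unfolding inv_gram_form_def
  by (simp add: SUP_mult_left_ennreal power_mult_distrib ennreal_mult mult.assoc)

text \<open>
For a unit vector \<open>z\<close> the quadratic form is the inverse square of the distance of the image of \<open>z\<close>
from the image of the orthogonal complement of \<open>z\<close>. The latter image has dimension less than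
\<open>CARD('r)\<close>, so after a rotation the distance is at least the norm of the \<open>CARD('k) + 1 - CARD('r)\<close>
coordinates in \<open>D\<close>. Neither \<open>f\<close> nor \<open>D\<close> depends on \<open>g\<close>, the new image of \<open>z\<close>, so \<open>g\<close> can be
integrated out first.
\<close>

lemma inv_gram_form_replace_image_le:
  fixes G :: "real ^ 'r ^ 'k"
  assumes z: "norm z = 1" and rk: "CARD('r) \<le> CARD('k)"
  obtains f :: "real ^ 'k \<Rightarrow> real ^ 'k" and D where "orthogonal_transformation f" "card D = CARD('k) + 1 - CARD('r)"
    "\<And>g Y. inv_gram_form Y z (replace_image z g G) \<le> inverse (ennreal (\<Sum>i\<in>D. (f g $ i)\<^sup>2))"
proof -
  define W where "W = (\<lambda>w. G *v w) ` {w. z \<bullet> w = 0}"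
  have W: "subspace W" unfolding W_def
    by (intro linear_subspace_image subspace_hyperplane matrix_vector_mul_linear)
  have "z \<noteq> 0" using z by auto
  then have "dim {w. z \<bullet> w = 0} = CARD('r) - 1" by (simp add: dim_hyperplane)
  moreover have "dim W \<le> dim {w. z \<bullet> w = 0}"
    unfolding W_def by (intro dim_image_le matrix_vector_mul_linear)
  moreover have "CARD('r) \<ge> 1" by (simp add: Suc_le_eq)
  ultimately have "(CARD('k) + 1 - CARD('r)) + dim W \<le> CARD('k)" using rk by linarith
  then obtain f :: "real ^ 'k \<Rightarrow> real ^ 'k" and D where f: "orthogonal_transformation f"
    and D: "card D = CARD('k) + 1 - CARD('r)" and fW: "\<And>w i. w \<in> W \<Longrightarrow> i \<in> D \<Longrightarrow> f w $ i = 0"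
    using orthogonal_transformation_kill_subspace[OF W] by metis
  have "inv_gram_form Y z (replace_image z g G) \<le> inverse (ennreal (\<Sum>i\<in>D. (f g $ i)\<^sup>2))" for g Y
    unfolding inv_gram_form_def
  proof (rule SUP_least)
    fix y
    define S where "S = (\<Sum>i\<in>D. (f g $ i)\<^sup>2)"
    define v where "v = G *v (y - (z \<bullet> y) *\<^sub>R z)"
    have "z \<bullet> (y - (z \<bullet> y) *\<^sub>R z) = 0" using z by (simp add: inner_diff_right norm_eq_1)
    then have "v \<in> W" unfolding W_def v_def by blast
    then have fv: "f ((z \<bullet> y) *\<^sub>R g + v) $ i = (z \<bullet> y) * f g $ i" if "i \<in> D" for i
      using fW that orthogonal_transformation_linear[OF f] by (simp add: linear_add linear_scale)
    have "(z \<bullet> y)\<^sup>2 * S = (\<Sum>i\<in>D. (f ((z \<bullet> y) *\<^sub>R g + v) $ i)\<^sup>2)"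
      by (simp add: S_def sum_distrib_left fv power_mult_distrib)
    also have "\<dots> \<le> (\<Sum>i\<in>UNIV. (f ((z \<bullet> y) *\<^sub>R g + v) $ i)\<^sup>2)"
      by (intro sum_mono2) auto
    also have "\<dots> = (norm (f ((z \<bullet> y) *\<^sub>R g + v)))\<^sup>2"
      by (rule power2_norm_vec[symmetric])
    also have "\<dots> = (norm (replace_image z g G *v y))\<^sup>2"
      by (simp add: orthogonal_transformation_norm[OF f] replace_image_mult_vec v_def)
    finally have le: "(z \<bullet> y)\<^sup>2 * S \<le> (norm (replace_image z g G *v y))\<^sup>2" .
    have S: "S \<ge> 0" by (simp add: S_def sum_nonneg)
    show "ennreal ((z \<bullet> y)\<^sup>2) * inverse (ennreal ((norm (replace_image z g G *v y))\<^sup>2)) \<le> inverse (ennreal (\<Sum>i\<in>D. (f g $ i)\<^sup>2))"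
    proof (cases "S = 0 \<or> z \<bullet> y = 0")
      case True
      then show ?thesis by (auto simp: S_def[symmetric])
    next
      case False
      then have "S > 0" "(z \<bullet> y)\<^sup>2 * S > 0" using S by auto
      then have "S > 0" "(norm (replace_image z g G *v y))\<^sup>2 > 0" using le by linarith+
      then show ?thesis using le unfolding S_def[symmetric]
        by (subst (1 2) inverse_ennreal) (auto simp: ennreal_mult[symmetric] field_simps intro!: ennreal_leI)
    qed
  qed
  with f D show ?thesis using that by blast
qed

lemma gauss_inv_gram_form_moment_le:
  fixes x :: "real ^ 'r"
  assumes Y: "countable Y" "Y \<noteq> {}" and j: "j \<ge> 1" and rk: "CARD('r) \<le> CARD('k)"
    and jk: "2 * j < CARD('k) + 1 - CARD('r)"
  shows "(\<integral>\<^sup>+G. inv_gram_form Y x G ^ j \<partial>(gauss :: (real ^ 'r ^ 'k) measure))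
    \<le> ennreal (norm x ^ (2 * j)) * ennreal (1 / (2 ^ (j - 1) * fact (j - 1) * real (CARD('k) + 1 - CARD('r) - 2 * j)))"
    (is "_ \<le> _ * ?M")
proof (cases "x = 0")
  case True
  then have "inv_gram_form Y x G = 0" for G :: "real ^ 'r ^ 'k"
    using Y(2) by (simp add: inv_gram_form_def)
  then show ?thesis using j by (simp add: power_0_left)
next
  case False
  define z where "z = x /\<^sub>R norm x"
  have z: "norm z = 1" "x = norm x *\<^sub>R z" using False by (auto simp: z_def)
  note [measurable (raw)] = borel_measurable_inv_gram_form[OF Y(1)]
  have "(\<integral>\<^sup>+G. inv_gram_form Y x G ^ j \<partial>(gauss :: (real ^ 'r ^ 'k) measure))
     = (\<integral>\<^sup>+G. ennreal (norm x ^ (2 * j)) * inv_gram_form Y z G ^ j \<partial>(gauss :: (real ^ 'r ^ 'k) measure))"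
    by (subst z(2)) (simp add: inv_gram_form_scaleR[OF Y(2)] power_mult_distrib ennreal_power power_mult)
  also have "\<dots> = ennreal (norm x ^ (2 * j)) * (\<integral>\<^sup>+G. inv_gram_form Y z G ^ j \<partial>(gauss :: (real ^ 'r ^ 'k) measure))"
    by (rule nn_integral_cmult) measurable
  also have "(\<integral>\<^sup>+G. inv_gram_form Y z G ^ j \<partial>(gauss :: (real ^ 'r ^ 'k) measure))
     = (\<integral>\<^sup>+G. (\<integral>\<^sup>+g. inv_gram_form Y z (replace_image z g G) ^ j \<partial>gauss) \<partial>(gauss :: (real ^ 'r ^ 'k) measure))"
    by (rule nn_integral_gauss_replace_image[OF z(1)]) measurable
  also have "\<dots> \<le> (\<integral>\<^sup>+G. ?M \<partial>(gauss :: (real ^ 'r ^ 'k) measure))"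
  proof (intro nn_integral_mono)
    fix G :: "real ^ 'r ^ 'k"
    obtain f :: "real ^ 'k \<Rightarrow> real ^ 'k" and D where f: "orthogonal_transformation f"
      and D: "card D = CARD('k) + 1 - CARD('r)"
      and le: "\<And>g. inv_gram_form Y z (replace_image z g G) \<le> inverse (ennreal (\<Sum>i\<in>D. (f g $ i)\<^sup>2))"
      using inv_gram_form_replace_image_le[OF z(1) rk, of G] by metis
    have "(\<integral>\<^sup>+g. inv_gram_form Y z (replace_image z g G) ^ j \<partial>gauss) \<le> (\<integral>\<^sup>+g. inverse (ennreal (\<Sum>i\<in>D. (f g $ i)\<^sup>2)) ^ j \<partial>gauss)"
      by (intro nn_integral_mono power_mono le) auto
    also have "\<dots> = (\<integral>\<^sup>+g. inverse (ennreal (\<Sum>i\<in>D. (g $ i)\<^sup>2)) ^ j \<partial>(gauss :: (real ^ 'k) measure))"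
      by (rule nn_integral_gauss_orthogonal[OF f, where h="\<lambda>g. inverse (ennreal (\<Sum>i\<in>D. (g $ i)\<^sup>2)) ^ j"]) measurable
    also have "\<dots> \<le> ennreal (1 / (2 ^ (j - 1) * fact (j - 1) * real (card D - 2 * j)))"
      by (rule gauss_inverse_partial_norm_moment_le[OF j]) (use jk D in simp)
    finally show "(\<integral>\<^sup>+g. inv_gram_form Y z (replace_image z g G) ^ j \<partial>gauss) \<le> ?M" by (simp add: D)
  qed
  also have "\<dots> = ?M" by simp
  finally show ?thesis by (simp add: mult_left_mono)
qed

text \<open>
The argument of \<open>gauss_norm_tail_moment\<close> for the inverse Gram form: if \<open>|G y| < s |y|\<close>, then the form
at \<open>x\<close> is at least \<open>\<langle>x, w\<rangle>\<^sup>2\<close> for the multiple \<open>w\<close> of \<open>y\<close> with norm \<open>1 / s\<close>. The set \<open>Y\<close> is dense, so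
\<open>y\<close> can be chosen in it.
\<close>

lemma gauss_small_moment:
  assumes s: "s > 0" and j: "j \<ge> 1" and rk: "CARD('r) \<le> CARD('k)"
    and jk: "2 * j < CARD('k) + 1 - CARD('r)"
  shows "emeasure gauss {G :: real ^ 'r ^ 'k. \<exists>y. norm (G *v y) < s * norm y}
      * ennreal ((1 / s) ^ (2 * j) * (fact (2 * j) / (2 ^ j * fact j)))
    \<le> ennreal ((\<Prod>i<j. real (CARD('r) + 2 * i)) * (1 / (2 ^ (j - 1) * fact (j - 1) * real (CARD('k) + 1 - CARD('r) - 2 * j))))"
proof -
  let ?M = "1 / (2 ^ (j - 1) * fact (j - 1) * real (CARD('k) + 1 - CARD('r) - 2 * j))"
  define A where "A = {G :: real ^ 'r ^ 'k. \<exists>y. norm (G *v y) < s * norm y}"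
  have [measurable]: "A \<in> sets borel" unfolding A_def by (intro borel_open open_matrices_below)
  obtain Y :: "(real ^ 'r) set" where Y: "countable Y" and dense: "\<And>X. open X \<Longrightarrow> X \<noteq> {} \<Longrightarrow> \<exists>d\<in>Y. d \<in> X"
    using countable_dense_setE by blast
  note [measurable (raw)] = borel_measurable_inv_gram_form[OF Y]
  have Yne: "Y \<noteq> {}" using dense[of UNIV] by auto
  have lower: "ennreal ((1 / s) ^ (2 * j) * (fact (2 * j) / (2 ^ j * fact j))) \<le> (\<integral>\<^sup>+x. inv_gram_form Y x G ^ j \<partial>gauss)"
    if "G \<in> A" for G
  proof -
    have "open {y. norm (G *v y) < s * norm y}"
      by (intro open_Collect_less continuous_intros linear_continuous_on) (simp add: matrix_vector_mul_bounded_linear)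
    moreover have "{y. norm (G *v y) < s * norm y} \<noteq> {}" using that by (auto simp: A_def)
    ultimately obtain y where y: "y \<in> Y" "norm (G *v y) < s * norm y" using dense by blast
    define w where "w = y /\<^sub>R (s * norm y)"
    have y0: "norm y > 0" using y(2) s by (auto simp: zero_less_mult_iff dest: le_less_trans[OF norm_ge_zero])
    have w: "norm w = 1 / s" using y0 s by (simp add: w_def field_simps)
    have "ennreal ((x \<bullet> w)\<^sup>2) \<le> inv_gram_form Y x G" for x
    proof -
      have "ennreal ((x \<bullet> w)\<^sup>2) = ennreal ((x \<bullet> y)\<^sup>2) * inverse (ennreal ((s * norm y)\<^sup>2))"
        using y0 s by (subst inverse_ennreal)
          (simp_all add: w_def ennreal_mult[symmetric] power_mult_distrib power_inverse mult.commute)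
      also have "\<dots> \<le> ennreal ((x \<bullet> y)\<^sup>2) * inverse (ennreal ((norm (G *v y))\<^sup>2))"
        by (intro mult_left_mono inverse_ennreal_antimono power_mono) (use y(2) in auto)
      also have "\<dots> \<le> inv_gram_form Y x G" unfolding inv_gram_form_def by (rule SUP_upper[OF y(1)])
      finally show ?thesis .
    qed
    then have "(\<integral>\<^sup>+x. ennreal ((x \<bullet> w)\<^sup>2) ^ j \<partial>gauss) \<le> (\<integral>\<^sup>+x. inv_gram_form Y x G ^ j \<partial>gauss)"
      by (intro nn_integral_mono power_mono) auto
    then show ?thesis
      using gauss_inner_moment[of w j] by (simp add: ennreal_power w power_mult)
  qed
  have "emeasure gauss A * ennreal ((1 / s) ^ (2 * j) * (fact (2 * j) / (2 ^ j * fact j)))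
      = (\<integral>\<^sup>+G. ennreal ((1 / s) ^ (2 * j) * (fact (2 * j) / (2 ^ j * fact j))) * indicator A G \<partial>gauss)"
    by (subst nn_integral_cmult_indicator) (simp_all add: mult.commute)
  also have "\<dots> \<le> (\<integral>\<^sup>+G. (\<integral>\<^sup>+x. inv_gram_form Y x G ^ j \<partial>gauss) \<partial>(gauss :: (real ^ 'r ^ 'k) measure))"
    by (intro nn_integral_mono) (auto simp: indicator_def dest: lower)
  also have "\<dots> = (\<integral>\<^sup>+x. (\<integral>\<^sup>+G. inv_gram_form Y x G ^ j \<partial>(gauss :: (real ^ 'r ^ 'k) measure)) \<partial>gauss)"
    by (rule nn_integral_gauss_swap) measurable
  also have "\<dots> \<le> (\<integral>\<^sup>+x. ennreal (norm x ^ (2 * j)) * ennreal ?M \<partial>(gauss :: (real ^ 'r) measure))"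
    by (intro nn_integral_mono gauss_inv_gram_form_moment_le Y Yne j rk jk)
  also have "\<dots> = (\<integral>\<^sup>+x. ennreal (norm x ^ (2 * j)) \<partial>(gauss :: (real ^ 'r) measure)) * ennreal ?M"
    by (rule nn_integral_multc) measurable
  also have "\<dots> \<le> ennreal (\<Prod>i<j. real (CARD('r) + 2 * i)) * ennreal ?M"
    using gauss_norm_moment_le[where 'a="real ^ 'r", of j] by (intro mult_right_mono) auto
  also have "\<dots> = ennreal ((\<Prod>i<j. real (CARD('r) + 2 * i)) * ?M)"
    by (subst ennreal_mult[symmetric]) (auto intro!: prod_nonneg)
  finally show ?thesis unfolding A_def .
qed

lemma power_self_le_exp_fact:
  assumes "n \<ge> 1"
  shows "real n ^ n \<le> exp 1 ^ (n - 1) * fact n"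
  using assms
proof (induction n rule: nat_induct_at_least)
  case base then show ?case by simp
next
  case (Suc n)
  have "real (Suc n) ^ Suc n = real (Suc n) * ((1 + 1 / real n) ^ n * real n ^ n)"
    using Suc.hyps by (simp add: power_mult_distrib[symmetric] field_simps)
  also have "\<dots> \<le> real (Suc n) * (exp 1 * (exp 1 ^ (n - 1) * fact n))"
  proof (intro mult_left_mono mult_mono Suc.IH)
    have "(1 + 1 / real n) ^ n \<le> exp (1 / real n) ^ n"
      by (intro power_mono exp_ge_add_one_self) auto
    then show "(1 + 1 / real n) ^ n \<le> exp 1"
      using Suc.hyps by (simp add: exp_of_nat_mult[symmetric])
  qed auto
  also have "\<dots> = exp 1 ^ (Suc n - 1) * fact (Suc n)"
    using Suc.hyps by (cases n) (auto simp: algebra_simps)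
  finally show ?case .
qed

text \<open>
With \<open>p = k - r\<close>, the inverse moment of order \<open>2 j\<close> is finite for \<open>2 j < p + 1\<close>, and \<open>j = p div 2\<close> is
the largest such \<open>j\<close>. The products over \<open>r + 2 i\<close> are bounded by \<open>k\<^sup>j\<close>, which cancels the power of
\<open>\<surd>k\<close> in the threshold. The factorials combine to \<open>(2 j)!\<close>, and Stirling's bound
\<open>p\<^sup>p \<le> e\<^bsup>p-1\<^esup> p!\<close> cancels the powers of \<open>e\<close> and \<open>p\<close>. What is left is \<open>j / 10\<^sup>j\<close>.
\<close>

lemma gauss_small_tail:
  assumes rk: "CARD('r) + 2 \<le> CARD('k)"
  shows "measure gauss {G :: real ^ 'r ^ 'k. \<exists>y. norm (G *v y) <
      (real CARD('k) - real CARD('r)) / (sqrt 10 * exp 1 * sqrt (real CARD('k))) * norm y} \<le> 1 / 10"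
proof -
  define k r where "k = CARD('k)" and "r = CARD('r)"
  define p where "p = k - r"
  define j where "j = p div 2"
  define s where "s = (real k - real r) / (sqrt 10 * exp 1 * sqrt (real k))"
  define \<mu> where "\<mu> = measure gauss {G :: real ^ 'r ^ 'k. \<exists>y. norm (G *v y) < s * norm y}"
  interpret prob_space "gauss :: (real ^ 'r ^ 'k) measure" by (rule prob_space_gauss)
  have p: "p \<ge> 2" "real k - real r = real p" "k = r + p" using rk by (auto simp: p_def k_def r_def)
  have j: "j \<ge> 1" "2 * j \<le> p" "p + 1 - 2 * j > 0" using p by (auto simp: j_def)
  have k: "real k > 0" using p by simp
  have s: "s > 0" unfolding s_def p(2) using p k by auto
  have k1: "CARD('k) + 1 - CARD('r) = p + 1" using p(3) by (simp add: k_def r_def)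
  define c :: real where "c = (1 / s) ^ (2 * j) * (fact (2 * j) / (2 ^ j * fact j))"
  define d :: real where "d = (\<Prod>i<j. real (r + 2 * i)) * (1 / (2 ^ (j - 1) * fact (j - 1) * real (p + 1 - 2 * j)))"
  have c: "c > 0" using s by (simp add: c_def)
  have d: "d \<ge> 0" unfolding d_def by (intro mult_nonneg_nonneg prod_nonneg) auto
  have "ennreal \<mu> * ennreal c \<le> ennreal d"
    using gauss_small_moment[where 'r='r and 'k='k, OF s j(1)] rk j(3)
    unfolding \<mu>_def c_def d_def k_def r_def emeasure_eq_measure k1 by simp
  then have "\<mu> * c \<le> d" using c d
    by (subst (asm) ennreal_mult[symmetric]) (auto simp: \<mu>_def)
  also have "d \<le> real k ^ j * (1 / (2 ^ (j - 1) * fact (j - 1) * real (p + 1 - 2 * j)))"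
  proof -
    have "(\<Prod>i<j. real (r + 2 * i)) \<le> (\<Prod>i<j. real k)"
      using j p(3) by (intro prod_mono) auto
    then show ?thesis unfolding d_def by (intro mult_right_mono) auto
  qed
  also have "\<dots> = (real p ^ (2 * j) / (10 ^ j * exp 1 ^ (2 * j)) * (2 * real j / (fact (2 * j) * real (p + 1 - 2 * j)))) * c"
  proof -
    have f: "2 ^ j * fact j = 2 * real j * (2 ^ (j - 1) * fact (j - 1))"
      using j(1) by (cases j) auto
    have "s ^ (2 * j) = real p ^ (2 * j) / (10 ^ j * exp 1 ^ (2 * j)) / real k ^ j"
      unfolding s_def p(2) using k by (simp add: power_divide power_mult_distrib power_mult)
    moreover have "real p ^ (2 * j) / (10 ^ j * exp 1 ^ (2 * j)) \<noteq> 0" using p by simp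
    ultimately have e1: "real k ^ j = real p ^ (2 * j) / (10 ^ j * exp 1 ^ (2 * j)) * (1 / s) ^ (2 * j)"
      by (simp only: power_one_over) (simp del: power_divide)
    have e2: "1 / (2 ^ (j - 1) * fact (j - 1) * real (p + 1 - 2 * j))
      = fact (2 * j) / (2 ^ j * fact j) * (2 * real j / (fact (2 * j) * real (p + 1 - 2 * j)))"
      unfolding f using j by simp
    show ?thesis unfolding c_def e1 e2 by (simp only: mult_ac)
  qed
  finally have "\<mu> \<le> real p ^ (2 * j) / (10 ^ j * exp 1 ^ (2 * j)) * (2 * real j / (fact (2 * j) * real (p + 1 - 2 * j)))"
    by (rule mult_right_le_imp_le[OF _ c])
  also have "\<dots> \<le> real j / 10 ^ j"
  proof (cases "even p")
    case True
    then have pj: "p = 2 * j" by (simp add: j_def)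
    \<comment> \<open>the bound \<open>2 \<le> e\<close> makes up for the denominator \<open>p + 1 - 2 j\<close>, which is 1 here and 2 for odd \<open>p\<close>\<close>
    have "real p ^ p \<le> exp 1 ^ (p - 1) * fact p" using p by (intro power_self_le_exp_fact) auto
    also have "\<dots> * 2 \<le> exp 1 ^ (p - 1) * fact p * exp 1"
      using exp_ge_add_one_self[of 1] by (intro mult_left_mono) auto
    also have "\<dots> = exp 1 ^ p * fact p" using p by (cases p) auto
    finally have "real p ^ p * 2 \<le> exp 1 ^ p * fact p" by simp
    then have "(real p ^ p * 2) * (real j / (10 ^ j * exp 1 ^ p * fact p)) \<le> (exp 1 ^ p * fact p) * (real j / (10 ^ j * exp 1 ^ p * fact p))"
      by (intro mult_right_mono) auto
    moreover have "2 * j = p" "real (p + 1 - p) = 1" using pj by simp_all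
    ultimately show ?thesis by (simp only:) (simp add: mult_ac)
  next
    case False
    then have pj: "p = Suc (2 * j)" by (simp add: j_def)
    have "real p ^ p \<le> exp 1 ^ (p - 1) * fact p" using p by (intro power_self_le_exp_fact) auto
    then have "real p * real p ^ (2 * j) \<le> real p * (exp 1 ^ (2 * j) * fact (2 * j))"
      by (simp add: pj mult_ac)
    then have "real p ^ (2 * j) \<le> exp 1 ^ (2 * j) * fact (2 * j)"
      using p by (subst (asm) mult_le_cancel_left_pos) auto
    then have "real p ^ (2 * j) * (real j / (10 ^ j * exp 1 ^ (2 * j) * fact (2 * j))) \<le> (exp 1 ^ (2 * j) * fact (2 * j)) * (real j / (10 ^ j * exp 1 ^ (2 * j) * fact (2 * j)))"
      by (intro mult_right_mono) auto
    moreover have "real (p + 1 - 2 * j) = 2" by (simp add: pj)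
    ultimately show ?thesis by (simp add: mult_ac)
  qed
  also have "\<dots> \<le> 1 / 10"
  proof -
    have "10 * j \<le> 10 ^ j" using j(1)
      by (induction j rule: nat_induct_at_least) auto
    then have "10 * real j \<le> 10 ^ j" by (metis of_nat_le_iff of_nat_mult of_nat_numeral of_nat_power)
    then show ?thesis by (simp add: field_simps)
  qed
  finally show ?thesis unfolding \<mu>_def s_def k_def r_def .
qed

section \<open>Spectral norm, submatrices and pseudo inverses\<close>

text \<open>
Keeps \<open>transpose A *v y\<close> in the form in which it appears as the adjoint of \<open>A\<close>.
\<close>

declare transpose_matrix_vector [simp del]

lemma spectral_norm_nonneg: "0 \<le> spectral_norm A"
  unfolding spectral_norm_def by (rule onorm_pos_le[OF matrix_vector_mul_bounded_linear])

lemma norm_mult_vec_le: "norm (A *v x) \<le> spectral_norm A * norm x"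
  unfolding spectral_norm_def by (rule onorm[OF matrix_vector_mul_bounded_linear])

lemma spectral_norm_le: "(\<And>x. norm (A *v x) \<le> c * norm x) \<Longrightarrow> spectral_norm A \<le> c"
  unfolding spectral_norm_def by (rule onorm_le)

lemma norm_mult_vec_le_trans: "spectral_norm A \<le> c \<Longrightarrow> norm (A *v x) \<le> c * norm x"
  by (meson mult_right_mono norm_ge_zero norm_mult_vec_le order_trans)

lemma spectral_norm_mult_le: "spectral_norm (A ** B) \<le> spectral_norm A * spectral_norm B"
proof (rule spectral_norm_le)
  fix x
  have "norm (A *v (B *v x)) \<le> spectral_norm A * norm (B *v x)" by (rule norm_mult_vec_le)
  also have "\<dots> \<le> spectral_norm A * (spectral_norm B * norm x)"
    by (intro mult_left_mono norm_mult_vec_le spectral_norm_nonneg)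
  finally show "norm ((A ** B) *v x) \<le> spectral_norm A * spectral_norm B * norm x"
    by (simp add: matrix_vector_mul_assoc)
qed

lemma spectral_norm_mult_le_bound:
  assumes "spectral_norm A \<le> a" "spectral_norm B \<le> b"
  shows "spectral_norm (A ** B) \<le> a * b"
  by (rule order_trans[OF spectral_norm_mult_le mult_mono[OF assms order_trans[OF spectral_norm_nonneg assms(1)] spectral_norm_nonneg]])

lemma inner_mult_transpose:
  fixes A :: "real ^ 'n ^ 'm"
  shows "(A *v x) \<bullet> y = x \<bullet> (transpose A *v y)"
proof -
  have "(A *v x) \<bullet> y = y \<bullet> (A *v x)" by (rule inner_commute)
  also have "\<dots> = (y v* A) \<bullet> x" by (rule dot_lmul_matrix[symmetric])
  also have "\<dots> = x \<bullet> (transpose A *v y)" by (simp only: transpose_matrix_vector inner_commute)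
  finally show ?thesis .
qed

lemma spectral_norm_transpose_le: "spectral_norm (transpose A) \<le> spectral_norm A"
proof (rule spectral_norm_le)
  fix y
  have "(norm (transpose A *v y))\<^sup>2 = (A *v (transpose A *v y)) \<bullet> y"
    by (simp add: inner_mult_transpose power2_norm_eq_inner)
  also have "\<dots> \<le> norm (A *v (transpose A *v y)) * norm y" by (rule norm_cauchy_schwarz)
  also have "\<dots> \<le> (spectral_norm A * norm (transpose A *v y)) * norm y"
    by (intro mult_right_mono norm_mult_vec_le) auto
  finally have "norm (transpose A *v y) * norm (transpose A *v y) \<le> (spectral_norm A * norm y) * norm (transpose A *v y)"
    by (simp add: power2_eq_square mult_ac)
  then show "norm (transpose A *v y) \<le> spectral_norm A * norm y"
    using mult_right_le_imp_le[of "norm (transpose A *v y)" "norm (transpose A *v y)"] spectral_norm_nonneg[of A]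
    by (cases "norm (transpose A *v y) > 0") auto
qed

lemma spectral_norm_row_submatrix_le:
  assumes p: "inj p"
  shows "spectral_norm (row_submatrix p A) \<le> spectral_norm A"
proof (rule spectral_norm_le)
  fix x
  have "(norm (row_submatrix p A *v x))\<^sup>2 = (\<Sum>i\<in>UNIV. ((A *v x) $ p i)\<^sup>2)"
    by (simp add: power2_norm_vec matrix_vector_mult_def row_submatrix_def)
  also have "\<dots> = (\<Sum>i\<in>range p. ((A *v x) $ i)\<^sup>2)"
    by (simp add: sum.reindex[OF p])
  also have "\<dots> \<le> (norm (A *v x))\<^sup>2"
    unfolding power2_norm_vec by (intro sum_mono2) auto
  finally have "norm (row_submatrix p A *v x) \<le> norm (A *v x)" by (rule power2_le_imp_le) simp
  then show "norm (row_submatrix p A *v x) \<le> spectral_norm A * norm x"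
    using norm_mult_vec_le[of A x] by linarith
qed

lemma transpose_col_submatrix: "col_submatrix q A = transpose (row_submatrix q (transpose A))"
  by (simp add: vec_eq_iff col_submatrix_def row_submatrix_def transpose_def)

lemma spectral_norm_col_submatrix_le:
  assumes "inj q"
  shows "spectral_norm (col_submatrix q A) \<le> spectral_norm A"
  unfolding transpose_col_submatrix
  by (meson assms order_trans spectral_norm_row_submatrix_le spectral_norm_transpose_le)

lemma row_submatrix_mult: "row_submatrix p (A ** B) = row_submatrix p A ** B"
  by (simp add: vec_eq_iff row_submatrix_def matrix_matrix_mult_def)

lemma col_submatrix_mult: "col_submatrix q (A ** B) = A ** col_submatrix q B"
  by (simp add: vec_eq_iff col_submatrix_def matrix_matrix_mult_def)

lemma row_submatrix_add: "row_submatrix p (A + B) = row_submatrix p A + row_submatrix p B"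
  by (simp add: vec_eq_iff row_submatrix_def)

lemma col_submatrix_add: "col_submatrix q (A + B) = col_submatrix q A + col_submatrix q B"
  by (simp add: vec_eq_iff col_submatrix_def)

lemma submatrix_eq_row_col: "submatrix p q A = row_submatrix p (col_submatrix q A)"
  by (simp add: vec_eq_iff submatrix_def row_submatrix_def col_submatrix_def)

text \<open>
The left inverse \<open>Y = (G\<^sup>T G)\<^bsup>-1\<^esup> G\<^sup>T\<close>. Its norm is small because \<open>G Y\<close> is the orthogonal projection to
the range of \<open>G\<close>, whence \<open>s |Y z| \<le> |G Y z| \<le> |z|\<close>.
\<close>

lemma exists_bounded_left_inverse:
  fixes G :: "real ^ 'r ^ 'k"
  assumes s: "s > 0" and lower: "\<And>y. s * norm y \<le> norm (G *v y)"
  obtains Y where "Y ** G = mat 1" "spectral_norm Y \<le> 1 / s"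
proof -
  let ?W = "transpose G ** G"
  have "inj ((*v) ?W)"
  proof (rule linear_injective_0[THEN iffD2, rule_format])
    show "linear ((*v) ?W)" by (rule matrix_vector_mul_linear)
    fix y assume "?W *v y = 0"
    then have "(G *v y) \<bullet> (G *v y) = 0"
      by (simp add: inner_mult_transpose matrix_vector_mul_assoc)
    then show "y = 0" using lower[of y] s by (simp add: mult_le_0_iff)
  qed
  then obtain Y0 where Y0: "Y0 ** ?W = mat 1"
    using matrix_left_invertible_injective[of ?W] by auto
  then have Y0': "?W ** Y0 = mat 1" by (simp add: matrix_left_right_inverse)
  define Y where "Y = Y0 ** transpose G"
  have "Y ** G = mat 1" using Y0 by (simp add: Y_def matrix_mul_assoc)
  moreover have "spectral_norm Y \<le> 1 / s"
  proof (rule spectral_norm_le)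
    fix z
    define y where "y = Y *v z"
    have "transpose G *v (G *v y) = (?W ** Y0) *v (transpose G *v z)"
      by (simp add: y_def Y_def matrix_vector_mul_assoc[symmetric])
    then have normal: "transpose G *v (G *v y) = transpose G *v z" by (simp add: Y0')
    have "norm (G *v y) * norm (G *v y) = (G *v y) \<bullet> (G *v y)" by (simp add: dot_square_norm power2_eq_square)
    also have "\<dots> = (G *v y) \<bullet> z" by (simp add: inner_mult_transpose normal)
    also have "\<dots> \<le> norm z * norm (G *v y)" using norm_cauchy_schwarz[of "G *v y" z] by (simp add: mult.commute)
    finally have "norm (G *v y) \<le> norm z"
      using mult_right_le_imp_le[of "norm (G *v y)" "norm (G *v y)"]
      by (cases "norm (G *v y) > 0") auto
    then have "s * norm y \<le> norm z" using lower[of y] by linarith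
    then show "norm (Y *v z) \<le> 1 / s * norm z" using s by (simp add: y_def field_simps)
  qed
  ultimately show ?thesis using that by blast
qed

lemma pinv_eqI:
  fixes A :: "real ^ 'n ^ 'm"
  assumes X: "A ** X ** A = A" "X ** A ** X = X" "transpose (A ** X) = A ** X" "transpose (X ** A) = X ** A"
  shows "pinv A = X"
  unfolding pinv_def
proof (rule the_equality)
  fix Y :: "real ^ 'm ^ 'n"
  assume Y: "A ** Y ** A = A \<and> Y ** A ** Y = Y \<and> transpose (A ** Y) = A ** Y \<and> transpose (Y ** A) = Y ** A"
  have "A ** X = (A ** Y) ** (A ** X)" using Y by (simp add: matrix_mul_assoc)
  also have "\<dots> = transpose ((A ** X) ** (A ** Y))" using X Y by (simp add: matrix_transpose_mul)
  also have "\<dots> = A ** Y" using X Y by (simp add: matrix_mul_assoc)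
  finally have 1: "A ** X = A ** Y" .
  have "X ** A = (X ** A) ** (Y ** A)" using Y by (simp add: matrix_mul_assoc[symmetric])
  also have "\<dots> = transpose ((Y ** A) ** (X ** A))" using X Y by (simp add: matrix_transpose_mul)
  also have "(Y ** A) ** (X ** A) = Y ** A" using X(1) by (simp add: matrix_mul_assoc[symmetric])
  finally have 2: "X ** A = Y ** A" using Y by simp
  have "X = X ** A ** X" using X by simp
  also have "\<dots> = Y ** A ** X" by (simp add: 2)
  also have "\<dots> = Y ** (A ** Y)" by (simp add: matrix_mul_assoc[symmetric] 1)
  finally show "Y = X" using Y by (simp add: matrix_mul_assoc)
qed (use X in auto)

section \<open>Sums over singular triples\<close>

definition orthonormal_on :: "nat set \<Rightarrow> (nat \<Rightarrow> real ^ 'm) \<Rightarrow> bool" where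
  "orthonormal_on I u \<longleftrightarrow> (\<forall>i\<in>I. \<forall>j\<in>I. u i \<bullet> u j = (if i = j then 1 else 0))"

text \<open>
The sum \<open>svd_sum\<close> over an arbitrary index set, so that a decomposition can be split at index \<open>r\<close>.
\<close>

definition singular_sum ::
    "nat set \<Rightarrow> (nat \<Rightarrow> real ^ 'm) \<Rightarrow> (nat \<Rightarrow> real) \<Rightarrow> (nat \<Rightarrow> real ^ 'n) \<Rightarrow> real ^ 'n ^ 'm" where
  "singular_sum I u s v = (\<Sum>i\<in>I. s i *\<^sub>R (\<chi> a b. u i $ a * v i $ b))"

lemma svd_sum_eq_singular_sum: "svd_sum d u s v = singular_sum {1..d} u s v"
  by (simp add: svd_sum_def singular_sum_def)

lemma orthonormal_on_subset: "orthonormal_on I u \<Longrightarrow> J \<subseteq> I \<Longrightarrow> orthonormal_on J u"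
  unfolding orthonormal_on_def by blast

lemma singular_sum_mult_vec: "singular_sum I u s v *v x = (\<Sum>i\<in>I. (s i * (v i \<bullet> x)) *\<^sub>R u i)"
proof (cases "finite I")
  case True
  then show ?thesis
  proof (induction I)
    case (insert i I)
    have "(\<chi> a b. u i $ a * v i $ b) *v x = (v i \<bullet> x) *\<^sub>R u i"
      by (simp add: vec_eq_iff matrix_vector_mult_def inner_vec_def sum_distrib_right sum_distrib_left mult_ac)
    then show ?case using insert
      by (simp add: singular_sum_def matrix_vector_mult_add_rdistrib scaleR_matrix_vector_assoc[symmetric])
  qed (simp add: singular_sum_def)
qed (simp add: singular_sum_def)

lemma transpose_singular_sum: "transpose (singular_sum I u s v) = singular_sum I v s u"
  by (simp add: vec_eq_iff transpose_def singular_sum_def mult_ac)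

lemma norm_orthonormal_sum:
  assumes "finite I" "orthonormal_on I u"
  shows "(norm (\<Sum>i\<in>I. c i *\<^sub>R u i))\<^sup>2 = (\<Sum>i\<in>I. (c i)\<^sup>2)"
proof -
  have "(norm (\<Sum>i\<in>I. c i *\<^sub>R u i))\<^sup>2 = (\<Sum>i\<in>I. \<Sum>j\<in>I. c i * c j * (u i \<bullet> u j))"
    by (simp add: power2_norm_eq_inner inner_sum_left inner_sum_right sum_distrib_left mult_ac inner_commute)
  also have "\<dots> = (\<Sum>i\<in>I. \<Sum>j\<in>I. if i = j then (c i)\<^sup>2 else 0)"
    using assms(2) by (intro sum.cong refl) (auto simp: orthonormal_on_def power2_eq_square)
  also have "\<dots> = (\<Sum>i\<in>I. (c i)\<^sup>2)" using assms(1) by simp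
  finally show ?thesis .
qed

lemma inner_orthonormal_sum:
  assumes "finite I" "orthonormal_on I u" "j \<in> I"
  shows "u j \<bullet> (\<Sum>i\<in>I. c i *\<^sub>R u i) = c j"
proof -
  have "u j \<bullet> (\<Sum>i\<in>I. c i *\<^sub>R u i) = (\<Sum>i\<in>I. if i = j then c i else 0)"
    using assms(2,3) by (auto simp: inner_sum_right orthonormal_on_def intro!: sum.cong)
  then show ?thesis using assms(1,3) by simp
qed

lemma bessel_inequality:
  assumes I: "finite I" "orthonormal_on I v"
  shows "(\<Sum>i\<in>I. (v i \<bullet> x)\<^sup>2) \<le> (norm x)\<^sup>2"
proof -
  define p where "p = (\<Sum>i\<in>I. (v i \<bullet> x) *\<^sub>R v i)"
  have "p \<bullet> x = (\<Sum>i\<in>I. (v i \<bullet> x)\<^sup>2)" by (simp add: p_def inner_sum_left power2_eq_square)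
  moreover have "p \<bullet> p = (\<Sum>i\<in>I. (v i \<bullet> x)\<^sup>2)"
    using norm_orthonormal_sum[OF I, of "\<lambda>i. v i \<bullet> x"] by (simp add: p_def power2_norm_eq_inner)
  moreover have "0 \<le> (x - p) \<bullet> (x - p)" by (rule inner_ge_zero)
  moreover have "(x - p) \<bullet> (x - p) = x \<bullet> x - 2 * (p \<bullet> x) + p \<bullet> p"
    by (simp add: inner_diff_left inner_diff_right inner_commute)
  ultimately show ?thesis by (simp add: power2_norm_eq_inner)
qed

lemma orthonormal_expansion:
  assumes I: "finite I" "orthonormal_on I v" and x: "x \<in> span (v ` I)"
  shows "(\<Sum>i\<in>I. (v i \<bullet> x) *\<^sub>R v i) = x"
proof -
  let ?p = "\<Sum>i\<in>I. (v i \<bullet> x) *\<^sub>R v i"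
  have "?p \<in> span (v ` I)" by (intro span_sum span_scale span_base) auto
  then have d: "x - ?p \<in> span (v ` I)" using x by (rule span_diff[rotated])
  have "orthogonal (x - ?p) (x - ?p)"
  proof (rule orthogonal_to_span[OF d])
    fix y assume "y \<in> v ` I"
    then obtain j where j: "j \<in> I" "y = v j" by auto
    show "orthogonal (x - ?p) y"
      using inner_orthonormal_sum[OF I j(1), of "\<lambda>i. v i \<bullet> x"]
      by (simp add: orthogonal_def j(2) inner_diff_left inner_diff_right inner_commute[of _ "v j"])
  qed
  then show ?thesis by (simp add: orthogonal_self)
qed

lemma dim_span_orthonormal:
  assumes I: "finite I" "orthonormal_on I v"
  shows "dim (span (v ` I)) = card I"
proof -
  have inj: "inj_on v I"
  proof (rule inj_onI)
    fix i j assume "i \<in> I" "j \<in> I" "v i = v j"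
    then show "i = j" using I(2) by (metis orthonormal_on_def zero_neq_one)
  qed
  have "independent (v ` I)"
  proof (rule pairwise_orthogonal_independent)
    show "pairwise orthogonal (v ` I)"
      using I(2) by (auto simp: pairwise_def orthonormal_on_def orthogonal_def)
    show "0 \<notin> v ` I"
      using I(2) by (metis imageE inner_zero_left orthonormal_on_def zero_neq_one)
  qed
  then show ?thesis using card_image[OF inj] by (simp add: dim_eq_card_independent)
qed

lemma spectral_norm_singular_sum_le:
  assumes I: "finite I" "orthonormal_on I u" "orthonormal_on I v" and c: "c \<ge> 0" "\<And>i. i \<in> I \<Longrightarrow> \<bar>s i\<bar> \<le> c"
  shows "spectral_norm (singular_sum I u s v) \<le> c"
proof (rule spectral_norm_le)
  fix x
  have "(norm (singular_sum I u s v *v x))\<^sup>2 = (\<Sum>i\<in>I. (s i * (v i \<bullet> x))\<^sup>2)"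
    unfolding singular_sum_mult_vec by (rule norm_orthonormal_sum[OF I(1,2)])
  also have "\<dots> \<le> (\<Sum>i\<in>I. c\<^sup>2 * (v i \<bullet> x)\<^sup>2)"
  proof (rule sum_mono)
    fix i assume "i \<in> I"
    then have "\<bar>s i\<bar> ^ 2 \<le> c ^ 2" by (intro power_mono c) auto
    then show "(s i * (v i \<bullet> x))\<^sup>2 \<le> c\<^sup>2 * (v i \<bullet> x)\<^sup>2"
      unfolding power_mult_distrib by (intro mult_right_mono) auto
  qed
  also have "\<dots> = c\<^sup>2 * (\<Sum>i\<in>I. (v i \<bullet> x)\<^sup>2)" by (rule sum_distrib_left[symmetric])
  also have "\<dots> \<le> c\<^sup>2 * (norm x)\<^sup>2"
    by (intro mult_left_mono bessel_inequality I) auto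
  also have "\<dots> = (c * norm x)\<^sup>2" by (rule power_mult_distrib[symmetric])
  finally show "norm (singular_sum I u s v *v x) \<le> c * norm x"
    by (rule power2_le_imp_le) (rule mult_nonneg_nonneg[OF c(1) norm_ge_zero])
qed

lemma singular_sum_mult:
  assumes fin: "finite I" "finite J" and v: "orthonormal_on (I \<union> J) v"
  shows "singular_sum I u s v ** singular_sum J v t w = singular_sum (I \<inter> J) u (\<lambda>i. s i * t i) w"
proof -
  have "(singular_sum I u s v ** singular_sum J v t w) *v x = singular_sum (I \<inter> J) u (\<lambda>i. s i * t i) w *v x" for x
  proof -
    let ?y = "\<Sum>j\<in>J. (t j * (w j \<bullet> x)) *\<^sub>R v j"
    have in_y: "v i \<bullet> ?y = (if i \<in> J then t i * (w i \<bullet> x) else 0)" if "i \<in> I" for i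
    proof -
      have "v i \<bullet> ?y = (\<Sum>j\<in>J. if j = i then t j * (w j \<bullet> x) else 0)"
        using v that unfolding inner_sum_right by (intro sum.cong refl) (auto simp: orthonormal_on_def)
      then show ?thesis using fin(2) by simp
    qed
    have "(singular_sum I u s v ** singular_sum J v t w) *v x = (\<Sum>i\<in>I. (s i * (v i \<bullet> ?y)) *\<^sub>R u i)"
      by (simp add: matrix_vector_mul_assoc[symmetric] singular_sum_mult_vec)
    also have "\<dots> = (\<Sum>i\<in>I. if i \<in> J then (s i * t i * (w i \<bullet> x)) *\<^sub>R u i else 0)"
      by (intro sum.cong refl) (simp add: in_y)
    also have "\<dots> = singular_sum (I \<inter> J) u (\<lambda>i. s i * t i) w *v x"
      using fin(1) by (simp add: singular_sum_mult_vec sum.inter_restrict)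
    finally show ?thesis .
  qed
  then show ?thesis by (simp add: matrix_eq)
qed

lemma singular_sum_cong: "I = J \<Longrightarrow> (\<And>i. i \<in> J \<Longrightarrow> s i = t i) \<Longrightarrow> singular_sum I u s v = singular_sum J u t v"
  by (simp add: singular_sum_def)

lemma pinv_singular_sum:
  assumes I: "finite I" and u: "orthonormal_on I u" and v: "orthonormal_on I v" and s: "\<And>i. i \<in> I \<Longrightarrow> s i \<noteq> 0"
  shows "pinv (singular_sum I u s v) = singular_sum I v (\<lambda>i. 1 / s i) u"
proof (rule pinv_eqI)
  have AX: "singular_sum I u s v ** singular_sum I v (\<lambda>i. 1 / s i) u = singular_sum I u (\<lambda>_. 1) u"
    using v s by (subst singular_sum_mult[OF I I]) (auto intro: singular_sum_cong)
  have XA: "singular_sum I v (\<lambda>i. 1 / s i) u ** singular_sum I u s v = singular_sum I v (\<lambda>_. 1) v"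
    using u s by (subst singular_sum_mult[OF I I]) (auto intro: singular_sum_cong)
  show "singular_sum I u s v ** singular_sum I v (\<lambda>i. 1 / s i) u ** singular_sum I u s v = singular_sum I u s v"
    unfolding AX using u by (subst singular_sum_mult[OF I I]) auto
  show "singular_sum I v (\<lambda>i. 1 / s i) u ** singular_sum I u s v ** singular_sum I v (\<lambda>i. 1 / s i) u = singular_sum I v (\<lambda>i. 1 / s i) u"
    unfolding XA using v by (subst singular_sum_mult[OF I I]) auto
  show "transpose (singular_sum I u s v ** singular_sum I v (\<lambda>i. 1 / s i) u) = singular_sum I u s v ** singular_sum I v (\<lambda>i. 1 / s i) u"
    unfolding AX by (rule transpose_singular_sum)
  show "transpose (singular_sum I v (\<lambda>i. 1 / s i) u ** singular_sum I u s v) = singular_sum I v (\<lambda>i. 1 / s i) u ** singular_sum I u s v"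
    unfolding XA by (rule transpose_singular_sum)
qed

section \<open>Truncated singular value decomposition of a perturbed low-rank matrix\<close>

lemma is_svd_orthonormal:
  assumes "is_svd A u s v"
  shows "orthonormal_on {1..svd_dim A} u" "orthonormal_on {1..svd_dim A} v"
    "A = singular_sum {1..svd_dim A} u s v"
    "\<And>i. i \<in> {1..svd_dim A} \<Longrightarrow> 0 \<le> s i"
    "\<And>i j. i \<in> {1..svd_dim A} \<Longrightarrow> j \<in> {1..svd_dim A} \<Longrightarrow> i \<le> j \<Longrightarrow> s j \<le> s i"
  using assms by (auto simp: is_svd_def orthonormal_on_def svd_sum_eq_singular_sum)

lemma singular_sum_restrict_mult_vec:
  assumes "finite I" "J \<subseteq> I" "\<And>i. i \<in> I - J \<Longrightarrow> v i \<bullet> x = 0"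
  shows "singular_sum I u s v *v x = singular_sum J u s v *v x"
  unfolding singular_sum_mult_vec using assms by (intro sum.mono_neutral_right) auto

text \<open>
The lower half of the minimax principle. The range of \<open>L\<^sup>T\<close> has dimension \<open>r = CARD('r)\<close>, so it
contains a nonzero vector orthogonal to \<open>v\<^sub>1, \<dots>, v\<^bsub>r-1\<^esub>\<close>. On this vector \<open>W\<close> stretches by at most
\<open>s\<^sub>r\<close> and \<open>A\<close> by at least \<open>\<tau>\<close>.
\<close>

lemma svd_value_ge:
  fixes W A :: "real ^ 'l ^ 'k" and L :: "real ^ 'l ^ 'r"
  assumes svd: "is_svd W u s v" and r: "CARD('r) \<le> svd_dim W"
    and close: "spectral_norm (W - A) \<le> \<epsilon>"
    and Linj: "inj ((*v) (transpose L))"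
    and lower: "\<And>y. \<tau> * norm (transpose L *v y) \<le> norm (A *v (transpose L *v y))"
  shows "\<tau> - \<epsilon> \<le> s CARD('r)"
proof -
  define r where "r = CARD('r)"
  note W = is_svd_orthonormal[OF svd]
  have r1: "r \<ge> 1" "r \<le> svd_dim W" using r by (simp_all add: r_def Suc_le_eq)
  let ?S = "(\<lambda>i. L *v v i) ` {1..<r}"
  have "dim ?S \<le> card ?S" by (rule dim_le_card') simp
  also have "\<dots> \<le> r - 1" using card_image_le[of "{1..<r}" "\<lambda>i. L *v v i"] by simp
  also have "\<dots> < DIM(real ^ 'r)" using r1 by (simp add: r_def)
  finally obtain y where y: "y \<noteq> 0" "\<And>b. b \<in> span ?S \<Longrightarrow> orthogonal y b"
    by (rule orthogonal_to_subspace_exists) blast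
  define z where "z = transpose L *v y"
  have "z \<noteq> 0"
    using y(1) Linj unfolding z_def by (metis injD matrix_vector_mult_0_right)
  then have z: "norm z > 0" by simp
  have perp: "v i \<bullet> z = 0" if "i \<in> {1..<r}" for i
    using y(2)[OF span_base[of "L *v v i"]] that
    by (simp add: z_def inner_mult_transpose[symmetric] orthogonal_def inner_commute)
  have "W *v z = singular_sum {1..svd_dim W} u s v *v z" by (subst W(3)[symmetric]) simp
  also have "\<dots> = singular_sum {r..svd_dim W} u s v *v z"
    by (rule singular_sum_restrict_mult_vec) (use r1 perp in auto)
  finally have "norm (W *v z) = norm (singular_sum {r..svd_dim W} u s v *v z)" by simp
  also have "\<dots> \<le> s r * norm z"
  proof (rule norm_mult_vec_le_trans, rule spectral_norm_singular_sum_le)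
    show "orthonormal_on {r..svd_dim W} u" "orthonormal_on {r..svd_dim W} v"
      using W(1,2) r1 by (auto intro: orthonormal_on_subset)
    show "0 \<le> s r" using W(4)[of r] r1 by auto
    fix i assume "i \<in> {r..svd_dim W}"
    then show "\<bar>s i\<bar> \<le> s r" using W(4)[of i] W(5)[of r i] r1 by auto
  qed simp
  finally have "norm (W *v z) \<le> s r * norm z" .
  moreover have "norm ((W - A) *v z) \<le> \<epsilon> * norm z" by (rule norm_mult_vec_le_trans[OF close])
  moreover have "norm (A *v z) \<le> norm (W *v z) + norm ((W - A) *v z)"
    using norm_triangle_ineq4[of "W *v z" "(W - A) *v z"] by (simp add: matrix_vector_mult_diff_rdistrib)
  moreover have "\<tau> * norm z \<le> norm (A *v z)" using lower[of y] by (simp add: z_def)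
  ultimately have "\<tau> * norm z \<le> (s r + \<epsilon>) * norm z" by (simp add: distrib_right)
  then show ?thesis using z by (simp add: r_def)
qed

text \<open>
The upper half of the minimax principle. The span of \<open>v\<^sub>1, \<dots>, v\<^bsub>r+1\<^esub>\<close> has a nonzero vector in the
kernel of \<open>L\<close>, since \<open>L\<close> maps to a space of dimension \<open>r\<close>. On this vector \<open>W\<close> stretches by at least
\<open>s\<^bsub>r+1\<^esub>\<close> and agrees with \<open>W - A\<close>.
\<close>

lemma svd_next_value_le:
  fixes W A :: "real ^ 'l ^ 'k" and L :: "real ^ 'l ^ 'r"
  assumes svd: "is_svd W u s v" and r: "CARD('r) < svd_dim W"
    and close: "spectral_norm (W - A) \<le> \<epsilon>"
    and kernel: "\<And>z. L *v z = 0 \<Longrightarrow> A *v z = 0"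
  shows "s (Suc CARD('r)) \<le> \<epsilon>"
proof -
  define I where "I = {1..Suc CARD('r)}"
  note W = is_svd_orthonormal[OF svd]
  have I: "finite I" "I \<subseteq> {1..svd_dim W}" using r by (auto simp: I_def)
  have uI: "orthonormal_on I u" and vI: "orthonormal_on I v"
    using W(1,2) I(2) by (auto intro: orthonormal_on_subset)
  let ?V = "span (v ` I)"
  have "\<not> inj_on ((*v) L) ?V"
  proof
    assume "inj_on ((*v) L) ?V"
    then have "dim ((*v) L ` ?V) = dim ?V"
      by (intro dim_image_eq matrix_vector_mul_linear) (simp add: span_span)
    also have "\<dots> = Suc CARD('r)" using dim_span_orthonormal[OF I(1) vI] by (simp add: I_def)
    finally show False using dim_subset_UNIV[of "(*v) L ` ?V"] by simp
  qed
  then obtain z where z: "z \<in> ?V" "L *v z = 0" "z \<noteq> 0"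
    using linear_inj_on_iff_eq_0[OF matrix_vector_mul_linear[of L], of ?V] by (auto simp: subspace_span)
  have exp: "(\<Sum>i\<in>I. (v i \<bullet> z) *\<^sub>R v i) = z" by (rule orthonormal_expansion[OF I(1) vI z(1)])
  have nz: "(\<Sum>i\<in>I. (v i \<bullet> z)\<^sup>2) = (norm z)\<^sup>2"
    using norm_orthonormal_sum[OF I(1) vI, of "\<lambda>i. v i \<bullet> z"] by (simp add: exp)
  define c where "c = s (Suc CARD('r))"
  have c: "c \<ge> 0" using W(4)[of "Suc CARD('r)"] r by (simp add: c_def)
  have perp: "v i \<bullet> z = 0" if "i \<in> {1..svd_dim W} - I" for i
  proof -
    have "v i \<bullet> z = (\<Sum>j\<in>I. (v j \<bullet> z) * (v i \<bullet> v j))"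
      by (subst exp[symmetric]) (simp add: inner_sum_right)
    also have "\<dots> = 0"
    proof (intro sum.neutral ballI)
      fix j assume j: "j \<in> I"
      then have "i \<noteq> j" "j \<in> {1..svd_dim W}" "i \<in> {1..svd_dim W}" using that I(2) by auto
      then have "v i \<bullet> v j = 0" using W(2) unfolding orthonormal_on_def by metis
      then show "(v j \<bullet> z) * (v i \<bullet> v j) = 0" by simp
    qed
    finally show ?thesis .
  qed
  have "(c * norm z)\<^sup>2 = (\<Sum>i\<in>I. c\<^sup>2 * (v i \<bullet> z)\<^sup>2)"
    by (simp add: power_mult_distrib nz[symmetric] sum_distrib_left)
  also have "\<dots> \<le> (\<Sum>i\<in>I. (s i * (v i \<bullet> z))\<^sup>2)"
  proof (rule sum_mono)
    fix i assume i: "i \<in> I"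
    then have "c \<le> s i" using W(5)[of i "Suc CARD('r)"] r I(2) by (auto simp: c_def I_def)
    then show "c\<^sup>2 * (v i \<bullet> z)\<^sup>2 \<le> (s i * (v i \<bullet> z))\<^sup>2"
      unfolding power_mult_distrib using c by (intro mult_right_mono power_mono) auto
  qed
  also have "\<dots> = (norm (singular_sum I u s v *v z))\<^sup>2"
    unfolding singular_sum_mult_vec by (rule norm_orthonormal_sum[OF I(1) uI, symmetric])
  also have "singular_sum I u s v *v z = W *v z"
    using singular_sum_restrict_mult_vec[of "{1..svd_dim W}" I v z u s] I(2) perp W(3) by simp
  finally have "c * norm z \<le> norm (W *v z)" by (rule power2_le_imp_le) simp
  also have "W *v z = (W - A) *v z" using kernel[OF z(2)] by (simp add: matrix_vector_mult_diff_rdistrib)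
  also have "norm ((W - A) *v z) \<le> \<epsilon> * norm z" by (rule norm_mult_vec_le_trans[OF close])
  finally show ?thesis using z(3) by (simp add: c_def)
qed

text \<open>
For any singular value decomposition that produces \<open>B\<close>, the pseudo inverse of \<open>B\<close> inverts the first
\<open>r\<close> singular values, which are at least \<open>\<tau> - \<epsilon>\<close>, and \<open>W - W B\<^sup>+ W\<close> is the remaining part of the
decomposition, whose singular values are at most \<open>\<epsilon>\<close>.
\<close>

lemma truncation_pinv_properties:
  fixes W A :: "real ^ 'l ^ 'k" and L :: "real ^ 'l ^ 'r"
  assumes trunc: "is_truncation CARD('r) W B" and r: "CARD('r) < svd_dim W"
    and close: "spectral_norm (W - A) \<le> \<epsilon>" and \<epsilon>: "0 \<le> \<epsilon>" "\<epsilon> < \<tau>"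
    and Linj: "inj ((*v) (transpose L))"
    and lower: "\<And>y. \<tau> * norm (transpose L *v y) \<le> norm (A *v (transpose L *v y))"
    and kernel: "\<And>z. L *v z = 0 \<Longrightarrow> A *v z = 0"
  shows "pinv B ** W ** pinv B = pinv B"
    "spectral_norm (pinv B) \<le> 1 / (\<tau> - \<epsilon>)"
    "spectral_norm (W ** pinv B) \<le> 1"
    "spectral_norm (pinv B ** W) \<le> 1"
    "spectral_norm (W - W ** pinv B ** W) \<le> \<epsilon>"
proof -
  define r d where "r = CARD('r)" and "d = svd_dim W"
  obtain u s v where svd: "is_svd W u s v" and "B = svd_sum (min r d) u s v"
    using trunc by (auto simp: is_truncation_def r_def d_def)
  then have B: "B = singular_sum {1..r} u s v"
    using r by (simp add: svd_sum_eq_singular_sum r_def d_def min_def)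
  note W = is_svd_orthonormal[OF svd, folded d_def]
  have rd: "1 \<le> r" "r < d" using r by (simp_all add: r_def d_def Suc_le_eq)
  have u: "orthonormal_on {1..r} u" and v: "orthonormal_on {1..r} v"
    using W(1,2) rd by (auto intro: orthonormal_on_subset)
  have sr: "\<tau> - \<epsilon> \<le> s r"
    unfolding r_def by (rule svd_value_ge[OF svd _ close Linj lower]) (use r in simp)
  have si: "\<tau> - \<epsilon> \<le> s i" "s i > 0" if "i \<in> {1..r}" for i
    using W(5)[of i r] that rd sr \<epsilon> by auto
  have nz: "s i \<noteq> 0" if "i \<in> {1..r}" for i using si(2)[OF that] by simp
  have snext: "s i \<le> \<epsilon>" if "i \<in> {Suc r..d}" for i
    using svd_next_value_le[where L=L, OF svd r close, OF kernel] W(5)[of "Suc r" i] that rd by (auto simp: r_def)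
  have U: "pinv B = singular_sum {1..r} v (\<lambda>i. 1 / s i) u"
    unfolding B using u v nz by (intro pinv_singular_sum) auto
  have un: "{1..d} \<union> {1..r} = {1..d}" "{1..r} \<union> {1..d} = {1..d}" "{1..d} \<inter> {1..r} = {1..r}" "{1..r} \<inter> {1..d} = {1..r}"
    using rd by auto
  note mult = singular_sum_mult[OF finite_atLeastAtMost finite_atLeastAtMost]
  have WU: "W ** pinv B = singular_sum {1..r} u (\<lambda>_. 1) u"
  proof -
    have "W ** pinv B = singular_sum ({1..d} \<inter> {1..r}) u (\<lambda>i. s i * (1 / s i)) u"
      unfolding U by (subst W(3)) (rule mult, unfold un, rule W(2))
    also have "\<dots> = singular_sum {1..r} u (\<lambda>_. 1) u"
      unfolding un by (rule singular_sum_cong[OF refl]) (simp add: nz)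
    finally show ?thesis .
  qed
  have UW: "pinv B ** W = singular_sum {1..r} v (\<lambda>_. 1) v"
  proof -
    have "pinv B ** W = singular_sum ({1..r} \<inter> {1..d}) v (\<lambda>i. (1 / s i) * s i) v"
      unfolding U by (subst W(3)) (rule mult, unfold un, rule W(1))
    also have "\<dots> = singular_sum {1..r} v (\<lambda>_. 1) v"
      unfolding un by (rule singular_sum_cong[OF refl]) (simp add: nz)
    finally show ?thesis .
  qed
  show "pinv B ** W ** pinv B = pinv B"
    unfolding UW unfolding U by (subst mult) (use v in simp_all)
  show "spectral_norm (pinv B) \<le> 1 / (\<tau> - \<epsilon>)"
    unfolding U
  proof (rule spectral_norm_singular_sum_le[OF _ v u])
    fix i assume i: "i \<in> {1..r}"
    then show "\<bar>1 / s i\<bar> \<le> 1 / (\<tau> - \<epsilon>)" using si[OF i] \<epsilon> by (simp add: frac_le)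
  qed (use \<epsilon> in auto)
  show "spectral_norm (W ** pinv B) \<le> 1" unfolding WU by (rule spectral_norm_singular_sum_le[OF _ u u]) auto
  show "spectral_norm (pinv B ** W) \<le> 1" unfolding UW by (rule spectral_norm_singular_sum_le[OF _ v v]) auto
  have "W ** pinv B ** W = singular_sum {1..r} u s v"
  proof -
    have "W ** pinv B ** W = singular_sum ({1..r} \<inter> {1..d}) u (\<lambda>i. 1 * s i) v"
      unfolding WU by (subst W(3)) (rule mult, unfold un, rule W(1))
    then show ?thesis unfolding un by simp
  qed
  moreover have "W = singular_sum {1..r} u s v + singular_sum {Suc r..d} u s v"
  proof -
    have "{1..d} = {1..r} \<union> {Suc r..d}" using rd by auto
    moreover have "singular_sum ({1..r} \<union> {Suc r..d}) u s v = singular_sum {1..r} u s v + singular_sum {Suc r..d} u s v"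
      unfolding singular_sum_def by (rule sum.union_disjoint) auto
    ultimately show ?thesis using W(3) by (simp only:)
  qed
  ultimately have "W - W ** pinv B ** W = singular_sum {Suc r..d} u s v"
    by (simp only: add_diff_cancel_left')
  also have "spectral_norm \<dots> \<le> \<epsilon>"
  proof (rule spectral_norm_singular_sum_le)
    show "orthonormal_on {Suc r..d} u" "orthonormal_on {Suc r..d} v"
      using W(1,2) by (auto intro: orthonormal_on_subset)
    fix i assume "i \<in> {Suc r..d}"
    then show "\<bar>s i\<bar> \<le> \<epsilon>" using snext[of i] W(4)[of i] by auto
  qed (use \<epsilon> in auto)
  finally show "spectral_norm (W - W ** pinv B ** W) \<le> \<epsilon>" .
qed

section \<open>Error of the CUR approximation\<close>

text \<open>
Expanding \<open>(L A + E\<^sub>C) U (A K + E\<^sub>R)\<close>, the error is \<open>E + L (A - A U A) K\<close> minus the cross terms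
\<open>L A U E\<^sub>R\<close>, \<open>E\<^sub>C U A K\<close> and \<open>E\<^sub>C U E\<^sub>R\<close>. Since \<open>A = W - F\<close> and \<open>U W U = U\<close>, the matrix
\<open>A - A U A\<close> is \<open>(W - W U W) - F + F U W + W U F - F U F\<close>. The first four terms have norm at most \<open>\<epsilon>\<close>
and the last one at most \<open>\<epsilon> / 2\<close>, which gives the factor \<open>9/2\<close> of \<open>v\<^sup>2\<close>. Similarly \<open>A U\<close> and \<open>U A\<close>
have norm at most \<open>3/2\<close>.
\<close>

lemma cur_error_bound:
  fixes A F :: "real ^ 'l ^ 'k" and U :: "real ^ 'k ^ 'l" and E :: "real ^ 'n ^ 'm"
    and L :: "real ^ 'k ^ 'm" and K :: "real ^ 'n ^ 'l" and EC :: "real ^ 'l ^ 'm" and ER :: "real ^ 'n ^ 'k"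
  assumes U: "U ** W ** U = U" "spectral_norm (W ** U) \<le> 1" "spectral_norm (U ** W) \<le> 1"
      "spectral_norm (W - W ** U ** W) \<le> \<epsilon>" "spectral_norm U * \<epsilon> \<le> 1 / 2"
    and W: "W = A + F"
    and pert: "spectral_norm F \<le> \<epsilon>" "spectral_norm E \<le> \<epsilon>" "spectral_norm EC \<le> \<epsilon>" "spectral_norm ER \<le> \<epsilon>"
    and L: "spectral_norm L \<le> v" and K: "spectral_norm K \<le> v"
  shows "spectral_norm ((L ** A ** K + E) - (L ** A + EC) ** U ** (A ** K + ER)) \<le> (9 / 2 * v\<^sup>2 + 3 * v + 3 / 2) * \<epsilon>"
proof (rule spectral_norm_le)
  fix x
  define k where "k = K *v x"
  have v: "v \<ge> 0" using order_trans[OF spectral_norm_nonneg L] .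
  have \<epsilon>: "\<epsilon> \<ge> 0" using order_trans[OF spectral_norm_nonneg pert(1)] .
  have bnd: "norm (X *v y) \<le> a * b" if "spectral_norm X \<le> a" "norm y \<le> b" for X :: "real ^ 'a ^ 'b" and y a b
  proof -
    have "norm (X *v y) \<le> a * norm y" by (rule norm_mult_vec_le_trans[OF that(1)])
    also have "\<dots> \<le> a * b" using that(2) order_trans[OF spectral_norm_nonneg that(1)] by (rule mult_left_mono)
    finally show ?thesis .
  qed
  have bnd': "norm (X *v y) \<le> a * norm y" if "spectral_norm X \<le> a" for X :: "real ^ 'a ^ 'b" and y a
    by (rule norm_mult_vec_le_trans[OF that])
  have k: "norm k \<le> v * norm x" unfolding k_def by (rule bnd'[OF K])
  have WU: "norm (W *v (U *v y)) \<le> norm y" for y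
    using bnd'[OF U(2), of y] by (simp add: matrix_vector_mul_assoc)
  have UW: "norm (U *v (W *v y)) \<le> norm y" for y
    using bnd'[OF U(3), of y] by (simp add: matrix_vector_mul_assoc)
  have tail: "norm (W *v y - W *v (U *v (W *v y))) \<le> \<epsilon> * norm y" for y
    using bnd'[OF U(4), of y] by (simp add: matrix_vector_mul_assoc matrix_mul_assoc matrix_vector_mult_diff_rdistrib)
  have UE: "norm (U *v y) * \<epsilon> \<le> norm y / 2" for y
  proof -
    have "norm (U *v y) * \<epsilon> \<le> (spectral_norm U * norm y) * \<epsilon>"
      using norm_mult_vec_le[of U y] \<epsilon> by (rule mult_right_mono)
    also have "\<dots> = (spectral_norm U * \<epsilon>) * norm y" by simp
    also have "\<dots> \<le> 1 / 2 * norm y" using U(5) by (rule mult_right_mono) simp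
    finally show ?thesis by simp
  qed
  have UWU: "U *v (W *v (U *v y)) = U *v y" for y
    using U(1) by (simp add: matrix_vector_mul_assoc matrix_mul_assoc)
  have Ay: "A *v y = W *v y - F *v y" for y by (simp add: W matrix_vector_mult_add_rdistrib)
  have FU: "norm (F *v (U *v y)) \<le> norm y / 2" for y
    using bnd'[OF pert(1), of "U *v y"] UE[of y] by (simp add: mult.commute)
  have UF: "norm (U *v (F *v y)) \<le> norm y / 2" for y
  proof -
    have "norm (U *v (F *v y)) \<le> spectral_norm U * (\<epsilon> * norm y)"
      by (intro bnd order_refl bnd' pert)
    also have "\<dots> = (spectral_norm U * \<epsilon>) * norm y" by simp
    also have "\<dots> \<le> 1 / 2 * norm y" using U(5) by (rule mult_right_mono) simp
    finally show ?thesis by simp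
  qed
  have AU: "norm (A *v (U *v y)) \<le> 3 / 2 * norm y" for y
    using norm_triangle_ineq4[of "W *v (U *v y)" "F *v (U *v y)"] WU[of y] FU[of y] by (simp add: Ay)
  have UA: "norm (U *v (A *v y)) \<le> 3 / 2 * norm y" for y
    using norm_triangle_ineq4[of "U *v (W *v y)" "U *v (F *v y)"] UW[of y] UF[of y]
    by (simp add: Ay matrix_vector_mult_diff_distrib)
  have core: "norm (A *v y - A *v (U *v (A *v y))) \<le> 9 / 2 * \<epsilon> * norm y" for y
  proof -
    let ?a = "W *v y - W *v (U *v (W *v y))" and ?b = "F *v y" and ?c = "F *v (U *v (W *v y))"
      and ?d = "W *v (U *v (F *v y))" and ?e = "F *v (U *v (F *v y))"
    have eq: "A *v y - A *v (U *v (A *v y)) = ?a - ?b + ?c + ?d - ?e"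
      by (simp add: Ay matrix_vector_mult_diff_distrib)
    have "norm (?a - ?b + ?c + ?d - ?e) \<le> norm ?a + norm ?b + norm ?c + norm ?d + norm ?e"
      using norm_triangle_ineq4[of "?a - ?b + ?c + ?d" ?e] norm_triangle_ineq[of "?a - ?b + ?c" ?d]
        norm_triangle_ineq[of "?a - ?b" ?c] norm_triangle_ineq4[of ?a ?b] by linarith
    also have "\<dots> \<le> \<epsilon> * norm y + \<epsilon> * norm y + \<epsilon> * norm y + \<epsilon> * norm y + \<epsilon> * norm y / 2"
    proof (intro add_mono)
      show "norm ?b \<le> \<epsilon> * norm y" by (rule bnd'[OF pert(1)])
      show "norm ?c \<le> \<epsilon> * norm y" by (rule bnd[OF pert(1) UW])
      show "norm ?d \<le> \<epsilon> * norm y" by (rule order_trans[OF WU bnd'[OF pert(1)]])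
      show "norm ?e \<le> \<epsilon> * norm y / 2"
        using FU[of "F *v y"] bnd'[OF pert(1), of y] by linarith
    qed (rule tail)
    also have "\<dots> = 9 / 2 * \<epsilon> * norm y" by simp
    finally show ?thesis unfolding eq .
  qed
  let ?e1 = "E *v x" and ?e2 = "L *v (A *v k - A *v (U *v (A *v k)))"
    and ?e3 = "L *v (A *v (U *v (ER *v x)))" and ?e4 = "EC *v (U *v (A *v k))" and ?e5 = "EC *v (U *v (ER *v x))"
  have eq: "((L ** A ** K + E) - (L ** A + EC) ** U ** (A ** K + ER)) *v x = ?e1 + ?e2 - ?e3 - ?e4 - ?e5"
    by (simp add: k_def matrix_vector_mult_diff_rdistrib matrix_vector_mult_add_rdistrib matrix_vector_right_distrib
        matrix_vector_mult_diff_distrib matrix_vector_mul_assoc[symmetric])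
  have e1: "norm ?e1 \<le> \<epsilon> * norm x" by (rule bnd'[OF pert(2)])
  have "norm ?e2 \<le> v * (9 / 2 * \<epsilon> * (v * norm x))"
    using \<epsilon> by (intro bnd[OF L] order_trans[OF core] mult_left_mono k) auto
  then have e2: "norm ?e2 \<le> 9 / 2 * v\<^sup>2 * \<epsilon> * norm x" by (simp add: power2_eq_square mult_ac)
  have "norm ?e3 \<le> v * (3 / 2 * (\<epsilon> * norm x))"
    by (intro bnd[OF L] order_trans[OF AU] mult_left_mono bnd'[OF pert(4)]) auto
  then have e3: "norm ?e3 \<le> 3 / 2 * v * \<epsilon> * norm x" by (simp add: mult_ac)
  have "norm ?e4 \<le> \<epsilon> * (3 / 2 * (v * norm x))"
    by (intro bnd[OF pert(3)] order_trans[OF UA] mult_left_mono k) auto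
  then have e4: "norm ?e4 \<le> 3 / 2 * v * \<epsilon> * norm x" by (simp add: mult_ac)
  have "norm ?e5 \<le> \<epsilon> * norm (U *v (ER *v x))" by (rule bnd'[OF pert(3)])
  also have "\<dots> \<le> norm (ER *v x) / 2" using UE[of "ER *v x"] by (simp add: mult.commute)
  also have "\<dots> \<le> \<epsilon> * norm x / 2" using bnd'[OF pert(4), of x] by simp
  finally have e5: "norm ?e5 \<le> 1 / 2 * \<epsilon> * norm x" by simp
  have "norm (?e1 + ?e2 - ?e3 - ?e4 - ?e5) \<le> norm ?e1 + norm ?e2 + norm ?e3 + norm ?e4 + norm ?e5"
    using norm_triangle_ineq4[of "?e1 + ?e2 - ?e3 - ?e4" ?e5] norm_triangle_ineq4[of "?e1 + ?e2 - ?e3" ?e4]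
      norm_triangle_ineq4[of "?e1 + ?e2" ?e3] norm_triangle_ineq[of ?e1 ?e2] by linarith
  also have "\<dots> \<le> \<epsilon> * norm x + 9 / 2 * v\<^sup>2 * \<epsilon> * norm x + 3 / 2 * v * \<epsilon> * norm x + 3 / 2 * v * \<epsilon> * norm x + 1 / 2 * \<epsilon> * norm x"
    by (intro add_mono e1 e2 e3 e4 e5)
  also have "\<dots> = (9 / 2 * v\<^sup>2 + 3 * v + 3 / 2) * \<epsilon> * norm x" by (simp add: algebra_simps)
  finally show "norm (((L ** A ** K + E) - (L ** A + EC) ** U ** (A ** K + ER)) *v x) \<le> (9 / 2 * v\<^sup>2 + 3 * v + 3 / 2) * \<epsilon> * norm x"
    unfolding eq .
qed

section \<open>Extreme singular values of an invertible matrix\<close>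

lemma quadratic_bound_imp_zero:
  fixes a b c :: real
  assumes "\<And>t. 2 * t * a + t\<^sup>2 * b \<le> t\<^sup>2 * c"
  shows "a = 0"
proof (rule ccontr)
  assume a: "a \<noteq> 0"
  define D where "D = \<bar>c - b\<bar> + 1"
  have D: "D > 0" "c - b \<le> D" by (auto simp: D_def)
  \<comment> \<open>near 0 the linear term dominates; \<open>t = a / D\<close> is close enough to 0\<close>
  have "2 * (a / D) * a \<le> (a / D)\<^sup>2 * (c - b)"
    using assms[of "a / D"] by (simp add: algebra_simps)
  also have "\<dots> \<le> (a / D)\<^sup>2 * D" by (intro mult_left_mono D) auto
  finally have "2 * (a\<^sup>2 / D) \<le> a\<^sup>2 / D" using D(1) by (simp add: power2_eq_square)
  moreover have "a\<^sup>2 / D > 0" using a D(1) by simp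
  ultimately show False by simp
qed

text \<open>
Construction of right singular vectors: each maximises \<open>|A x|\<close> among the unit vectors orthogonal to
the preceding ones.
\<close>

lemma greedy_orthonormal_maximisers:
  fixes A :: "real ^ 'r ^ 'm"
  assumes "j \<le> CARD('r)"
  shows "\<exists>v. orthonormal_on {1..j} v \<and>
    (\<forall>i\<in>{1..j}. \<forall>x. (\<forall>h\<in>{1..<i}. v h \<bullet> x = 0) \<longrightarrow> norm (A *v x) \<le> norm (A *v v i) * norm x)"
  using assms
proof (induction j)
  case 0
  show ?case by (auto simp: orthonormal_on_def)
next
  case (Suc j)
  then obtain v where v: "orthonormal_on {1..j} v"
    and max: "\<And>i x. i \<in> {1..j} \<Longrightarrow> (\<forall>h\<in>{1..<i}. v h \<bullet> x = 0) \<Longrightarrow> norm (A *v x) \<le> norm (A *v v i) * norm x"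
    by (auto dest: Suc_leD)
  define V where "V = {x. norm x = 1 \<and> (\<forall>h\<in>{1..j}. v h \<bullet> x = 0)}"
  have "dim (span (v ` {1..j})) < DIM(real ^ 'r)"
    using dim_span_orthonormal[OF _ v] Suc.prems by simp
  then have "dim (v ` {1..j}) < DIM(real ^ 'r)" by (simp only: dim_span)
  then obtain y where y: "y \<noteq> 0" "\<And>b. b \<in> span (v ` {1..j}) \<Longrightarrow> orthogonal y b"
    by (rule orthogonal_to_subspace_exists) blast
  have "v h \<bullet> y = 0" if "h \<in> {1..j}" for h
    using y(2)[OF span_base[of "v h"]] that by (auto simp: orthogonal_def inner_commute)
  then have "y /\<^sub>R norm y \<in> V" using y(1) by (auto simp: V_def)
  then have "V \<noteq> {}" by auto
  moreover have "compact V"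
  proof -
    have "V = sphere 0 1 \<inter> (\<Inter>h\<in>{1..j}. {x. v h \<bullet> x = 0})" by (auto simp: V_def)
    then show ?thesis by (simp add: compact_Int_closed closed_INT closed_hyperplane)
  qed
  moreover have "continuous_on V (\<lambda>x. norm (A *v x))"
    by (intro continuous_intros linear_continuous_on matrix_vector_mul_bounded_linear)
  ultimately obtain w where w: "w \<in> V" and wmax: "\<And>x. x \<in> V \<Longrightarrow> norm (A *v x) \<le> norm (A *v w)"
    using continuous_attains_sup[of V "\<lambda>x. norm (A *v x)"] by blast
  define v' where "v' = v(Suc j := w)"
  have vv: "v' i = v i" if "i \<le> j" for i using that by (simp add: v'_def)
  have "orthonormal_on {1..Suc j} v'"
    using v w by (auto simp: orthonormal_on_def v'_def V_def norm_eq_1 inner_commute le_Suc_eq)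
  moreover have "norm (A *v x) \<le> norm (A *v v' i) * norm x"
    if i: "i \<in> {1..Suc j}" and x: "\<forall>h\<in>{1..<i}. v' h \<bullet> x = 0" for i x
  proof (cases "i = Suc j")
    case False
    then show ?thesis using max[of i x] i x vv by auto
  next
    case True
    show ?thesis
    proof (cases "x = 0")
      case False
      have "x /\<^sub>R norm x \<in> V" using x True vv False by (auto simp: V_def)
      from wmax[OF this] show ?thesis
        using False True by (simp add: v'_def matrix_vector_mult_scaleR field_simps)
    qed simp
  qed
  ultimately show ?case by blast
qed

text \<open>
The images of greedily chosen maximisers are orthogonal: if \<open>i < j\<close>, then \<open>v\<^sub>i + t v\<^sub>j\<close> competed with
\<open>v\<^sub>i\<close>, so \<open>|A (v\<^sub>i + t v\<^sub>j)|\<^sup>2 \<le> |A v\<^sub>i|\<^sup>2 (1 + t\<^sup>2)\<close> for all \<open>t\<close>, which forces the linear term in \<open>t\<close> to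
vanish. As \<open>A\<close> is injective, all images are nonzero and can be normalised to left singular vectors.
\<close>

lemma svd_of_invertible:
  fixes A :: "real ^ 'r ^ 'r"
  assumes "rank A = CARD('r)"
  shows "\<exists>u s v. is_svd A u s v \<and> 0 < s CARD('r)"
proof -
  define r where "r = CARD('r)"
  have inj: "inj ((*v) A)" using assms full_rank_injective by blast
  obtain v where v: "orthonormal_on {1..r} v"
    and max: "\<And>i x. i \<in> {1..r} \<Longrightarrow> (\<forall>h\<in>{1..<i}. v h \<bullet> x = 0) \<Longrightarrow> norm (A *v x) \<le> norm (A *v v i) * norm x"
    using greedy_orthonormal_maximisers[of r A] by (auto simp: r_def)
  have vin: "v i \<bullet> v j = (if i = j then 1 else 0)" if "i \<in> {1..r}" "j \<in> {1..r}" for i j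
    using v that by (simp add: orthonormal_on_def)
  have vnorm: "norm (v i) = 1" if "i \<in> {1..r}" for i using vin[OF that that] by (simp add: norm_eq_1)
  define s where "s i = norm (A *v v i)" for i
  define u where "u i = (A *v v i) /\<^sub>R s i" for i
  have spos: "s i > 0" if "i \<in> {1..r}" for i
  proof -
    have "v i \<noteq> 0" using vnorm[OF that] by auto
    then show ?thesis using inj by (metis injD matrix_vector_mult_0_right s_def zero_less_norm_iff)
  qed
  have orth: "(A *v v i) \<bullet> (A *v v j) = 0" if ij: "i \<in> {1..r}" "j \<in> {1..r}" "i < j" for i j
  proof (rule quadratic_bound_imp_zero)
    fix t :: real
    have "norm (A *v (v i + t *\<^sub>R v j)) \<le> norm (A *v v i) * norm (v i + t *\<^sub>R v j)"
      using ij by (intro max) (auto simp: inner_add_right vin)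
    then have "(norm (A *v (v i + t *\<^sub>R v j)))\<^sup>2 \<le> (norm (A *v v i) * norm (v i + t *\<^sub>R v j))\<^sup>2"
      by (intro power_mono) auto
    moreover have "(norm (A *v (v i + t *\<^sub>R v j)))\<^sup>2 = (s i)\<^sup>2 + 2 * t * ((A *v v i) \<bullet> (A *v v j)) + t\<^sup>2 * (s j)\<^sup>2"
      unfolding power2_norm_eq_inner s_def matrix_vector_right_distrib matrix_vector_mult_scaleR
      by (simp add: inner_add_left inner_add_right inner_commute power2_eq_square[of t] algebra_simps)
    moreover have "(norm (v i + t *\<^sub>R v j))\<^sup>2 = 1 + t\<^sup>2"
    proof -
      have "v i \<bullet> v i = 1" "v j \<bullet> v j = 1" "v i \<bullet> v j = 0" "v j \<bullet> v i = 0"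
        using vin[OF ij(1,1)] vin[OF ij(2,2)] vin[OF ij(1,2)] vin[OF ij(2,1)] ij(3) by auto
      then show ?thesis
        unfolding power2_norm_eq_inner by (simp add: inner_add_left inner_add_right power2_eq_square)
    qed
    ultimately show "2 * t * ((A *v v i) \<bullet> (A *v v j)) + t\<^sup>2 * (s j)\<^sup>2 \<le> t\<^sup>2 * (s i)\<^sup>2"
      by (simp add: power_mult_distrib s_def[symmetric] algebra_simps)
  qed
  have u: "orthonormal_on {1..r} u"
    unfolding orthonormal_on_def
  proof (intro ballI)
    fix i j assume ij: "i \<in> {1..r}" "j \<in> {1..r}"
    consider "i = j" | "i < j" | "j < i" by linarith
    then show "u i \<bullet> u j = (if i = j then 1 else 0)"
    proof cases
      case 1
      have "norm (u i) = 1" using spos[OF ij(1)] by (simp add: u_def s_def)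
      then show ?thesis using 1 by (simp add: norm_eq_1)
    qed (use orth[of i j] orth[of j i] ij in \<open>auto simp: u_def inner_commute\<close>)
  qed
  have mono: "s j \<le> s i" if "i \<in> {1..r}" "j \<in> {1..r}" "i \<le> j" for i j
    using max[of i "v j"] that vnorm[of j] by (auto simp: s_def vin)
  have span: "span (v ` {1..r}) = UNIV"
    using dim_span_orthonormal[OF _ v] by (simp add: r_def dim_eq_full[symmetric])
  have "singular_sum {1..r} u s v *v x = A *v x" for x
  proof -
    have "singular_sum {1..r} u s v *v x = (\<Sum>i\<in>{1..r}. A *v ((v i \<bullet> x) *\<^sub>R v i))"
      unfolding singular_sum_mult_vec
    proof (rule sum.cong[OF refl])
      fix i assume "i \<in> {1..r}"
      then have "s i \<noteq> 0" using spos by force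
      then show "(s i * (v i \<bullet> x)) *\<^sub>R u i = A *v ((v i \<bullet> x) *\<^sub>R v i)"
        by (simp add: u_def matrix_vector_mult_scaleR)
    qed
    also have "\<dots> = A *v (\<Sum>i\<in>{1..r}. (v i \<bullet> x) *\<^sub>R v i)"
      by (rule linear_sum[OF matrix_vector_mul_linear, symmetric])
    also have "(\<Sum>i\<in>{1..r}. (v i \<bullet> x) *\<^sub>R v i) = x"
      by (rule orthonormal_expansion[OF _ v]) (simp, unfold span, rule UNIV_I)
    finally show ?thesis .
  qed
  then have "A = singular_sum {1..r} u s v" by (simp add: matrix_eq)
  moreover have "svd_dim A = r" by (simp add: svd_dim_def r_def)
  ultimately have "is_svd A u s v"
    unfolding is_svd_def svd_sum_eq_singular_sum
    using u v mono spos by (auto simp: orthonormal_on_def intro: less_imp_le)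
  moreover have "0 < s r" using spos[of r] by (simp add: r_def Suc_le_eq)
  ultimately show ?thesis unfolding r_def by blast
qed

lemma svd_square_extreme_values:
  fixes A :: "real ^ 'r ^ 'r"
  assumes svd: "is_svd A u s v"
  shows "norm (A *v x) \<le> s 1 * norm x" "s CARD('r) * norm x \<le> norm (A *v x)"
    "\<exists>y. norm y = 1 \<and> norm (A *v y) = s 1" "\<exists>y. norm y = 1 \<and> norm (A *v y) = s CARD('r)"
proof -
  define I where "I = {1..CARD('r)}"
  have d: "svd_dim A = CARD('r)" by (simp add: svd_dim_def)
  note A = is_svd_orthonormal[OF svd, unfolded d, folded I_def]
  have I: "finite I" "1 \<in> I" "CARD('r) \<in> I" by (auto simp: I_def Suc_le_eq)
  have span: "span (v ` I) = UNIV"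
    using dim_span_orthonormal[OF I(1) A(2)] by (simp add: I_def dim_eq_full[symmetric])
  have nA: "(norm (A *v x))\<^sup>2 = (\<Sum>i\<in>I. (s i * (v i \<bullet> x))\<^sup>2)" for x
    by (subst A(3)) (simp only: singular_sum_mult_vec norm_orthonormal_sum[OF I(1) A(1)])
  have nx: "(norm x)\<^sup>2 = (\<Sum>i\<in>I. (v i \<bullet> x)\<^sup>2)" for x
    using norm_orthonormal_sum[OF I(1) A(2), of "\<lambda>i. v i \<bullet> x"] orthonormal_expansion[OF I(1) A(2), of x] span by simp
  have s: "0 \<le> s i" "s i \<le> s 1" "s CARD('r) \<le> s i" if "i \<in> I" for i
    using A(4)[OF that] A(5)[OF I(2) that] A(5)[OF that I(3)] that by (auto simp: I_def)
  have "(norm (A *v x))\<^sup>2 \<le> (\<Sum>i\<in>I. (s 1)\<^sup>2 * (v i \<bullet> x)\<^sup>2)"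
    unfolding nA power_mult_distrib by (intro sum_mono mult_right_mono power_mono s) auto
  then have "(norm (A *v x))\<^sup>2 \<le> (s 1 * norm x)\<^sup>2"
    by (simp add: power_mult_distrib nx sum_distrib_left)
  then show "norm (A *v x) \<le> s 1 * norm x"
    by (rule power2_le_imp_le) (use s(1)[OF I(2)] in simp)
  have "(\<Sum>i\<in>I. (s CARD('r))\<^sup>2 * (v i \<bullet> x)\<^sup>2) \<le> (norm (A *v x))\<^sup>2"
    unfolding nA power_mult_distrib by (intro sum_mono mult_right_mono power_mono s I) auto
  then have "(s CARD('r) * norm x)\<^sup>2 \<le> (norm (A *v x))\<^sup>2"
    by (simp add: power_mult_distrib nx sum_distrib_left)
  then show "s CARD('r) * norm x \<le> norm (A *v x)"
    by (rule power2_le_imp_le) simp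
  have att: "norm (v j) = 1 \<and> norm (A *v v j) = s j" if j: "j \<in> I" for j
  proof -
    have "A *v v j = (\<Sum>i\<in>I. if i = j then s i *\<^sub>R u i else 0)"
      by (subst A(3), unfold singular_sum_mult_vec, intro sum.cong refl)
        (use A(2) j in \<open>auto simp: orthonormal_on_def\<close>)
    then have "A *v v j = s j *\<^sub>R u j" using I(1) j by simp
    moreover have "norm (u j) = 1" "norm (v j) = 1" using A(1,2) j by (auto simp: orthonormal_on_def norm_eq_1)
    ultimately show ?thesis using s(1)[OF j] by simp
  qed
  then show "\<exists>y. norm y = 1 \<and> norm (A *v y) = s 1" "\<exists>y. norm y = 1 \<and> norm (A *v y) = s CARD('r)"
    using I by blast+
qed

text \<open>
The largest and the least singular value are the extreme values of \<open>|A x|\<close> on the unit sphere, so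
they do not depend on the chosen decomposition.
\<close>

lemma singular_value_extreme_eq:
  fixes A :: "real ^ 'r ^ 'r"
  assumes svd: "is_svd A u s v"
  shows "singular_value 1 A = s 1" "singular_value CARD('r) A = s CARD('r)"
proof -
  have eq: "s' 1 = s 1 \<and> s' CARD('r) = s CARD('r)" if "is_svd A u' s' v'" for u' s' v'
  proof -
    have le: "s1 1 \<le> s2 1 \<and> s2 CARD('r) \<le> s1 CARD('r)"
      if "is_svd A u1 s1 v1" "is_svd A u2 s2 v2" for u1 s1 v1 u2 s2 v2
      using svd_square_extreme_values(3,4)[OF that(1)] svd_square_extreme_values(1,2)[OF that(2)]
      by (metis mult.right_neutral)
    show ?thesis using le[OF that svd] le[OF svd that] by linarith
  qed
  show "singular_value 1 A = s 1" "singular_value CARD('r) A = s CARD('r)"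
    unfolding singular_value_def by (rule the_equality; use svd eq in blast)+
qed

lemma singular_value_bounds_of_invertible:
  fixes A :: "real ^ 'r ^ 'r"
  assumes "rank A = CARD('r)"
  shows "0 < singular_value CARD('r) A" "norm (A *v x) \<le> singular_value 1 A * norm x"
    "singular_value CARD('r) A * norm x \<le> norm (A *v x)"
proof -
  obtain u s v where svd: "is_svd A u s v" "0 < s CARD('r)" using svd_of_invertible[OF assms] by blast
  show "0 < singular_value CARD('r) A" "norm (A *v x) \<le> singular_value 1 A * norm x"
    "singular_value CARD('r) A * norm x \<le> norm (A *v x)"
    unfolding singular_value_extreme_eq[OF svd(1)] using svd svd_square_extreme_values[OF svd(1)] by auto
qed

section \<open>CUR approximation of a perturbed Gaussian product\<close>

text \<open>
With left inverses \<open>Y\<^sub>1\<close> of \<open>G\<^sub>1\<close> and \<open>X\<close> of \<open>S\<close> and a right inverse \<open>X\<^sub>2\<close> of \<open>G\<^sub>2\<close>, the matrix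
\<open>Z = X\<^sub>2 X Y\<^sub>1\<close> satisfies \<open>A Z A = A\<close> and has norm at most \<open>1 / \<tau>\<close>. Multiplying the selected columns
and rows of \<open>H\<^sub>1 S H\<^sub>2\<close> by \<open>Z\<close> gives the factors \<open>L\<close> and \<open>K\<close> of \<open>cur_error_bound\<close>.
\<close>

lemma cur_error_bound_of_factorization:
  fixes H1 :: "real ^ 'r ^ 'm" and H2 :: "real ^ 'n ^ 'r" and S :: "real ^ 'r ^ 'r"
    and p :: "'k::finite \<Rightarrow> 'm" and q :: "'l::finite \<Rightarrow> 'n" and E :: "real ^ 'n ^ 'm"
  defines "M \<equiv> H1 ** S ** H2 + E"
  assumes p: "inj p" and q: "inj q" and dims: "CARD('r) < CARD('k)" "CARD('r) < CARD('l)"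
    and S: "0 < \<sigma>" "\<And>x. norm (S *v x) \<le> \<sigma>1 * norm x" "\<And>x. \<sigma> * norm x \<le> norm (S *v x)"
    and s1: "0 < s1" "\<And>y. s1 * norm y \<le> norm (row_submatrix p H1 *v y)"
    and s2: "0 < s2" "\<And>y. s2 * norm y \<le> norm (row_submatrix q (transpose H2) *v y)"
    and b1: "spectral_norm H1 * spectral_norm (row_submatrix q (transpose H2)) \<le> b"
    and b2: "spectral_norm (row_submatrix p H1) * spectral_norm (transpose H2) \<le> b"
    and E: "0 < \<epsilon>" "spectral_norm E \<le> \<epsilon>" "3 * \<epsilon> \<le> s1 * s2 * \<sigma>"
    and trunc: "is_truncation CARD('r) (submatrix p q M) B"
    and v: "v = b * \<sigma>1 / (s1 * s2 * \<sigma>)"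
  shows "spectral_norm (M - col_submatrix q M ** pinv B ** row_submatrix p M) \<le> (9 / 2 * v\<^sup>2 + 3 * v + 3 / 2) * \<epsilon>"
proof -
  define \<tau> where "\<tau> = s1 * s2 * \<sigma>"
  define G1 where "G1 = row_submatrix p H1"
  define G2 where "G2 = col_submatrix q H2"
  define EC where "EC = col_submatrix q E"
  define ER where "ER = row_submatrix p E"
  define F where "F = submatrix p q E"
  define A where "A = G1 ** S ** G2"
  have \<tau>: "\<tau> > 0" "3 * \<epsilon> \<le> \<tau>" using s1 s2 S(1) E(3) by (simp_all add: \<tau>_def)
  have G2t: "row_submatrix q (transpose H2) = transpose G2"
    by (simp add: G2_def transpose_col_submatrix transpose_transpose)
  have \<sigma>1: "spectral_norm S \<le> \<sigma>1" by (rule spectral_norm_le[OF S(2)])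
  have C: "col_submatrix q M = H1 ** S ** G2 + EC"
    by (simp add: M_def col_submatrix_add col_submatrix_mult G2_def EC_def)
  have R: "row_submatrix p M = G1 ** S ** H2 + ER"
    by (simp add: M_def row_submatrix_add row_submatrix_mult G1_def ER_def)
  have W: "submatrix p q M = A + F"
    by (simp add: submatrix_eq_row_col C row_submatrix_add row_submatrix_mult G1_def EC_def F_def A_def)
  have EC: "spectral_norm EC \<le> \<epsilon>" and ER: "spectral_norm ER \<le> \<epsilon>" and F: "spectral_norm F \<le> \<epsilon>"
    unfolding EC_def ER_def F_def submatrix_eq_row_col
    using E(2) spectral_norm_col_submatrix_le[OF q, of E] spectral_norm_row_submatrix_le[OF p, of E]
      spectral_norm_row_submatrix_le[OF p, of "col_submatrix q E"] by linarith+
  obtain Y1 where Y1: "Y1 ** G1 = mat 1" "spectral_norm Y1 \<le> 1 / s1"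
    using exists_bounded_left_inverse[OF s1(1)] s1(2) unfolding G1_def by blast
  obtain Y2 where Y2: "Y2 ** transpose G2 = mat 1" "spectral_norm Y2 \<le> 1 / s2"
    using exists_bounded_left_inverse[OF s2(1)] s2(2) unfolding G2t by blast
  obtain X where X: "X ** S = mat 1" "spectral_norm X \<le> 1 / \<sigma>"
    using exists_bounded_left_inverse[OF S(1,3)] by blast
  define X2 where "X2 = transpose Y2"
  have X2: "G2 ** X2 = mat 1" "spectral_norm X2 \<le> 1 / s2"
  proof -
    have "transpose (Y2 ** transpose G2) = mat 1" by (simp add: Y2(1) transpose_mat)
    then show "G2 ** X2 = mat 1" by (simp add: X2_def matrix_transpose_mul transpose_transpose)
    show "spectral_norm X2 \<le> 1 / s2" using Y2(2) spectral_norm_transpose_le[of Y2] by (simp add: X2_def)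
  qed
  have SX: "S ** X = mat 1" using X(1) by (simp add: matrix_left_right_inverse)
  define Z where "Z = X2 ** X ** Y1"
  have Z: "spectral_norm Z \<le> 1 / \<tau>"
    using spectral_norm_mult_le_bound[OF spectral_norm_mult_le_bound[OF X2(2) X(2)] Y1(2)]
    by (simp add: Z_def \<tau>_def mult_ac)
  define L where "L = H1 ** S ** G2 ** Z"
  define K where "K = Z ** (G1 ** S ** H2)"
  have GX: "G2 *v (X2 *v x) = x" and SXx: "S *v (X *v x) = x" and YG: "Y1 *v (G1 *v x) = x" and XS: "X *v (S *v x) = x" for x
    using X2(1) SX Y1(1) X(1) by (simp_all add: matrix_vector_mul_assoc)
  have LA: "L ** A = H1 ** S ** G2" and AK: "A ** K = G1 ** S ** H2" and LAK: "L ** A ** K = H1 ** S ** H2"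
    by (simp_all add: matrix_eq L_def K_def Z_def A_def matrix_vector_mul_assoc[symmetric] GX SXx YG XS)
  have Lv: "spectral_norm L \<le> v"
  proof -
    have "spectral_norm G2 \<le> spectral_norm (transpose G2)"
      using spectral_norm_transpose_le[of "transpose G2"] by (simp add: transpose_transpose)
    then have "spectral_norm (H1 ** S ** G2) \<le> spectral_norm H1 * \<sigma>1 * spectral_norm (transpose G2)"
      by (intro spectral_norm_mult_le_bound \<sigma>1 order_refl)
    also have "\<dots> = (spectral_norm H1 * spectral_norm (transpose G2)) * \<sigma>1" by simp
    also have "\<dots> \<le> b * \<sigma>1"
      using b1 order_trans[OF spectral_norm_nonneg \<sigma>1] unfolding G2t by (rule mult_right_mono)
    finally show ?thesis
      unfolding L_def v \<tau>_def[symmetric] using spectral_norm_mult_le_bound[OF _ Z] by fastforce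
  qed
  have Kv: "spectral_norm K \<le> v"
  proof -
    have "spectral_norm H2 \<le> spectral_norm (transpose H2)"
      using spectral_norm_transpose_le[of "transpose H2"] by (simp add: transpose_transpose)
    then have "spectral_norm (G1 ** S ** H2) \<le> spectral_norm G1 * \<sigma>1 * spectral_norm (transpose H2)"
      by (intro spectral_norm_mult_le_bound \<sigma>1 order_refl)
    also have "\<dots> = (spectral_norm G1 * spectral_norm (transpose H2)) * \<sigma>1" by simp
    also have "\<dots> \<le> b * \<sigma>1"
      using b2 order_trans[OF spectral_norm_nonneg \<sigma>1] unfolding G1_def by (rule mult_right_mono)
    finally have "spectral_norm K \<le> 1 / \<tau> * (b * \<sigma>1)"
      unfolding K_def by (rule spectral_norm_mult_le_bound[OF Z])
    then show ?thesis unfolding v \<tau>_def by simp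
  qed
  define Wm where "Wm = submatrix p q M"
  have WA: "spectral_norm (Wm - A) \<le> \<epsilon>" using F by (simp add: Wm_def W)
  have inj: "inj ((*v) (transpose G2))"
    using Y2(1) matrix_left_invertible_injective[of "transpose G2"] by blast
  have lower: "\<tau> * norm (transpose G2 *v y) \<le> norm (A *v (transpose G2 *v y))" for y
  proof -
    define z where "z = transpose G2 *v y"
    have "s2 * norm z \<le> norm (G2 *v z)"
    proof (cases "y = 0")
      case False
      have "(s2 * norm z) * norm y \<le> norm z * norm z"
        using mult_left_mono[OF s2(2)[of y], of "norm z"] by (simp add: G2t z_def mult_ac)
      also have "\<dots> = (G2 *v z) \<bullet> y"
        by (simp add: z_def inner_mult_transpose dot_square_norm power2_eq_square)
      also have "\<dots> \<le> norm (G2 *v z) * norm y" by (rule norm_cauchy_schwarz)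
      finally show ?thesis using False by simp
    qed (simp add: z_def)
    then have "s1 * (\<sigma> * (s2 * norm z)) \<le> s1 * (\<sigma> * norm (G2 *v z))"
      using s1(1) S(1) by simp
    also have "\<dots> \<le> s1 * norm (S *v (G2 *v z))" using s1(1) S(3) by simp
    also have "\<dots> \<le> norm (G1 *v (S *v (G2 *v z)))" unfolding G1_def by (rule s1(2))
    finally show ?thesis by (simp add: \<tau>_def A_def z_def matrix_vector_mul_assoc matrix_mul_assoc mult_ac)
  qed
  have kernel: "A *v z = 0" if "G2 *v z = 0" for z
    using that by (simp add: A_def matrix_vector_mul_assoc[symmetric])
  have dW: "CARD('r) < svd_dim Wm" using dims by (simp add: svd_dim_def)
  have \<epsilon>\<tau>: "0 \<le> \<epsilon>" "\<epsilon> < \<tau>" using E(1) \<tau>(2) by simp_all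
  note tr = truncation_pinv_properties[where L=G2, OF trunc[folded Wm_def] dW WA \<epsilon>\<tau> inj lower kernel]
  have "spectral_norm (pinv B) * \<epsilon> \<le> 1 / (\<tau> - \<epsilon>) * \<epsilon>"
    using tr(2) E(1) by (intro mult_right_mono) auto
  also have "\<dots> \<le> 1 / 2" using E(1) \<tau>(2) by (simp add: field_simps)
  finally have Ub: "spectral_norm (pinv B) * \<epsilon> \<le> 1 / 2" .
  have Wm: "Wm = A + F" by (simp add: Wm_def W)
  have M: "M = L ** A ** K + E" unfolding LAK by (simp add: M_def)
  have C: "col_submatrix q M = L ** A + EC" unfolding LA by (rule C)
  have R: "row_submatrix p M = A ** K + ER" unfolding AK by (rule R)
  show ?thesis
    using cur_error_bound[OF tr(1,3,4,5) Ub Wm F E(2) EC ER Lv Kv] unfolding C R unfolding M .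
qed

lemma gaussian_matrix_bad_event:
  fixes H :: "'w \<Rightarrow> real ^ 'n ^ 'm" and f :: "'a::finite \<times> 'b::finite \<Rightarrow> 'm \<times> 'n"
  assumes P: "prob_space P" and H: "gaussian_matrix P H" and f: "inj f"
    and X: "\<And>\<omega>. X \<omega> = (\<chi> i j. H \<omega> $ fst (f (i, j)) $ snd (f (i, j)))"
    and S: "S \<in> sets borel"
  shows "{\<omega> \<in> space P. X \<omega> \<in> S} \<in> sets P"
    and "measure gauss S \<le> c \<Longrightarrow> measure P {\<omega> \<in> space P. X \<omega> \<in> S} \<le> c"
proof -
  have "X = (\<lambda>\<omega>. \<chi> i j. H \<omega> $ fst (f (i, j)) $ snd (f (i, j)))" using X by auto
  then have m: "X \<in> borel_measurable P" and d: "distr P borel X = gauss"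
    using gaussian_matrix_distr[OF P H f] by auto
  have eq: "{\<omega> \<in> space P. X \<omega> \<in> S} = X -` S \<inter> space P" by auto
  show "{\<omega> \<in> space P. X \<omega> \<in> S} \<in> sets P"
    unfolding eq by (rule measurable_sets[OF m S])
  have "measure P (X -` S \<inter> space P) = measure (distr P borel X) S"
    by (rule measure_distr[OF m S, symmetric])
  then show "measure P {\<omega> \<in> space P. X \<omega> \<in> S} \<le> c" if "measure gauss S \<le> c"
    using that by (simp add: eq d)
qed

lemma (in prob_space) prob_avoid_all_ge:
  assumes bs: "list_all (\<lambda>(b, c). b \<in> events \<and> prob b \<le> c) bs"
  shows "space M - (\<Union>(b, c)\<in>set bs. b) \<in> events
    \<and> prob (space M - (\<Union>(b, c)\<in>set bs. b)) \<ge> 1 - sum_list (map snd bs)"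
proof -
  have bs: "\<forall>(b, c)\<in>set bs. b \<in> events \<and> prob b \<le> c" using assms by (simp add: list_all_iff)
  have U: "(\<Union>(b, c)\<in>set bs. b) \<in> events"
    using bs by (intro sets.finite_UN) auto
  have "prob (\<Union>(b, c)\<in>set bs. b) \<le> sum_list (map snd bs)"
    using bs
  proof (induction bs)
    case (Cons bc bs)
    obtain b c where bc: "bc = (b, c)" by (cases bc)
    have "(\<Union>(b, c)\<in>set bs. b) \<in> events"
      using Cons.prems by (intro sets.finite_UN) auto
    then have "prob (b \<union> (\<Union>(b, c)\<in>set bs. b)) \<le> prob b + prob (\<Union>(b, c)\<in>set bs. b)"
      using Cons.prems by (intro measure_Un_le) (auto simp: bc)
    also have "\<dots> \<le> c + sum_list (map snd bs)"
      using Cons by (intro add_mono) (auto simp: bc)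
    finally show ?case by (simp add: bc)
  qed simp
  then show ?thesis using U prob_compl[OF U] by auto
qed

text \<open>
The factor \<open>\<surd>10\<close> in this threshold and in the next one: the bounds on norms, and likewise those on
least singular values, are used in pairs, whose product has to lose no more than the factor 10.
\<close>

definition norm_exceeds :: "real ^ 'r ^ 'k \<Rightarrow> bool" where
  "norm_exceeds G \<longleftrightarrow> (\<exists>y. sqrt 10 * (sqrt (real CARD('k)) + sqrt (real CARD('r))) * norm y < norm (G *v y))"

definition near_singular :: "real ^ 'r ^ 'k \<Rightarrow> bool" where
  "near_singular G \<longleftrightarrow> (\<exists>y. norm (G *v y) <
      (real CARD('k) - real CARD('r)) / (sqrt 10 * exp 1 * sqrt (real CARD('k))) * norm y)"

lemma norm_exceeds_event:
  shows "Collect (norm_exceeds :: real ^ 'r ^ 'k \<Rightarrow> bool) \<in> sets borel"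
    and "2 \<le> CARD('r) \<Longrightarrow> measure gauss (Collect (norm_exceeds :: real ^ 'r ^ 'k \<Rightarrow> bool)) \<le> 3 / 100"
  unfolding norm_exceeds_def by (intro borel_open open_matrices_exceeding) (rule gauss_norm_tail)

lemma near_singular_event:
  shows "Collect (near_singular :: real ^ 'r ^ 'k \<Rightarrow> bool) \<in> sets borel"
    and "CARD('r) + 2 \<le> CARD('k) \<Longrightarrow> measure gauss (Collect (near_singular :: real ^ 'r ^ 'k \<Rightarrow> bool)) \<le> 1 / 10"
  unfolding near_singular_def by (intro borel_open open_matrices_below) (rule gauss_small_tail)

lemma not_norm_exceedsD:
  fixes G :: "real ^ 'r ^ 'k"
  assumes "\<not> norm_exceeds G"
  shows "spectral_norm G \<le> sqrt 10 * (sqrt (real CARD('k)) + sqrt (real CARD('r)))"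
  using assms by (intro spectral_norm_le) (auto simp: norm_exceeds_def not_less)

theorem theorem5p2:
  fixes P :: "'w measure"
    and H1 :: "'w \<Rightarrow> real ^ 'r ^ 'm"
    and H2 :: "'w \<Rightarrow> real ^ 'n ^ 'r"
    and Sigma :: "real ^ 'r ^ 'r"
    and E :: "real ^ 'n ^ 'm"
    and I :: "'m set" and J :: "'n set"
    and p :: "'k::finite \<Rightarrow> 'm" and q :: "'l::finite \<Rightarrow> 'n"
    and k l m n \<rho> :: nat
    and \<alpha> \<beta> \<epsilon> \<zeta> \<nu> :: real
  assumes "k = CARD('k)" "l = CARD('l)" "m = CARD('m)" "n = CARD('n)" "\<rho> = CARD('r)"
    and "k < m" and "l < n" and "min k l \<ge> \<rho> + 2" and "\<rho> + 2 \<ge> 4"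
    and "prob_space P"
    and "gaussian_matrix P H1" and "gaussian_matrix P H2"
    and "indep_rvs P borel H1 borel H2"
    and "rank Sigma = \<rho>"
    and "card I = k" and "card J = l"
    and "bij_betw p UNIV I" and "bij_betw q UNIV J"
    and "\<alpha> = (exp 1)\<^sup>2 * sqrt (real k * real l) / ((real k - real \<rho>) * (real l - real \<rho>))"
    and "\<beta> = max ((sqrt (real m) + sqrt (real \<rho>)) * (sqrt (real \<rho>) + sqrt (real l)))
                 ((sqrt (real n) + sqrt (real \<rho>)) * (sqrt (real \<rho>) + sqrt (real k)))"
    and "0 < \<epsilon>" and "\<epsilon> \<le> singular_value \<rho> Sigma / (30 * \<alpha>)"
    and "spectral_norm E \<le> \<epsilon>"
    and "\<zeta> = (1 + sqrt 5) / 2"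
    and "\<nu> = 150 * \<alpha> * \<beta> * singular_value 1 Sigma / singular_value \<rho> Sigma + 1 / 2"
  shows "(\<exists>A \<in> sets P. measure P A \<ge> 0.6 \<and>
            (\<forall>\<omega>\<in>A. \<forall>B.
               let M = H1 \<omega> ** Sigma ** H2 \<omega> + E;
                   C = col_submatrix q M;
                   R = row_submatrix p M;
                   U = pinv B
               in is_truncation \<rho> (submatrix p q M) B \<longrightarrow>
                  spectral_norm (M - C ** U ** R) \<le> (4 * \<zeta> * (\<nu> + 1) + 2) * (\<nu> + 1) * \<epsilon>))
         \<and> 4 * \<zeta> \<le> 2 + 2 * sqrt 5"
proof -
  note cards = assms(1-5) and kl = assms(8) and \<rho>2 = assms(9) and P = assms(10)
    and gauss1 = assms(11) and gauss2 = assms(12) and rk = assms(14)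
    and \<alpha> = assms(19) and \<beta> = assms(20) and \<epsilon> = assms(21-23) and \<zeta> = assms(24) and \<nu> = assms(25)
  have p: "inj p" and q: "inj q" using assms(17,18) by (auto simp: bij_betw_def)
  define \<sigma> \<sigma>1 where "\<sigma> = singular_value \<rho> Sigma" and "\<sigma>1 = singular_value 1 Sigma"
  have S: "0 < \<sigma>" "\<And>x. norm (Sigma *v x) \<le> \<sigma>1 * norm x" "\<And>x. \<sigma> * norm x \<le> norm (Sigma *v x)"
    using singular_value_bounds_of_invertible[of Sigma] rk cards by (auto simp: \<sigma>_def \<sigma>1_def)
  define s where "s N = (real N - real \<rho>) / (sqrt 10 * exp 1 * sqrt (real N))" for N
  define T where "T N = sqrt 10 * (sqrt (real N) + sqrt (real \<rho>))" for N
  have k: "real k > real \<rho>" "real l > real \<rho>" "real \<rho> > 0" using kl \<rho>2 by auto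
  \<comment> \<open>the two lower thresholds multiply to \<open>1 / (10 \<alpha>)\<close>, so that \<open>\<epsilon> \<le> \<sigma> / (30 \<alpha>)\<close> is the gap condition\<close>
  have \<alpha>s: "s k * s l = 1 / (10 * \<alpha>)"
    using k by (simp add: s_def \<alpha> real_sqrt_mult field_simps power2_eq_square)
  have spos: "s k > 0" "s l > 0" using k by (simp_all add: s_def)
  then have \<alpha>pos: "\<alpha> > 0" using \<alpha>s by (metis mult_pos_pos zero_less_divide_1_iff zero_less_mult_iff zero_less_numeral not_numeral_less_zero)
  have TT: "T a * T b = 10 * ((sqrt (real a) + sqrt (real \<rho>)) * (sqrt (real \<rho>) + sqrt (real b)))" for a b
  proof -
    have "sqrt 10 * x * (sqrt 10 * y) = 10 * (x * y)" for x y :: real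
      using real_sqrt_mult_self[of 10] by (simp add: mult.assoc[symmetric] mult.commute[of x])
    then show ?thesis unfolding T_def by (simp only: add.commute)
  qed
  have Tkl: "T m * T l \<le> 10 * \<beta>" "T k * T n \<le> 10 * \<beta>"
    using mult.commute[of "T k" "T n"] unfolding TT \<beta> by auto
  let ?X2 = "\<lambda>\<omega>. row_submatrix p (H1 \<omega>)" and ?X3 = "\<lambda>\<omega>. transpose (H2 \<omega>)"
    and ?X4 = "\<lambda>\<omega>. row_submatrix q (transpose (H2 \<omega>))"
  have r2: "2 \<le> CARD('r)" and rk2: "CARD('r) + 2 \<le> CARD('k)" and rl2: "CARD('r) + 2 \<le> CARD('l)"
    using cards kl \<rho>2 by auto
  have inj2: "inj (\<lambda>(i, j :: 'r). (p i, j))" and inj3: "inj (\<lambda>(i :: 'n, j :: 'r). (j, i))"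
    and inj4: "inj (\<lambda>(i, j :: 'r). (j, q i))"
    using p q by (auto simp: inj_def)
  have X1: "H1 \<omega> = (\<chi> i j. H1 \<omega> $ fst (id (i, j)) $ snd (id (i, j)))" for \<omega> by (simp add: vec_eq_iff)
  have X2: "?X2 \<omega> = (\<chi> i j. H1 \<omega> $ fst ((\<lambda>(i, j). (p i, j)) (i, j)) $ snd ((\<lambda>(i, j). (p i, j)) (i, j)))" for \<omega>
    by (simp add: vec_eq_iff row_submatrix_def)
  have X3: "?X3 \<omega> = (\<chi> i j. H2 \<omega> $ fst ((\<lambda>(i, j). (j, i)) (i, j)) $ snd ((\<lambda>(i, j). (j, i)) (i, j)))" for \<omega>
    by (simp add: vec_eq_iff transpose_def)
  have X4: "?X4 \<omega> = (\<chi> i j. H2 \<omega> $ fst ((\<lambda>(i, j). (j, q i)) (i, j)) $ snd ((\<lambda>(i, j). (j, q i)) (i, j)))" for \<omega>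
    by (simp add: vec_eq_iff row_submatrix_def transpose_def)
  note ev1 = gaussian_matrix_bad_event[OF P gauss1 inj_on_id X1]
    and ev2 = gaussian_matrix_bad_event[OF P gauss1 inj2 X2]
    and ev3 = gaussian_matrix_bad_event[OF P gauss2 inj3 X3]
    and ev4 = gaussian_matrix_bad_event[OF P gauss2 inj4 X4]
  define bs where "bs = [({\<omega> \<in> space P. H1 \<omega> \<in> Collect norm_exceeds}, 3 / 100 :: real),
    ({\<omega> \<in> space P. ?X2 \<omega> \<in> Collect norm_exceeds}, 3 / 100),
    ({\<omega> \<in> space P. ?X3 \<omega> \<in> Collect norm_exceeds}, 3 / 100),
    ({\<omega> \<in> space P. ?X4 \<omega> \<in> Collect norm_exceeds}, 3 / 100),
    ({\<omega> \<in> space P. ?X2 \<omega> \<in> Collect near_singular}, 1 / 10),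
    ({\<omega> \<in> space P. ?X4 \<omega> \<in> Collect near_singular}, 1 / 10)]"
  define A where "A = space P - (\<Union>(b, c)\<in>set bs. b)"
  have "list_all (\<lambda>(b, c). b \<in> sets P \<and> measure P b \<le> c) bs"
    unfolding bs_def list.pred_inject(2) prod.case
    by (intro conjI list.pred_inject(1) ev1 ev2 ev3 ev4 norm_exceeds_event near_singular_event r2 rk2 rl2)
  from prob_space.prob_avoid_all_ge[OF P this]
  have A: "A \<in> sets P" "measure P A \<ge> 0.6" by (simp_all add: A_def bs_def)
  define M where "M \<omega> = H1 \<omega> ** Sigma ** H2 \<omega> + E" for \<omega>
  have bound: "spectral_norm (M \<omega> - col_submatrix q (M \<omega>) ** pinv B ** row_submatrix p (M \<omega>))
      \<le> (4 * \<zeta> * (\<nu> + 1) + 2) * (\<nu> + 1) * \<epsilon>"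
    if \<omega>: "\<omega> \<in> A" and B: "is_truncation \<rho> (submatrix p q (M \<omega>)) B" for \<omega> B
  proof -
    have good: "\<not> norm_exceeds (H1 \<omega>)" "\<not> norm_exceeds (?X2 \<omega>)" "\<not> norm_exceeds (?X3 \<omega>)" "\<not> norm_exceeds (?X4 \<omega>)"
      "\<not> near_singular (?X2 \<omega>)" "\<not> near_singular (?X4 \<omega>)"
      using \<omega> by (auto simp: A_def bs_def)
    have n: "spectral_norm (H1 \<omega>) \<le> T m" "spectral_norm (?X2 \<omega>) \<le> T k" "spectral_norm (?X3 \<omega>) \<le> T n"
      "spectral_norm (?X4 \<omega>) \<le> T l"
      using good(1-4)[THEN not_norm_exceedsD] by (simp_all add: T_def cards)
    have low: "s k * norm y \<le> norm (?X2 \<omega> *v y)" "s l * norm y \<le> norm (?X4 \<omega> *v y)" for y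
      using good(5,6) by (auto simp: near_singular_def s_def cards not_less)
    define v where "v = 10 * \<beta> * \<sigma>1 / (s k * s l * \<sigma>)"
    have e3: "3 * \<epsilon> \<le> s k * s l * \<sigma>"
      using \<epsilon>(2) \<alpha>pos unfolding \<alpha>s \<sigma>_def[symmetric] by (simp add: field_simps)
    have b1: "spectral_norm (H1 \<omega>) * spectral_norm (?X4 \<omega>) \<le> 10 * \<beta>"
      using mult_mono[OF n(1,4) order_trans[OF spectral_norm_nonneg n(1)] spectral_norm_nonneg] Tkl(1) by linarith
    have b2: "spectral_norm (?X2 \<omega>) * spectral_norm (?X3 \<omega>) \<le> 10 * \<beta>"
      using mult_mono[OF n(2,3) order_trans[OF spectral_norm_nonneg n(2)] spectral_norm_nonneg] Tkl(2) by linarith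
    have "spectral_norm (M \<omega> - col_submatrix q (M \<omega>) ** pinv B ** row_submatrix p (M \<omega>)) \<le> (9 / 2 * v\<^sup>2 + 3 * v + 3 / 2) * \<epsilon>"
      unfolding M_def
      by (rule cur_error_bound_of_factorization[where S=Sigma, OF p q _ _ S spos(1) low(1) spos(2) low(2) b1 b2 \<epsilon>(1,3) e3 _ v_def])
        (use rk2 rl2 B in \<open>simp_all add: M_def cards\<close>)
    also have "\<dots> \<le> (4 * \<zeta> * (\<nu> + 1) + 2) * (\<nu> + 1) * \<epsilon>"
    proof (rule mult_right_mono)
      have "\<sigma>1 \<ge> 0" using order_trans[OF spectral_norm_nonneg spectral_norm_le[OF S(2)]] .
      moreover have "\<beta> \<ge> 0" unfolding \<beta> by (simp add: le_max_iff_disj)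
      ultimately have v0: "v \<ge> 0" using spos S(1) by (simp add: v_def)
      have \<nu>v: "\<nu> = 3 / 2 * v + 1 / 2"
        unfolding \<nu> v_def \<alpha>s \<sigma>_def \<sigma>1_def by simp
      \<comment> \<open>the crude bound \<open>4 \<zeta> \<ge> 6\<close> is enough\<close>
      have "sqrt 5 \<ge> 2" by (rule real_le_rsqrt) simp
      then have "6 \<le> 4 * \<zeta>" by (simp add: \<zeta>)
      then have "(6 * (\<nu> + 1) + 2) * (\<nu> + 1) \<le> (4 * \<zeta> * (\<nu> + 1) + 2) * (\<nu> + 1)"
        using v0 \<nu>v by (intro mult_right_mono add_mono) auto
      moreover have "9 / 2 * v\<^sup>2 + 3 * v + 3 / 2 \<le> (6 * (\<nu> + 1) + 2) * (\<nu> + 1)"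
      proof -
        have "(6 * (\<nu> + 1) + 2) * (\<nu> + 1) = (9 / 2 * v\<^sup>2 + 3 * v + 3 / 2) + (9 * v\<^sup>2 + 27 * v + 15)"
          unfolding \<nu>v by (simp add: power2_eq_square algebra_simps)
        moreover have "0 \<le> 9 * v\<^sup>2 + 27 * v + 15" using v0 by simp
        ultimately show ?thesis by linarith
      qed
      ultimately show "9 / 2 * v\<^sup>2 + 3 * v + 3 / 2 \<le> (4 * \<zeta> * (\<nu> + 1) + 2) * (\<nu> + 1)" by linarith
    qed (use \<epsilon>(1) in simp)
    finally show ?thesis .
  qed
  have "4 * \<zeta> \<le> 2 + 2 * sqrt 5" by (simp add: \<zeta>)
  then show ?thesis using A bound unfolding Let_def M_def by blast
qed

end
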